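(* Let $S$ be a densely defined closed $\alpha$-sectorial operator in the complex Hilbert space $\mathfrak H$, let $\{\mathcal H,\Gamma\}$ be a boundary pair of $S$, and let $\langle \mathbf Z,X\rangle$ be an admissible pair. Then the $m$-accretive extension $\tilde S$ of $S$ determined by $\langle \mathbf Z,X\rangle$ is $m$-sectorial if and only if the following conditions are fulfilled: (1) $\operatorname{dom}(\mathbf Z)\subseteq\mathcal D_0$; (2) the sesquilinear form $$\omega[e,g]=(\mathbf Z e,g)_{\mathcal H}-\Omega_0[e,g]-2((X-X_0)e,X_0g)=(\mathbf Z e,g)_{\mathcal H}+\Omega_0^*[e,g]-2(Xe,X_0g),\quad e,g\in\operatorname{dom}(\mathbf Z)=\Gamma\operatorname{dom}(\tilde S),$$ is sectorial and admits a closure in the Hilbert space $\mathcal H'$; (3) there is $\delta\in[0,1)$ such that $\|(X-X_0)e\|^2\le\delta^2\operatorname{Re}\omega[e,e]$ for all $e\in\operatorname{dom}(\mathbf Z)$. Moreover, in this case the closed sesquilinear form associated with $\tilde S$ is given by $$\tilde S[u,v]=l[u,v]+\mathbf Z[\Gamma u,\Gamma v]+2(\overline X\,\Gamma u,S_{FR}^{1/2}\mathcal P_Fv),\qquad u,v\in D[\tilde S]=\Gamma^{-1}\operatorname{dom}(\overline\omega),$$ where $\overline\omega$ is the closure of $\omega$ in $\mathcal H'$, $\overline X$ is the continuous extension of $X$ to $\operatorname{dom}(\overline\omega)$ (continuity with respect to the inner product $(e,g)_{\mathcal H'}+(\operatorname{Re}\overline\omega)[e,g]$), and $$\mathbf Z[e,g]:=\overline\omega[e,g]-\Omega_0^*[e,g]+2(\overline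 Xe,X_0g),\qquad e,g\in\operatorname{dom}(\overline\omega).$$
   Context: Basic notions. $\mathfrak H$ is a complex Hilbert space, inner products are linear in the first argument. $\Theta(\alpha)=\{z\in\mathbb C:|\arg z|\le\alpha\}$, $\alpha\in[0,\pi/2)$. An operator $T$ is $\alpha$-sectorial if $(Tu,u)\in\Theta(\alpha)$ for all $u\in\operatorname{dom}(T)$, accretive if $\operatorname{Re}(Tu,u)\ge0$; sectorial means $\alpha$-sectorial for some $\alpha\in[0,\pi/2)$ (vertex always at the origin); the same terminology is used for sesquilinear forms. $m$-accretive: accretive, closed and without proper accretive extensions in $\mathfrak H$ (equivalently, densely defined closed with $T$ and $T^*$ accretive). $m$-sectorial: sectorial and $m$-accretive. $m$-sectorial operators $T$ are in bijection with closed densely defined sectorial forms $T[\cdot,\cdot]$ with domain $D[T]$, by $(Tu,v)=T[u,v]$, $u\in\operatorname{dom}(T)$, $v\in D[T]$. An $m$-accretive linear relation $\mathbf Z$ in a Hilbert space $\mathcal H$ is a linear subspace of $\mathcal H\times\mathcal H$ with $\operatorname{Re}(h,e)\ge0$ for all $\langle e,h\rangle\in\mathbf Z$ that has no proper extension with this property; then $(\mathbf Z e,g)_{\mathcal H}:=(h,g)_{\mathcal H}$ with $\langle e,h\rangle\in\mathbf Z$ is well defined for $e,g\in\operatorname{dom}(\mathbf Z)$. Friedrichs extension. $S[\cdot,\cdot]$ with domain $D[S]$ is the closure of the form $(Su,v)$, $u,v\in\operatorname{dom}(S)$; $S_F$ is the associated $m$-sectorial operator. $S_{FR}$ is the nonnegative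 selfadjoint operator associated with the real part of $S[\cdot,\cdot]$; $D[S]=\operatorname{dom}(S_{FR}^{1/2})$ and $S[u,v]=S_F[u,v]=((I+iG_F)S_{FR}^{1/2}u,S_{FR}^{1/2}v)$ with $G_F$ bounded selfadjoint in $\overline{\operatorname{ran}(S_{FR})}=\overline{\operatorname{ran}(S_F)}$. $\hat S_{FR}$ is $S_{FR}$ restricted to $\overline{\operatorname{ran}(S_F)}$, which is injective; $\hat S_{FR}^{-1/2}$ is defined on $R[S_F]:=\operatorname{ran}(S_{FR}^{1/2})$. Boundary pair. $\mathfrak N_\lambda=\ker(S^*-\lambda I)$. $\mathfrak L:=D[S]\dotplus\mathfrak N_z$ (direct sum) does not depend on $z\in\rho(S_F^* )$; $\mathcal P_{z,F},\mathcal P_z$ are the skew projectors of $\mathfrak L$ onto $D[S]$ and $\mathfrak N_z$; $\mathcal P_F:=\mathcal P_{i,F}$, and $\mathcal P_i$ is $\mathcal P_z$ for $z=i$. $\mathfrak L$ is a Hilbert space with the inner product $S_{FR}[\mathcal P_{-1,F}u,\mathcal P_{-1,F}v]+(\mathcal P_{-1}u,\mathcal P_{-1}v)+(u,v)$, where $S_{FR}[u,v]=(S_{FR}^{1/2}u,S_{FR}^{1/2}v)$. A boundary pair of $S$ is $\{\mathcal H,\Gamma\}$ with $\mathcal H$ a Hilbert space and $\Gamma:\mathfrak L\to\mathcal H$ bounded linear, $\ker\Gamma=D[S]$, $\operatorname{ran}\Gamma=\mathcal H$. $\gamma(\lambda):=(\Gamma\upharpoonright\mathfrak N_\lambda)^{-1}$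 is bounded from $\mathcal H$ to $\mathfrak H$, $\lambda\in\rho(S_F^* )$. On $\mathfrak L$ put $$l[u,v]=S_F[\mathcal P_Fu,\mathcal P_Fv]-i(\mathcal P_iu,\mathcal P_Fv)-i(\mathcal P_Fu,\mathcal P_iv)-i(\mathcal P_iu,\mathcal P_iv).$$ Admissible pairs and the correspondence. An admissible pair $\langle\mathbf Z,X\rangle$ consists of an $m$-accretive linear relation $\mathbf Z$ in $\mathcal H$ and a linear operator $X:\operatorname{dom}(\mathbf Z)\to\overline{\operatorname{ran}(S_F)}$ with $\|Xe\|^2\le\operatorname{Re}(\mathbf Z e,e)_{\mathcal H}$ for all $e\in\operatorname{dom}(\mathbf Z)$. It is known that $m$-accretive extensions $\tilde S$ of $S$ (all of which satisfy $\operatorname{dom}(\tilde S)\subseteq\mathfrak L$) are in bijection with admissible pairs: $\tilde S$ is determined by (corresponds to) $\langle\mathbf Z,X\rangle$ iff there is a linear operator $Z:\operatorname{dom}(\tilde S)\to\mathcal H$ such that $\mathbf Z=\{\langle\Gamma u,Zu\rangle:u\in\operatorname{dom}(\tilde S)\}$ and $$(\tilde Su,v)=l[u,v]+(Zu,\Gamma v)_{\mathcal H}+2(X\Gamma u,S_{FR}^{1/2}\mathcal P_Fv),\quad u\in\operatorname{dom}(\tilde S),\ v\in\mathfrak L.$$ The objects $\mathcal D_0,\Omega_0,X_0,\mathcal H'$. The Kreĭn–von Neumann extension $S_N$ of $S$ is an $m$-sectorial extension whose form has domain $D[S_N]=D[S]\dotplus(\mathfrak N_z\cap R[S_F])$,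 $z\in\rho(S_F^* )$ (independent of $z$). Put $\mathcal D_0=\Gamma D[S_N]=\{e\in\mathcal H:\gamma(i)e\in R[S_F]\}$ and, for $e,g\in\mathcal D_0$, $$\Omega_0[e,g]=i(\gamma(i)e,\gamma(i)g)+((I-iG_F)^{-1}\hat S_{FR}^{-1/2}\gamma(i)e,\hat S_{FR}^{-1/2}\gamma(i)g),\qquad X_0e=i(I-iG_F)^{-1}\hat S_{FR}^{-1/2}\gamma(i)e,$$ $\Omega_0^*[e,g]=\overline{\Omega_0[g,e]}$. One has $\operatorname{Re}\Omega_0[e,e]=\|X_0e\|^2$. $\mathcal H'$ is $\mathcal D_0$ with the inner product $(e,g)_{\mathcal H'}=(e,g)_{\mathcal H}+(X_0e,X_0g)$; it is a Hilbert space. *)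

theory Defs
  imports "HOL-Analysis.Analysis"
begin

section \<open>Complex Hilbert spaces\<close>

class scaleC =
  fixes scaleC :: "complex \<Rightarrow> 'a \<Rightarrow> 'a"  (infixr "*\<^sub>C" 75)

class complex_vector = real_vector + scaleC +
  assumes scaleC_add_right: "c *\<^sub>C (x + y) = c *\<^sub>C x + c *\<^sub>C y"
    and scaleC_add_left: "(c + d) *\<^sub>C x = c *\<^sub>C x + d *\<^sub>C x"
    and scaleC_scaleC: "c *\<^sub>C d *\<^sub>C x = (c * d) *\<^sub>C x"
    and scaleC_one: "1 *\<^sub>C x = x"
    and scaleR_scaleC: "r *\<^sub>R x = complex_of_real r *\<^sub>C x"

text \<open>Inner products are linear in the first argument.\<close>

class complex_inner = complex_vector + real_normed_vector +
  fixes cinner :: "'a \<Rightarrow> 'a \<Rightarrow> complex"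
  assumes cinner_commute: "cinner x y = cnj (cinner y x)"
    and cinner_add_left: "cinner (x + y) z = cinner x z + cinner y z"
    and cinner_scaleC_left: "cinner (c *\<^sub>C x) y = c * cinner x y"
    and norm_cinner: "cinner x x = complex_of_real ((norm x)\<^sup>2)"

class chilbert_space = complex_inner + complete_space

instantiation complex :: chilbert_space
begin
definition scaleC_complex :: "complex \<Rightarrow> complex \<Rightarrow> complex" where
  "scaleC_complex c x = c * x"
definition cinner_complex :: "complex \<Rightarrow> complex \<Rightarrow> complex" where
  "cinner_complex x y = x * cnj y"
instance
proof
  fix c d x y z :: complex and r :: real
  show "c *\<^sub>C (x + y) = c *\<^sub>C x + c *\<^sub>C y" "(c + d) *\<^sub>C x = c *\<^sub>C x + d *\<^sub>C x"
    "c *\<^sub>C d *\<^sub>C x = (c * d) *\<^sub>C x" "1 *\<^sub>C x = x" "r *\<^sub>R x = complex_of_real r *\<^sub>C x"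
    by (simp_all add: scaleC_complex_def distrib_left distrib_right mult.assoc scaleR_conv_of_real)
  show "cinner x y = cnj (cinner y x)"
    by (simp add: cinner_complex_def mult.commute)
  show "cinner (x + y) z = cinner x z + cinner y z" "cinner (c *\<^sub>C x) y = c * cinner x y"
    by (simp_all add: cinner_complex_def scaleC_complex_def distrib_right mult.assoc)
  show "cinner x x = complex_of_real ((norm x)\<^sup>2)"
    unfolding cinner_complex_def by (rule complex_norm_square[symmetric])
qed
end

instantiation prod :: (complex_vector, complex_vector) complex_vector
begin
definition scaleC_prod :: "complex \<Rightarrow> 'a \<times> 'b \<Rightarrow> 'a \<times> 'b" where
  "scaleC_prod c p = (c *\<^sub>C fst p, c *\<^sub>C snd p)"
instance
proof
  fix c d :: complex and x y :: "'a \<times> 'b" and r :: real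
  show "c *\<^sub>C (x + y) = c *\<^sub>C x + c *\<^sub>C y" by (simp add: scaleC_prod_def scaleC_add_right)
  show "(c + d) *\<^sub>C x = c *\<^sub>C x + d *\<^sub>C x" by (simp add: scaleC_prod_def scaleC_add_left)
  show "c *\<^sub>C d *\<^sub>C x = (c * d) *\<^sub>C x" by (simp add: scaleC_prod_def scaleC_scaleC)
  show "1 *\<^sub>C x = x" by (simp add: scaleC_prod_def scaleC_one)
  show "r *\<^sub>R x = complex_of_real r *\<^sub>C x"
    by (simp add: scaleC_prod_def scaleR_prod_def scaleR_scaleC)
qed
end

definition csubspace :: "'a::complex_vector set \<Rightarrow> bool" where
  "csubspace V \<longleftrightarrow> 0 \<in> V \<and> (\<forall>x\<in>V. \<forall>y\<in>V. x + y \<in> V) \<and> (\<forall>c. \<forall>x\<in>V. c *\<^sub>C x \<in> V)"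

definition clinear_on :: "'a::complex_vector set \<Rightarrow> ('a \<Rightarrow> 'b::complex_vector) \<Rightarrow> bool" where
  "clinear_on V f \<longleftrightarrow> csubspace V \<and> (\<forall>x\<in>V. \<forall>y\<in>V. f (x + y) = f x + f y)
     \<and> (\<forall>c. \<forall>x\<in>V. f (c *\<^sub>C x) = c *\<^sub>C f x)"


section \<open>Unbounded operators and linear relations\<close>

text \<open>Operators and linear relations are identified with their graphs; the domain and the range
  are \<open>Domain\<close> and \<open>Range\<close>, extension is inclusion, and the product is relational composition.\<close>

definition linear_operator :: "('a::complex_vector \<times> 'b::complex_vector) set \<Rightarrow> bool" where
  "linear_operator T \<longleftrightarrow> csubspace T \<and> single_valued T"

definition op_app :: "('a \<times> 'b) set \<Rightarrow> 'a \<Rightarrow> 'b" where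
  "op_app T u = (THE h. (u, h) \<in> T)"

definition densely_defined :: "('a::topological_space \<times> 'b) set \<Rightarrow> bool" where
  "densely_defined T \<longleftrightarrow> closure (Domain T) = UNIV"

definition adjoint_op :: "('a::complex_inner \<times> 'a) set \<Rightarrow> ('a \<times> 'a) set" where
  "adjoint_op T = {(v, w). \<forall>(u, h)\<in>T. cinner h v = cinner u w}"

definition defect_space :: "('a::complex_inner \<times> 'a) set \<Rightarrow> complex \<Rightarrow> 'a set" where
  "defect_space S z = {u. (u, z *\<^sub>C u) \<in> adjoint_op S}"

definition sector :: "real \<Rightarrow> complex set" where
  "sector \<alpha> = {z. \<bar>Arg z\<bar> \<le> \<alpha>}"

definition sectorial_angle_op :: "real \<Rightarrow> ('a::complex_inner \<times> 'a) set \<Rightarrow> bool" where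
  "sectorial_angle_op \<alpha> T \<longleftrightarrow> (\<forall>(u, h)\<in>T. cinner h u \<in> sector \<alpha>)"

definition accretive :: "('a::complex_inner \<times> 'a) set \<Rightarrow> bool" where
  "accretive T \<longleftrightarrow> (\<forall>(u, h)\<in>T. Re (cinner h u) \<ge> 0)"

text \<open>Maximality of an operator is among operators, maximality of a relation is among linear
  relations.\<close>

definition m_accretive_op :: "('a::complex_inner \<times> 'a) set \<Rightarrow> bool" where
  "m_accretive_op T \<longleftrightarrow> linear_operator T \<and> accretive T \<and> closed T
     \<and> (\<forall>T'. linear_operator T' \<and> accretive T' \<and> T \<subseteq> T' \<longrightarrow> T' = T)"

definition m_accretive_rel :: "('a::complex_inner \<times> 'a) set \<Rightarrow> bool" where
  "m_accretive_rel Z \<longleftrightarrow> csubspace Z \<and> accretive Z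
     \<and> (\<forall>Z'. csubspace Z' \<and> accretive Z' \<and> Z \<subseteq> Z' \<longrightarrow> Z' = Z)"

definition m_sectorial_op :: "('a::complex_inner \<times> 'a) set \<Rightarrow> bool" where
  "m_sectorial_op T \<longleftrightarrow> (\<exists>\<alpha>. 0 \<le> \<alpha> \<and> \<alpha> < pi / 2 \<and> sectorial_angle_op \<alpha> T) \<and> m_accretive_op T"

definition nonneg_selfadjoint :: "('a::complex_inner \<times> 'a) set \<Rightarrow> bool" where
  "nonneg_selfadjoint A \<longleftrightarrow> linear_operator A \<and> densely_defined A \<and> adjoint_op A = A
     \<and> (\<forall>(u, h)\<in>A. Re (cinner h u) \<ge> 0)"

definition is_sqrt_op :: "('a::complex_inner \<times> 'a) set \<Rightarrow> ('a \<times> 'a) set \<Rightarrow> bool" where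
  "is_sqrt_op A B \<longleftrightarrow> nonneg_selfadjoint B \<and> B O B = A"

text \<open>The number \<open>(Z e, g) = (h, g)\<close> with \<open>(e, h) \<in> Z\<close>, for \<open>e\<close> and \<open>g\<close> in the domain of an
  m-accretive relation \<open>Z\<close>.\<close>

definition rel_form :: "('h::complex_inner \<times> 'h) set \<Rightarrow> 'h \<Rightarrow> 'h \<Rightarrow> complex" where
  "rel_form Z e g = (THE c. \<exists>h. (e, h) \<in> Z \<and> c = cinner h g)"


section \<open>Sesquilinear forms\<close>

definition sesquilinear_on :: "'a::complex_vector set \<Rightarrow> ('a \<Rightarrow> 'a \<Rightarrow> complex) \<Rightarrow> bool" where
  "sesquilinear_on D t \<longleftrightarrow> csubspace D
     \<and> (\<forall>u\<in>D. \<forall>v\<in>D. \<forall>w\<in>D. t (u + v) w = t u w + t v w \<and> t w (u + v) = t w u + t w v)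
     \<and> (\<forall>c. \<forall>u\<in>D. \<forall>v\<in>D. t (c *\<^sub>C u) v = c * t u v \<and> t u (c *\<^sub>C v) = cnj c * t u v)"

definition sectorial_form :: "'a::complex_vector set \<Rightarrow> ('a \<Rightarrow> 'a \<Rightarrow> complex) \<Rightarrow> bool" where
  "sectorial_form D t \<longleftrightarrow> sesquilinear_on D t
     \<and> (\<exists>\<alpha>. 0 \<le> \<alpha> \<and> \<alpha> < pi / 2 \<and> (\<forall>u\<in>D. t u u \<in> sector \<alpha>))"

definition form_adj :: "('a \<Rightarrow> 'a \<Rightarrow> complex) \<Rightarrow> 'a \<Rightarrow> 'a \<Rightarrow> complex" where
  "form_adj t u v = cnj (t v u)"

definition form_re :: "('a \<Rightarrow> 'a \<Rightarrow> complex) \<Rightarrow> 'a \<Rightarrow> 'a \<Rightarrow> complex" where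
  "form_re t u v = (t u v + form_adj t u v) / 2"

text \<open>The next notions are relative to an ambient Hilbert space that is given by its underlying
  vector space \<open>K\<close> and its norm \<open>N\<close>; this is needed because the space \<open>\<H>'\<close> of the theorem is a
  linear submanifold of \<open>\<H>\<close> with its own norm.\<close>

definition form_conv ::
  "('a::complex_vector \<Rightarrow> real) \<Rightarrow> ('a \<Rightarrow> 'a \<Rightarrow> complex) \<Rightarrow> (nat \<Rightarrow> 'a) \<Rightarrow> 'a \<Rightarrow> bool" where
  "form_conv N t x u \<longleftrightarrow> (\<lambda>n. N (x n - u)) \<longlonglongrightarrow> 0
     \<and> (\<forall>\<epsilon>>0. \<exists>M. \<forall>m\<ge>M. \<forall>n\<ge>M. cmod (t (x m - x n) (x m - x n)) < \<epsilon>)"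

definition closed_form ::
  "'a::complex_vector set \<Rightarrow> ('a \<Rightarrow> real) \<Rightarrow> 'a set \<Rightarrow> ('a \<Rightarrow> 'a \<Rightarrow> complex) \<Rightarrow> bool" where
  "closed_form K N D t \<longleftrightarrow> D \<subseteq> K \<and>
     (\<forall>x u. (\<forall>n. x n \<in> D) \<and> u \<in> K \<and> form_conv N t x u \<longrightarrow>
        u \<in> D \<and> (\<lambda>n. t (x n - u) (x n - u)) \<longlonglongrightarrow> 0)"

definition admits_closure ::
  "'a::complex_vector set \<Rightarrow> ('a \<Rightarrow> real) \<Rightarrow> 'a set \<Rightarrow> ('a \<Rightarrow> 'a \<Rightarrow> complex) \<Rightarrow> bool" where
  "admits_closure K N D t \<longleftrightarrow>
     (\<exists>D' t'. sectorial_form D' t' \<and> closed_form K N D' t' \<and> D \<subseteq> D'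
        \<and> (\<forall>u\<in>D. \<forall>v\<in>D. t' u v = t u v))"

definition closure_dom ::
  "'a::complex_vector set \<Rightarrow> ('a \<Rightarrow> real) \<Rightarrow> 'a set \<Rightarrow> ('a \<Rightarrow> 'a \<Rightarrow> complex) \<Rightarrow> 'a set" where
  "closure_dom K N D t = {u \<in> K. \<exists>x. (\<forall>n. x n \<in> D) \<and> form_conv N t x u}"

definition closure_form ::
  "('a::complex_vector \<Rightarrow> real) \<Rightarrow> 'a set \<Rightarrow> ('a \<Rightarrow> 'a \<Rightarrow> complex) \<Rightarrow> 'a \<Rightarrow> 'a \<Rightarrow> complex" where
  "closure_form N D t u v = (THE c. \<exists>x y. (\<forall>n. x n \<in> D) \<and> (\<forall>n. y n \<in> D)
      \<and> form_conv N t x u \<and> form_conv N t y v \<and> (\<lambda>n. t (x n) (y n)) \<longlonglongrightarrow> c)"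

definition form_operator ::
  "'a::complex_inner set \<Rightarrow> ('a \<Rightarrow> 'a \<Rightarrow> complex) \<Rightarrow> ('a \<times> 'a) set" where
  "form_operator D t = {(u, h). u \<in> D \<and> (\<forall>v\<in>D. t u v = cinner h v)}"

text \<open>For an m-sectorial operator \<open>T\<close>, the closed form \<open>T[\<cdot>,\<cdot>]\<close> with domain \<open>D[T]\<close>.\<close>

definition associated_form ::
  "('a::complex_inner \<times> 'a) set \<Rightarrow> 'a set \<Rightarrow> ('a \<Rightarrow> 'a \<Rightarrow> complex) \<Rightarrow> bool" where
  "associated_form T D t \<longleftrightarrow> sectorial_form D t \<and> closed_form UNIV norm D t \<and> closure D = UNIV
     \<and> Domain T \<subseteq> D \<and> (\<forall>u\<in>Domain T. \<forall>v\<in>D. cinner (op_app T u) v = t u v)"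


section \<open>The Friedrichs extension\<close>

definition DS :: "('a::complex_inner \<times> 'a) set \<Rightarrow> 'a set" where
  "DS S = closure_dom UNIV norm (Domain S) (\<lambda>u v. cinner (op_app S u) v)"

definition S_form :: "('a::complex_inner \<times> 'a) set \<Rightarrow> 'a \<Rightarrow> 'a \<Rightarrow> complex" where
  "S_form S = closure_form norm (Domain S) (\<lambda>u v. cinner (op_app S u) v)"

definition S_F :: "('a::complex_inner \<times> 'a) set \<Rightarrow> ('a \<times> 'a) set" where
  "S_F S = form_operator (DS S) (S_form S)"

definition S_FR :: "('a::complex_inner \<times> 'a) set \<Rightarrow> ('a \<times> 'a) set" where
  "S_FR S = form_operator (DS S) (form_re (S_form S))"

definition ran_SF :: "('a::complex_inner \<times> 'a) set \<Rightarrow> 'a set" where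
  "ran_SF S = closure (Range (S_F S))"

text \<open>From here on \<open>R\<close> stands for the nonnegative selfadjoint square root of \<open>S\<^sub>F\<^sub>R\<close> and \<open>G\<close> for \<open>G\<^sub>F\<close>. The operator \<open>G\<^sub>F\<close> acts in the
  closed subspace \<open>ran_SF S\<close>, so the values of \<open>G\<close> elsewhere are irrelevant.\<close>

definition is_GF :: "('a::complex_inner \<times> 'a) set \<Rightarrow> ('a \<times> 'a) set \<Rightarrow> ('a \<Rightarrow> 'a) \<Rightarrow> bool" where
  "is_GF S R G \<longleftrightarrow> clinear_on (ran_SF S) G \<and> G ` ran_SF S \<subseteq> ran_SF S
     \<and> (\<exists>C. \<forall>x\<in>ran_SF S. norm (G x) \<le> C * norm x)
     \<and> (\<forall>x\<in>ran_SF S. \<forall>y\<in>ran_SF S. cinner (G x) y = cinner x (G y))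
     \<and> (\<forall>u\<in>DS S. \<forall>v\<in>DS S.
          S_form S u v = cinner (op_app R u + \<i> *\<^sub>C G (op_app R u)) (op_app R v))"

definition SFR_inv_sqrt :: "('a::complex_inner \<times> 'a) set \<Rightarrow> ('a \<times> 'a) set \<Rightarrow> 'a \<Rightarrow> 'a" where
  "SFR_inv_sqrt S R f = (THE x. x \<in> ran_SF S \<and> (x, f) \<in> R)"

definition inv_I_minus_iG :: "('a::complex_inner \<times> 'a) set \<Rightarrow> ('a \<Rightarrow> 'a) \<Rightarrow> 'a \<Rightarrow> 'a" where
  "inv_I_minus_iG S G = the_inv_into (ran_SF S) (\<lambda>x. x - \<i> *\<^sub>C G x)"


section \<open>Boundary pairs\<close>

text \<open>The space \<open>\<LL> = D[S] \<dotplus> \<NN>\<^sub>z\<close> does not depend on the regular point \<open>z\<close> of \<open>S\<^sub>F\<^sup>*\<close>. It is taken with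
  \<open>z = \<i>\<close>, which is regular, like \<open>-1\<close>, since the sector is strictly inside the right
  half-plane.\<close>

definition LL :: "('a::complex_inner \<times> 'a) set \<Rightarrow> 'a set" where
  "LL S = {u + w | u w. u \<in> DS S \<and> w \<in> defect_space S \<i>}"

definition projF :: "('a::complex_inner \<times> 'a) set \<Rightarrow> complex \<Rightarrow> 'a \<Rightarrow> 'a" where
  "projF S z u = (THE d. d \<in> DS S \<and> u - d \<in> defect_space S z)"

definition projN :: "('a::complex_inner \<times> 'a) set \<Rightarrow> complex \<Rightarrow> 'a \<Rightarrow> 'a" where
  "projN S z u = (THE w. w \<in> defect_space S z \<and> u - w \<in> DS S)"

definition LL_inner :: "('a::complex_inner \<times> 'a) set \<Rightarrow> ('a \<times> 'a) set \<Rightarrow> 'a \<Rightarrow> 'a \<Rightarrow> complex" where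
  "LL_inner S R u v = cinner (op_app R (projF S (-1) u)) (op_app R (projF S (-1) v))
     + cinner (projN S (-1) u) (projN S (-1) v) + cinner u v"

definition LL_norm :: "('a::complex_inner \<times> 'a) set \<Rightarrow> ('a \<times> 'a) set \<Rightarrow> 'a \<Rightarrow> real" where
  "LL_norm S R u = sqrt (Re (LL_inner S R u u))"

definition boundary_pair ::
  "('a::complex_inner \<times> 'a) set \<Rightarrow> ('a \<times> 'a) set \<Rightarrow> ('a \<Rightarrow> 'h::chilbert_space) \<Rightarrow> bool" where
  "boundary_pair S R \<Gamma> \<longleftrightarrow> clinear_on (LL S) \<Gamma>
     \<and> (\<exists>C. \<forall>u\<in>LL S. norm (\<Gamma> u) \<le> C * LL_norm S R u)
     \<and> {u \<in> LL S. \<Gamma> u = 0} = DS S \<and> \<Gamma> ` LL S = UNIV"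

definition gamma_field ::
  "('a::complex_inner \<times> 'a) set \<Rightarrow> ('a \<Rightarrow> 'h) \<Rightarrow> complex \<Rightarrow> 'h \<Rightarrow> 'a" where
  "gamma_field S \<Gamma> z = the_inv_into (defect_space S z) \<Gamma>"

definition l_form :: "('a::complex_inner \<times> 'a) set \<Rightarrow> 'a \<Rightarrow> 'a \<Rightarrow> complex" where
  "l_form S u v = S_form S (projF S \<i> u) (projF S \<i> v)
     - \<i> * cinner (projN S \<i> u) (projF S \<i> v)
     - \<i> * cinner (projF S \<i> u) (projN S \<i> v)
     - \<i> * cinner (projN S \<i> u) (projN S \<i> v)"

definition admissible_pair ::
  "('a::complex_inner \<times> 'a) set \<Rightarrow> ('h::complex_inner \<times> 'h) set \<Rightarrow> ('h \<Rightarrow> 'a) \<Rightarrow> bool" where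
  "admissible_pair S Z X \<longleftrightarrow> m_accretive_rel Z \<and> clinear_on (Domain Z) X
     \<and> X ` Domain Z \<subseteq> ran_SF S
     \<and> (\<forall>e\<in>Domain Z. (norm (X e))\<^sup>2 \<le> Re (rel_form Z e e))"

text \<open>The m-accretive extension \<open>T\<close> corresponds to the admissible pair \<open>(Z, X)\<close>.\<close>

definition corresponds ::
  "('a::complex_inner \<times> 'a) set \<Rightarrow> ('a \<times> 'a) set \<Rightarrow> ('a \<Rightarrow> 'h::complex_inner)
     \<Rightarrow> ('h \<times> 'h) set \<Rightarrow> ('h \<Rightarrow> 'a) \<Rightarrow> ('a \<times> 'a) set \<Rightarrow> bool" where
  "corresponds S R \<Gamma> Z X T \<longleftrightarrow> Domain T \<subseteq> LL S \<and>
     (\<exists>Y. clinear_on (Domain T) Y \<and> Z = {(\<Gamma> u, Y u) | u. u \<in> Domain T} \<and>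
        (\<forall>u\<in>Domain T. \<forall>v\<in>LL S.
           cinner (op_app T u) v = l_form S u v + cinner (Y u) (\<Gamma> v)
             + 2 * cinner (X (\<Gamma> u)) (op_app R (projF S \<i> v))))"


section \<open>The objects attached to the Krein--von Neumann extension\<close>

definition D0 ::
  "('a::complex_inner \<times> 'a) set \<Rightarrow> ('a \<times> 'a) set \<Rightarrow> ('a \<Rightarrow> 'h) \<Rightarrow> 'h set" where
  "D0 S R \<Gamma> = {e. gamma_field S \<Gamma> \<i> e \<in> Range R}"

definition X0 :: "('a::complex_inner \<times> 'a) set \<Rightarrow> ('a \<times> 'a) set \<Rightarrow> ('a \<Rightarrow> 'a)
     \<Rightarrow> ('a \<Rightarrow> 'h) \<Rightarrow> 'h \<Rightarrow> 'a" where
  "X0 S R G \<Gamma> e = \<i> *\<^sub>C inv_I_minus_iG S G (SFR_inv_sqrt S R (gamma_field S \<Gamma> \<i> e))"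

definition Omega0 :: "('a::complex_inner \<times> 'a) set \<Rightarrow> ('a \<times> 'a) set \<Rightarrow> ('a \<Rightarrow> 'a)
     \<Rightarrow> ('a \<Rightarrow> 'h) \<Rightarrow> 'h \<Rightarrow> 'h \<Rightarrow> complex" where
  "Omega0 S R G \<Gamma> e g = \<i> * cinner (gamma_field S \<Gamma> \<i> e) (gamma_field S \<Gamma> \<i> g)
     + cinner (inv_I_minus_iG S G (SFR_inv_sqrt S R (gamma_field S \<Gamma> \<i> e)))
              (SFR_inv_sqrt S R (gamma_field S \<Gamma> \<i> g))"

definition H'_norm :: "('a::complex_inner \<times> 'a) set \<Rightarrow> ('a \<times> 'a) set \<Rightarrow> ('a \<Rightarrow> 'a)
     \<Rightarrow> ('a \<Rightarrow> 'h::complex_inner) \<Rightarrow> 'h \<Rightarrow> real" where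
  "H'_norm S R G \<Gamma> e = sqrt (Re (cinner e e + cinner (X0 S R G \<Gamma> e) (X0 S R G \<Gamma> e)))"

definition omega :: "('a::complex_inner \<times> 'a) set \<Rightarrow> ('a \<times> 'a) set \<Rightarrow> ('a \<Rightarrow> 'a)
     \<Rightarrow> ('a \<Rightarrow> 'h::complex_inner) \<Rightarrow> ('h \<times> 'h) set \<Rightarrow> ('h \<Rightarrow> 'a) \<Rightarrow> 'h \<Rightarrow> 'h \<Rightarrow> complex" where
  "omega S R G \<Gamma> Z X e g = rel_form Z e g - Omega0 S R G \<Gamma> e g
     - 2 * cinner (X e - X0 S R G \<Gamma> e) (X0 S R G \<Gamma> g)"

definition omega_bar_dom :: "('a::complex_inner \<times> 'a) set \<Rightarrow> ('a \<times> 'a) set \<Rightarrow> ('a \<Rightarrow> 'a)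
     \<Rightarrow> ('a \<Rightarrow> 'h::complex_inner) \<Rightarrow> ('h \<times> 'h) set \<Rightarrow> ('h \<Rightarrow> 'a) \<Rightarrow> 'h set" where
  "omega_bar_dom S R G \<Gamma> Z X =
     closure_dom (D0 S R \<Gamma>) (H'_norm S R G \<Gamma>) (Domain Z) (omega S R G \<Gamma> Z X)"

definition omega_bar :: "('a::complex_inner \<times> 'a) set \<Rightarrow> ('a \<times> 'a) set \<Rightarrow> ('a \<Rightarrow> 'a)
     \<Rightarrow> ('a \<Rightarrow> 'h::complex_inner) \<Rightarrow> ('h \<times> 'h) set \<Rightarrow> ('h \<Rightarrow> 'a) \<Rightarrow> 'h \<Rightarrow> 'h \<Rightarrow> complex" where
  "omega_bar S R G \<Gamma> Z X = closure_form (H'_norm S R G \<Gamma>) (Domain Z) (omega S R G \<Gamma> Z X)"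

text \<open>\<open>Xb\<close> extends \<open>X\<close> to a linear operator on \<open>dom \<omega>\<close>-bar that is continuous for the inner product
  \<open>(e, g)\<^bsub>\<H>'\<^esub> + (Re \<omega>-bar)[e, g]\<close>.\<close>

definition is_X_bar :: "('a::complex_inner \<times> 'a) set \<Rightarrow> ('a \<times> 'a) set \<Rightarrow> ('a \<Rightarrow> 'a)
     \<Rightarrow> ('a \<Rightarrow> 'h::complex_inner) \<Rightarrow> ('h \<times> 'h) set \<Rightarrow> ('h \<Rightarrow> 'a) \<Rightarrow> ('h \<Rightarrow> 'a) \<Rightarrow> bool" where
  "is_X_bar S R G \<Gamma> Z X Xb \<longleftrightarrow> clinear_on (omega_bar_dom S R G \<Gamma> Z X) Xb
     \<and> (\<forall>e\<in>Domain Z. Xb e = X e)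
     \<and> (\<exists>C. \<forall>e\<in>omega_bar_dom S R G \<Gamma> Z X.
          norm (Xb e) \<le> C * sqrt ((H'_norm S R G \<Gamma> e)\<^sup>2 + Re (omega_bar S R G \<Gamma> Z X e e)))"

definition Z_form :: "('a::complex_inner \<times> 'a) set \<Rightarrow> ('a \<times> 'a) set \<Rightarrow> ('a \<Rightarrow> 'a)
     \<Rightarrow> ('a \<Rightarrow> 'h::complex_inner) \<Rightarrow> ('h \<times> 'h) set \<Rightarrow> ('h \<Rightarrow> 'a) \<Rightarrow> ('h \<Rightarrow> 'a)
     \<Rightarrow> 'h \<Rightarrow> 'h \<Rightarrow> complex" where
  "Z_form S R G \<Gamma> Z X Xb e g = omega_bar S R G \<Gamma> Z X e g
     - form_adj (Omega0 S R G \<Gamma>) e g + 2 * cinner (Xb e) (X0 S R G \<Gamma> g)"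

end

theory Submission
  imports Defs
begin

text \<open>Every \<open>u\<close> in the space \<open>\<LL>\<close> splits as \<open>u = u\<^sub>F + \<gamma>(i)\<Gamma>u\<close> with \<open>u\<^sub>F \<in> D[S]\<close>, and the proof rests on the
  vector \<open>\<xi>\<^sub>u = S\<^sub>F\<^sub>R\<^sup>1\<^sup>/\<^sup>2 u\<^sub>F + X\<^sub>0\<Gamma>u\<close>, which is defined when \<open>\<Gamma>u \<in> \<D>\<^sub>0\<close>. Completing the square in \<open>l\<close>
  (\<open>l_form_eq\<close>) turns the formula for the extension into (\<open>T_split\<close>)

  \<open>(Tu,v) = ((I + iG)\<xi>\<^sub>u, \<xi>\<^sub>v) + 2((X - X\<^sub>0)\<Gamma>u, \<xi>\<^sub>v) + \<omega>[\<Gamma>u, \<Gamma>v]\<close>.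

  The first term is the form of the Krein-von Neumann extension, the last one depends on boundary
  values only, and the middle one couples them. If \<open>\<omega>\<close> is sectorial and \<open>\<parallel>(X - X\<^sub>0)e\<parallel>\<^sup>2 \<le> \<delta>\<^sup>2 Re \<omega>[e]\<close>
  with \<open>\<delta> < 1\<close>, then the coupling is absorbed, \<open>Re (Tu,u)\<close> is comparable to
  \<open>\<parallel>\<xi>\<^sub>u\<parallel>\<^sup>2 + Re \<omega>[\<Gamma>u]\<close>, and it controls the imaginary part (\<open>coupled_form_bounds\<close>,
  \<open>sectorial_if\<close>).

  Conversely, let the extension be sectorial. The Cauchy-Schwarz inequality for its form, applied
  to \<open>u\<close> and to vectors of \<open>dom S\<close>, shows that \<open>\<gamma>(i)\<Gamma>u\<close> lies in the range of the square root
  (\<open>dom_Z_D0_if_sectorial\<close>). Adding vectors of \<open>dom S\<close> to \<open>u\<close> keeps \<open>\<Gamma>u\<close> and moves \<open>\<xi>\<^sub>u\<close> through a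
  dense subset of the closed range, so the sector condition holds with \<open>\<xi>\<^sub>u\<close> replaced by any \<open>\<eta>\<close> in
  the closed range (\<open>sector_condition_free\<close>). The choice \<open>\<eta> = 0\<close> gives sectoriality of \<open>\<omega>\<close>, and a
  complex perturbation of \<open>\<eta> = -(X - X\<^sub>0)e\<close> gives the strict contraction (\<open>X_contraction\<close>).
  Null sequences in \<open>\<H>'\<close> lift to null sequences in \<open>dom T\<close>, so \<open>\<omega>\<close> inherits closability from the
  operator (\<open>closable_\<omega>\<close>); this needs boundedness of the gamma field, hence a bounded inverse
  theorem.

  For the closed form, the same formula with \<open>\<omega>\<close> and \<open>X\<close> replaced by their closures is taken as
  the definition. It is closed because convergence of \<open>u\<^sub>n\<close> in \<open>\<HH>\<close> and of \<open>\<xi>\<close> along \<open>u\<^sub>n\<close> forces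
  convergence of \<open>\<Gamma>u\<^sub>n\<close> in \<open>\<H>'\<close> (\<open>\<xi>_closed\<close>), and it represents \<open>T\<close> by continuity.

  The facts on the Friedrichs extension that this uses are derived from a Lax-Milgram theorem for
  sectorial forms on a subspace and from an approximate Riesz representation that does without
  completeness.\<close>

section \<open>Complex inner product spaces\<close>

lemma scaleC_zero_left [simp]: "0 *\<^sub>C (x::'a::complex_vector) = 0"
  by (metis add_cancel_right_right add.right_neutral scaleC_add_left)

lemma scaleC_zero_right [simp]: "c *\<^sub>C (0::'a::complex_vector) = 0"
  by (metis add_cancel_right_right add.right_neutral scaleC_add_right)

lemma scaleC_one' [simp]: "1 *\<^sub>C (x::'a::complex_vector) = x"
  by (rule scaleC_one)

lemma scaleC_minus_left [simp]: "(- c) *\<^sub>C (x::'a::complex_vector) = - (c *\<^sub>C x)"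
  by (rule minus_unique[symmetric]) (simp flip: scaleC_add_left)

lemma scaleC_minus_right [simp]: "c *\<^sub>C (- x::'a::complex_vector) = - (c *\<^sub>C x)"
  by (rule minus_unique[symmetric]) (simp flip: scaleC_add_right)

lemma scaleC_diff_right: "c *\<^sub>C (x - y::'a::complex_vector) = c *\<^sub>C x - c *\<^sub>C y"
  using scaleC_add_right[of c x "- y"] by simp

lemma norm_sq_cinner: "(norm (x::'a::complex_inner))\<^sup>2 = Re (cinner x x)"
  by (simp add: norm_cinner)

lemma Im_cinner_self [simp]: "Im (cinner (x::'a::complex_inner) x) = 0"
  by (simp add: norm_cinner)

lemma cinner_add_right: "cinner (x::'a::complex_inner) (y + z) = cinner x y + cinner x z"
  by (metis cinner_add_left cinner_commute complex_cnj_add)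

lemma cinner_scaleC_right: "cinner (x::'a::complex_inner) (c *\<^sub>C y) = cnj c * cinner x y"
  by (metis cinner_scaleC_left cinner_commute complex_cnj_mult)

lemma cinner_zero_left [simp]: "cinner (0::'a::complex_inner) x = 0"
  using cinner_scaleC_left[of 0 x x] by simp

lemma cinner_zero_right [simp]: "cinner (x::'a::complex_inner) 0 = 0"
  using cinner_scaleC_right[of x 0 x] by simp

lemma cinner_minus_left [simp]: "cinner (- x::'a::complex_inner) y = - cinner x y"
  using cinner_scaleC_left[of "-1" x y] by simp

lemma cinner_minus_right [simp]: "cinner (x::'a::complex_inner) (- y) = - cinner x y"
  using cinner_scaleC_right[of x "-1" y] by simp

lemma cinner_diff_left: "cinner (x - y::'a::complex_inner) z = cinner x z - cinner y z"
  using cinner_add_left[of x "- y" z] by simp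

lemma cinner_diff_right: "cinner (x::'a::complex_inner) (y - z) = cinner x y - cinner x z"
  using cinner_add_right[of x y "- z"] by simp

lemmas cinner_simps = cinner_add_left cinner_add_right cinner_diff_left cinner_diff_right
  cinner_scaleC_left cinner_scaleC_right

lemma norm_scaleC [simp]: "norm (c *\<^sub>C (x::'a::complex_inner)) = cmod c * norm x"
proof -
  have "complex_of_real ((norm (c *\<^sub>C x))\<^sup>2) = (c * cnj c) * complex_of_real ((norm x)\<^sup>2)"
    by (simp add: norm_cinner[symmetric] cinner_simps del: of_real_power)
  also have "\<dots> = complex_of_real ((cmod c * norm x)\<^sup>2)"
    by (simp add: complex_norm_square[symmetric] power_mult_distrib)
  finally show ?thesis
    by (simp only: of_real_eq_iff) (simp add: power2_eq_iff_nonneg)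
qed

lemma cinner_Cauchy_Schwarz: "cmod (cinner (x::'a::complex_inner) y) \<le> norm x * norm y"
proof (cases "y = 0")
  case False
  define a where "a = cinner x y"
  define n where "n = (norm y)\<^sup>2"
  have n: "n > 0" using False by (simp add: n_def)
  have yy: "cinner y y = complex_of_real n" by (simp add: norm_cinner n_def)
  define c where "c = a / complex_of_real n"
  have "0 \<le> Re (cinner (x - c *\<^sub>C y) (x - c *\<^sub>C y))" by (simp add: norm_cinner)
  also have "cinner (x - c *\<^sub>C y) (x - c *\<^sub>C y)
      = cinner x x - cnj c * a - c * cnj a + c * cnj c * complex_of_real n"
    by (simp add: cinner_simps algebra_simps a_def yy cinner_commute[of y x])
  also have "\<dots> = cinner x x - a * cnj a / complex_of_real n"
    using n by (simp add: c_def field_simps)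
  also have "a * cnj a = complex_of_real ((cmod a)\<^sup>2)" by (rule complex_norm_square[symmetric])
  finally have "0 \<le> (norm x)\<^sup>2 - (cmod a)\<^sup>2 / n"
    by (simp add: norm_sq_cinner flip: of_real_divide of_real_power)
  then have "(cmod a)\<^sup>2 / n \<le> (norm x)\<^sup>2" by simp
  then have "(cmod a)\<^sup>2 \<le> (norm x)\<^sup>2 * n" by (simp only: pos_divide_le_eq[OF n])
  then have "(cmod a)\<^sup>2 \<le> (norm x * norm y)\<^sup>2" by (simp only: n_def power_mult_distrib)
  then show ?thesis unfolding a_def by (rule power2_le_imp_le) simp
qed simp

lemma bounded_bilinear_cinner: "bounded_bilinear (cinner :: 'a::complex_inner \<Rightarrow> 'a \<Rightarrow> complex)"
proof
  show "\<exists>K. \<forall>a b. norm (cinner a b) \<le> norm (a::'a) * norm b * K"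
    by (rule exI[of _ 1]) (simp add: cinner_Cauchy_Schwarz)
qed (simp_all add: cinner_simps scaleR_scaleC scaleC_complex_def scaleR_conv_of_real)

lemmas tendsto_cinner [tendsto_intros] = bounded_bilinear.tendsto[OF bounded_bilinear_cinner]

lemma bounded_bilinear_scaleC: "bounded_bilinear (scaleC :: complex \<Rightarrow> 'a::complex_inner \<Rightarrow> 'a)"
proof
  show "\<exists>K. \<forall>a b. norm (a *\<^sub>C (b::'a)) \<le> norm a * norm b * K"
    by (rule exI[of _ 1]) simp
qed (simp_all add: scaleC_add_left scaleC_add_right scaleR_scaleC scaleC_scaleC
    scaleC_complex_def mult.commute)

lemmas tendsto_scaleC [tendsto_intros] = bounded_bilinear.tendsto[OF bounded_bilinear_scaleC]

lemma norm_sq_null_iff: "(\<lambda>n. (norm (x n))\<^sup>2) \<longlonglongrightarrow> 0 \<longleftrightarrow> (x :: nat \<Rightarrow> 'a::real_normed_vector) \<longlonglongrightarrow> 0"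
proof
  assume "(\<lambda>n. (norm (x n))\<^sup>2) \<longlonglongrightarrow> 0"
  then have "(\<lambda>n. sqrt ((norm (x n))\<^sup>2)) \<longlonglongrightarrow> sqrt 0" by (intro tendsto_intros)
  then show "x \<longlonglongrightarrow> 0" by (simp add: tendsto_norm_zero_iff)
next
  assume "x \<longlonglongrightarrow> 0"
  then show "(\<lambda>n. (norm (x n))\<^sup>2) \<longlonglongrightarrow> 0" by (intro tendsto_null_power tendsto_norm_zero) auto
qed

lemma csubspaceD:
  assumes "csubspace V"
  shows csubspace_0: "0 \<in> V" and csubspace_add: "\<And>x y. x \<in> V \<Longrightarrow> y \<in> V \<Longrightarrow> x + y \<in> V"
    and csubspace_scaleC: "\<And>c x. x \<in> V \<Longrightarrow> c *\<^sub>C x \<in> V"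
  using assms by (auto simp: csubspace_def)

lemma csubspace_uminus: "csubspace V \<Longrightarrow> x \<in> V \<Longrightarrow> - x \<in> V"
  using csubspace_scaleC[of V x "-1"] by simp

lemma csubspace_diff: "csubspace V \<Longrightarrow> x \<in> V \<Longrightarrow> y \<in> V \<Longrightarrow> x - y \<in> V"
  using csubspace_add[of V x "- y"] csubspace_uminus[of V y] by simp

lemma clinear_onD:
  assumes "clinear_on V f"
  shows clinear_on_csubspace: "csubspace V"
    and clinear_on_add: "\<And>x y. x \<in> V \<Longrightarrow> y \<in> V \<Longrightarrow> f (x + y) = f x + f y"
    and clinear_on_scaleC: "\<And>c x. x \<in> V \<Longrightarrow> f (c *\<^sub>C x) = c *\<^sub>C f x"
  using assms by (auto simp: clinear_on_def)

lemma clinear_on_uminus: "clinear_on V f \<Longrightarrow> x \<in> V \<Longrightarrow> f (- x) = - f x"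
  using clinear_on_scaleC[of V f x "-1"] by simp

lemma clinear_on_diff: "clinear_on V f \<Longrightarrow> x \<in> V \<Longrightarrow> y \<in> V \<Longrightarrow> f (x - y) = f x - f y"
  using clinear_on_add[of V f x "- y"] clinear_on_uminus[of V f y]
    csubspace_uminus[OF clinear_on_csubspace] by fastforce

lemma clinear_on_0: "clinear_on V f \<Longrightarrow> f 0 = 0"
  using clinear_on_scaleC[of V f 0 0] csubspace_0[OF clinear_on_csubspace, of V f] by simp

section \<open>Cauchy conditions as double limits\<close>

text \<open>Cauchy conditions on vectors and on forms alike say that a real double sequence tends to
  zero, so implications between them reduce to comparing double sequences. Only the upper bound is
  required, since the double sequences in question are nonnegative.\<close>

definition null2 :: "(nat \<Rightarrow> nat \<Rightarrow> real) \<Rightarrow> bool" where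
  "null2 f \<longleftrightarrow> (\<forall>\<epsilon>>0. \<exists>M. \<forall>m\<ge>M. \<forall>n\<ge>M. f m n < \<epsilon>)"

lemma null2D: "null2 f \<Longrightarrow> \<epsilon> > 0 \<Longrightarrow> \<exists>M. \<forall>m\<ge>M. \<forall>n\<ge>M. f m n < \<epsilon>"
  by (simp add: null2_def)

lemma null2_le: "null2 f \<Longrightarrow> (\<And>m n. g m n \<le> f m n) \<Longrightarrow> null2 g"
  unfolding null2_def by (meson le_less_trans)

lemma null2_add:
  assumes "null2 f" "null2 g"
  shows "null2 (\<lambda>m n. f m n + g m n)"
  unfolding null2_def
proof (intro allI impI)
  fix e :: real assume "e > 0"
  then have e: "e / 2 > 0" by simp
  obtain M1 where M1: "\<forall>m\<ge>M1. \<forall>n\<ge>M1. f m n < e / 2" using null2D[OF assms(1) e] by blast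
  obtain M2 where M2: "\<forall>m\<ge>M2. \<forall>n\<ge>M2. g m n < e / 2" using null2D[OF assms(2) e] by blast
  have "f m n + g m n < e" if "m \<ge> max M1 M2" "n \<ge> max M1 M2" for m n
  proof -
    have "f m n < e / 2" "g m n < e / 2" using M1 M2 that by auto
    then show ?thesis by linarith
  qed
  then show "\<exists>M. \<forall>m\<ge>M. \<forall>n\<ge>M. f m n + g m n < e" by blast
qed

lemma null2_cmult:
  assumes "null2 f" "c \<ge> 0"
  shows "null2 (\<lambda>m n. c * f m n)"
proof (cases "c = 0")
  case False
  then have c: "c > 0" using assms(2) by simp
  show ?thesis
    unfolding null2_def
  proof (intro allI impI)
    fix e :: real assume "e > 0"
    then have "e / c > 0" using c by simp
    from null2D[OF assms(1) this] show "\<exists>M. \<forall>m\<ge>M. \<forall>n\<ge>M. c * f m n < e"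
      using c by (simp add: pos_less_divide_eq mult.commute)
  qed
qed (simp add: null2_def)

lemma null2_limit:
  assumes "f \<longlonglongrightarrow> 0"
  shows "null2 (\<lambda>m n. f m + f n)"
  unfolding null2_def
proof (intro allI impI)
  fix e :: real assume "e > 0"
  then have "e / 2 > 0" by simp
  from order_tendstoD(2)[OF assms this] obtain M where M: "\<forall>n\<ge>M. f n < e / 2"
    by (auto simp: eventually_sequentially)
  have "f m + f n < e" if "m \<ge> M" "n \<ge> M" for m n
  proof -
    have "f m < e / 2" "f n < e / 2" using M that by auto
    then show ?thesis by linarith
  qed
  then show "\<exists>M. \<forall>m\<ge>M. \<forall>n\<ge>M. f m + f n < e" by blast
qed

lemma Cauchy_iff_null2:
  "Cauchy (x :: nat \<Rightarrow> 'a::real_normed_vector) \<longleftrightarrow> null2 (\<lambda>m n. (norm (x m - x n))\<^sup>2)"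
proof
  assume c: "Cauchy x"
  show "null2 (\<lambda>m n. (norm (x m - x n))\<^sup>2)"
    unfolding null2_def
  proof (intro allI impI)
    fix e :: real assume "e > 0"
    then have "sqrt e > 0" by simp
    from metric_CauchyD[OF c this] obtain M where M: "\<forall>m\<ge>M. \<forall>n\<ge>M. norm (x m - x n) < sqrt e"
      by (auto simp: dist_norm)
    have "(norm (x m - x n))\<^sup>2 < e" if "m \<ge> M" "n \<ge> M" for m n
      using power_strict_mono[of "norm (x m - x n)" "sqrt e" 2] M that \<open>e > 0\<close> by simp
    then show "\<exists>M. \<forall>m\<ge>M. \<forall>n\<ge>M. (norm (x m - x n))\<^sup>2 < e" by blast
  qed
next
  assume n: "null2 (\<lambda>m n. (norm (x m - x n))\<^sup>2)"
  show "Cauchy x"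
  proof (rule metric_CauchyI)
    fix e :: real assume e: "e > 0"
    then have "e\<^sup>2 > 0" by simp
    from null2D[OF n this] show "\<exists>M. \<forall>m\<ge>M. \<forall>n\<ge>M. dist (x m) (x n) < e"
      using e by (simp add: dist_norm power_mono_iff) (meson less_imp_le power2_less_imp_less)
  qed
qed

lemma convergent_if_null2:
  assumes "null2 (\<lambda>m n. (norm (x m - x n))\<^sup>2)"
  shows "\<exists>l. x \<longlonglongrightarrow> (l :: 'a::{real_normed_vector, complete_space})"
  using assms unfolding Cauchy_iff_null2[symmetric] Cauchy_convergent_iff convergent_def by blast

section \<open>Sectorial forms\<close>

abbreviation quad :: "('a \<Rightarrow> 'a \<Rightarrow> complex) \<Rightarrow> 'a \<Rightarrow> real" where
  "quad t u \<equiv> Re (t u u)"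

lemma sesquilinear_onD:
  assumes "sesquilinear_on D t"
  shows sesq_csubspace: "csubspace D"
    and sesq_add_left: "\<And>u v w. u \<in> D \<Longrightarrow> v \<in> D \<Longrightarrow> w \<in> D \<Longrightarrow> t (u + v) w = t u w + t v w"
    and sesq_add_right: "\<And>u v w. u \<in> D \<Longrightarrow> v \<in> D \<Longrightarrow> w \<in> D \<Longrightarrow> t w (u + v) = t w u + t w v"
    and sesq_scale_left: "\<And>c u v. u \<in> D \<Longrightarrow> v \<in> D \<Longrightarrow> t (c *\<^sub>C u) v = c * t u v"
    and sesq_scale_right: "\<And>c u v. u \<in> D \<Longrightarrow> v \<in> D \<Longrightarrow> t u (c *\<^sub>C v) = cnj c * t u v"
  using assms by (auto simp: sesquilinear_on_def)

text \<open>The linear description of the sector survives limits and sums. The vertex belongs to the sector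
  because the argument of zero is zero by convention.\<close>

lemma sector_iff:
  assumes "0 \<le> \<alpha>" "\<alpha> < pi / 2"
  shows "z \<in> sector \<alpha> \<longleftrightarrow> 0 \<le> Re z \<and> \<bar>Im z\<bar> \<le> tan \<alpha> * Re z"
proof (cases "z = 0")
  case True
  then show ?thesis using assms by (simp add: sector_def Arg_zero)
next
  case False
  have polar: "z = of_real (cmod z) * exp (\<i> * of_real (Arg z))"
    using Arg_eq[OF False] by simp
  have pos: "0 < Re z" if "z \<in> sector \<alpha>"
  proof -
    have "\<bar>Arg z\<bar> < pi / 2" using that assms by (simp add: sector_def)
    then have "cos (Arg z) > 0" by (intro cos_gt_zero_pi) auto
    moreover have "Re z = cmod z * cos (Arg z)"
      by (subst polar) (simp add: exp_Euler cos_of_real sin_of_real)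
    ultimately show ?thesis using False by simp
  qed
  have eq: "z \<in> sector \<alpha> \<longleftrightarrow> \<bar>Im z\<bar> \<le> tan \<alpha> * Re z" if "0 < Re z"
  proof -
    have at: "arctan (tan \<alpha>) = \<alpha>" using assms by (intro arctan_tan) auto
    have "z \<in> sector \<alpha> \<longleftrightarrow> arctan \<bar>Im z / Re z\<bar> \<le> arctan (tan \<alpha>)"
      by (simp add: sector_def arg_conv_arctan[OF that] at abs_if arctan_minus)
    also have "\<dots> \<longleftrightarrow> \<bar>Im z / Re z\<bar> \<le> tan \<alpha>" by (rule arctan_le_iff)
    also have "\<dots> \<longleftrightarrow> \<bar>Im z\<bar> \<le> tan \<alpha> * Re z" using that by (simp add: field_simps)
    finally show ?thesis .
  qed
  have "0 < Re z" if "0 \<le> Re z" "\<bar>Im z\<bar> \<le> tan \<alpha> * Re z"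
  proof (rule ccontr)
    assume "\<not> 0 < Re z"
    then have "Re z = 0" "Im z = 0" using that by auto
    with False show False by (simp add: complex_eq_iff)
  qed
  then show ?thesis using pos eq by (meson less_eq_real_def)
qed

lemma ex_sector_iff:
  "(\<exists>\<alpha>. 0 \<le> \<alpha> \<and> \<alpha> < pi / 2 \<and> A \<subseteq> sector \<alpha>)
    \<longleftrightarrow> (\<exists>K\<ge>0. \<forall>z\<in>A. 0 \<le> Re z \<and> \<bar>Im z\<bar> \<le> K * Re z)"
proof
  assume "\<exists>\<alpha>. 0 \<le> \<alpha> \<and> \<alpha> < pi / 2 \<and> A \<subseteq> sector \<alpha>"
  then obtain \<alpha> where *: "0 \<le> \<alpha>" "\<alpha> < pi / 2" "A \<subseteq> sector \<alpha>" by blast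
  have "0 \<le> tan \<alpha>" using * by (simp add: tan_pos_pi2_le)
  then show "\<exists>K\<ge>0. \<forall>z\<in>A. 0 \<le> Re z \<and> \<bar>Im z\<bar> \<le> K * Re z"
    using * sector_iff[OF *(1,2)] by blast
next
  assume "\<exists>K\<ge>0. \<forall>z\<in>A. 0 \<le> Re z \<and> \<bar>Im z\<bar> \<le> K * Re z"
  then obtain K where K: "K \<ge> 0" "\<forall>z\<in>A. 0 \<le> Re z \<and> \<bar>Im z\<bar> \<le> K * Re z" by blast
  have \<alpha>: "0 \<le> arctan K" "arctan K < pi / 2" using K arctan_ubound by auto
  then have "A \<subseteq> sector (arctan K)" using K by (auto simp: sector_iff tan_arctan)
  with \<alpha> show "\<exists>\<alpha>. 0 \<le> \<alpha> \<and> \<alpha> < pi / 2 \<and> A \<subseteq> sector \<alpha>" by blast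
qed

text \<open>The constant \<open>K\<close> is the tangent of the semi-angle.\<close>

locale sect_form =
  fixes D :: "'a::complex_vector set" and t :: "'a \<Rightarrow> 'a \<Rightarrow> complex" and K :: real
  assumes sesq: "sesquilinear_on D t"
    and Re_nonneg: "\<And>u. u \<in> D \<Longrightarrow> 0 \<le> quad t u"
    and Im_le: "\<And>u. u \<in> D \<Longrightarrow> \<bar>Im (t u u)\<bar> \<le> K * quad t u"
    and K_nonneg: "0 \<le> K"

lemma sectorial_form_iff: "sectorial_form D t \<longleftrightarrow> (\<exists>K. sect_form D t K)"
  unfolding sectorial_form_def sect_form_def
  using ex_sector_iff[of "(\<lambda>u. t u u) ` D"] by (auto simp: image_subset_iff)

definition form_cauchy :: "('a::complex_vector \<Rightarrow> 'a \<Rightarrow> complex) \<Rightarrow> (nat \<Rightarrow> 'a) \<Rightarrow> bool" where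
  "form_cauchy t x \<longleftrightarrow> null2 (\<lambda>m n. cmod (t (x m - x n) (x m - x n)))"

lemma form_conv_iff: "form_conv N t x u \<longleftrightarrow> (\<lambda>n. N (x n - u)) \<longlonglongrightarrow> 0 \<and> form_cauchy t x"
  by (simp add: form_conv_def form_cauchy_def null2_def)

context sect_form
begin

lemmas csub = sesq_csubspace[OF sesq]
lemmas mem [simp, intro] = csubspace_0[OF csub] csubspace_add[OF csub] csubspace_scaleC[OF csub]
  csubspace_uminus[OF csub] csubspace_diff[OF csub]
lemmas add_left = sesq_add_left[OF sesq]
lemmas add_right = sesq_add_right[OF sesq]
lemmas scale_left = sesq_scale_left[OF sesq]
lemmas scale_right = sesq_scale_right[OF sesq]

lemma minus_left: "u \<in> D \<Longrightarrow> v \<in> D \<Longrightarrow> t (- u) v = - t u v"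
  using scale_left[of u v "-1"] by simp

lemma minus_right: "u \<in> D \<Longrightarrow> v \<in> D \<Longrightarrow> t u (- v) = - t u v"
  using scale_right[of u v "-1"] by simp

lemma diff_left: "u \<in> D \<Longrightarrow> v \<in> D \<Longrightarrow> w \<in> D \<Longrightarrow> t (u - v) w = t u w - t v w"
  using add_left[of u "- v" w] by (simp add: minus_left)

lemma diff_right: "u \<in> D \<Longrightarrow> v \<in> D \<Longrightarrow> w \<in> D \<Longrightarrow> t w (u - v) = t w u - t w v"
  using add_right[of u "- v" w] by (simp add: minus_right)

lemma zero_left: "v \<in> D \<Longrightarrow> t 0 v = 0"
  using scale_left[of v v 0] by simp

lemma zero_right: "v \<in> D \<Longrightarrow> t v 0 = 0"
  using scale_right[of v v 0] by simp

lemmas expand = add_left add_right scale_left scale_right minus_left minus_right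
  diff_left diff_right zero_left zero_right

lemma cmod_le: "u \<in> D \<Longrightarrow> cmod (t u u) \<le> (1 + K) * quad t u"
  using cmod_le[of "t u u"] Re_nonneg[of u] Im_le[of u] by (simp add: algebra_simps)

lemma q_add_le:
  assumes "u \<in> D" "v \<in> D"
  shows "quad t (u + v) \<le> 2 * quad t u + 2 * quad t v"
proof -
  have "quad t (u + v) + quad t (u - v) = 2 * quad t u + 2 * quad t v"
    using assms by (simp add: expand)
  then show ?thesis using Re_nonneg[of "u - v"] assms by simp
qed

lemma q_scale: "u \<in> D \<Longrightarrow> quad t (c *\<^sub>C u) = (cmod c)\<^sup>2 * quad t u"
proof -
  assume "u \<in> D"
  then have "t (c *\<^sub>C u) (c *\<^sub>C u) = c * cnj c * t u u" by (simp add: expand)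
  then show ?thesis by (simp add: complex_norm_square[symmetric] flip: of_real_power)
qed

lemma q_uminus: "u \<in> D \<Longrightarrow> t (- u) (- u) = t u u"
  by (simp add: expand)

lemma q_minus_commute: "u \<in> D \<Longrightarrow> v \<in> D \<Longrightarrow> t (u - v) (u - v) = t (v - u) (v - u)"
  using q_uminus[of "u - v"] by simp

text \<open>Polarization bounds the form by its values on the diagonal, and rescaling the two arguments
  against each other turns the resulting sum into a product. The constant is not sharp, but only
  its existence matters.\<close>

lemma Cauchy_Schwarz:
  assumes u: "u \<in> D" and v: "v \<in> D"
  shows "cmod (t u v) \<le> 2 * (1 + K) * sqrt (quad t u) * sqrt (quad t v)"
proof -
  have sum_bound: "cmod (t u v) \<le> (1 + K) * (quad t u + quad t v)" if u: "u \<in> D" and v: "v \<in> D" for u v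
  proof -
    let ?p = "\<lambda>c. t (u + c *\<^sub>C v) (u + c *\<^sub>C v)"
    have p: "?p c = t u u + cnj c * t u v + c * t v u + c * cnj c * t v v" for c
      using u v by (simp add: expand algebra_simps)
    \<comment> \<open>polarization identity\<close>
    have "4 * t u v = ?p 1 - ?p (-1) + \<i> * ?p \<i> - \<i> * ?p (- \<i>)"
      unfolding p by (simp add: algebra_simps)
    then have "4 * cmod (t u v) = cmod (?p 1 - ?p (-1) + \<i> * ?p \<i> - \<i> * ?p (- \<i>))"
      by (metis norm_mult norm_numeral)
    also have "\<dots> \<le> cmod (?p 1) + cmod (?p (-1)) + cmod (?p \<i>) + cmod (?p (- \<i>))"
      by (intro order_trans[OF norm_triangle_ineq4] order_trans[OF norm_triangle_ineq] add_mono)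
        (simp_all add: norm_mult)
    also have "\<dots> \<le> (1 + K) * (Re (?p 1) + Re (?p (-1)) + Re (?p \<i>) + Re (?p (- \<i>)))"
      using cmod_le[of "u + 1 *\<^sub>C v"] cmod_le[of "u + (-1) *\<^sub>C v"] cmod_le[of "u + \<i> *\<^sub>C v"]
        cmod_le[of "u + (- \<i>) *\<^sub>C v"] u v by (simp only: distrib_left) simp
    also have "Re (?p 1) + Re (?p (-1)) + Re (?p \<i>) + Re (?p (- \<i>)) = 4 * (quad t u + quad t v)"
      unfolding p by simp
    finally show ?thesis by (simp add: algebra_simps)
  qed
  \<comment> \<open>the shift by \<open>e\<close> permits dividing by the diagonal values even if these vanish\<close>
  have eps: "cmod (t u v) \<le> 2 * (1 + K) * (sqrt (quad t u) + e) * (sqrt (quad t v) + e)" if "e > 0" for e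
  proof -
    define a b where "a = sqrt (quad t u) + e" and "b = sqrt (quad t v) + e"
    have ab: "a > 0" "b > 0" using that u v Re_nonneg by (auto simp: a_def b_def add_nonneg_pos)
    have qa: "quad t u \<le> a\<^sup>2" and qb: "quad t v \<le> b\<^sup>2"
      using that u v Re_nonneg[of u] Re_nonneg[of v] ab
      by (auto simp: a_def b_def intro!: sqrt_le_D)
    define r where "r = sqrt (b / a)"
    have r: "r > 0" "r\<^sup>2 = b / a" using ab by (auto simp: r_def)
    have "t u v = t (complex_of_real r *\<^sub>C u) (complex_of_real (1 / r) *\<^sub>C v)"
      using u v r by (simp add: expand)
    also have "cmod \<dots> \<le> (1 + K) * (quad t (complex_of_real r *\<^sub>C u)
        + quad t (complex_of_real (1/r) *\<^sub>C v))"
      using u v by (intro sum_bound) auto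
    also have "\<dots> = (1 + K) * ((b / a) * quad t u + (a / b) * quad t v)"
      using u v r by (simp add: q_scale norm_divide power_divide)
    also have "\<dots> \<le> (1 + K) * ((b / a) * a\<^sup>2 + (a / b) * b\<^sup>2)"
      using qa qb ab K_nonneg by (intro mult_left_mono add_mono) auto
    also have "\<dots> = 2 * (1 + K) * a * b"
      using ab by (simp add: power2_eq_square)
    finally show ?thesis by (simp add: a_def b_def)
  qed
  have "(\<lambda>n. 2 * (1 + K) * (sqrt (quad t u) + inverse (real (Suc n))) * (sqrt (quad t v) + inverse (real (Suc n))))
     \<longlonglongrightarrow> 2 * (1 + K) * (sqrt (quad t u) + 0) * (sqrt (quad t v) + 0)"
    by (intro tendsto_intros LIMSEQ_inverse_real_of_nat)
  from tendsto_lowerbound[OF this] eps show ?thesis by simp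
qed

lemma form_cauchy_iff:
  assumes x: "\<And>n. x n \<in> D"
  shows "form_cauchy t x \<longleftrightarrow> null2 (\<lambda>m n. quad t (x m - x n))"
proof
  assume n: "null2 (\<lambda>m n. quad t (x m - x n))"
  have "null2 (\<lambda>m n. (1 + K) * quad t (x m - x n))" using n K_nonneg by (intro null2_cmult) auto
  then show "form_cauchy t x"
    unfolding form_cauchy_def by (rule null2_le) (use x in \<open>auto intro: cmod_le\<close>)
qed (auto simp: form_cauchy_def elim: null2_le intro: complex_Re_le_cmod)

lemma form_cauchy_if_limit:
  assumes x: "\<And>n. x n \<in> D" and u: "u \<in> D" and l: "(\<lambda>n. quad t (x n - u)) \<longlonglongrightarrow> 0"
  shows "form_cauchy t x"
  unfolding form_cauchy_iff[OF x]
proof (rule null2_le)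
  show "null2 (\<lambda>m n. 2 * (quad t (x m - u) + quad t (x n - u)))"
    by (intro null2_cmult null2_limit l) simp
  show "quad t (x m - x n) \<le> 2 * (quad t (x m - u) + quad t (x n - u))" for m n
    using q_add_le[of "x m - u" "u - x n"] q_minus_commute[of u "x n"] x u by simp
qed

lemma form_null_iff:
  assumes "\<And>n. x n \<in> D"
  shows "(\<lambda>n. t (x n) (x n)) \<longlonglongrightarrow> 0 \<longleftrightarrow> (\<lambda>n. quad t (x n)) \<longlonglongrightarrow> 0"
proof
  show "(\<lambda>n. t (x n) (x n)) \<longlonglongrightarrow> 0 \<Longrightarrow> (\<lambda>n. quad t (x n)) \<longlonglongrightarrow> 0"
    using tendsto_Re by fastforce
next
  assume "(\<lambda>n. quad t (x n)) \<longlonglongrightarrow> 0"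
  then have "(\<lambda>n. (1 + K) * quad t (x n)) \<longlonglongrightarrow> (1 + K) * 0" by (intro tendsto_intros)
  then show "(\<lambda>n. t (x n) (x n)) \<longlonglongrightarrow> 0"
    using assms by (rule_tac Lim_null_comparison[of _ "\<lambda>n. (1 + K) * quad t (x n)"])
      (auto intro!: always_eventually cmod_le)
qed

text \<open>Beyond some index the values stay within distance one of a fixed member of the sequence; the
  sum accounts for the finitely many earlier ones.\<close>

lemma form_cauchy_bounded:
  assumes x: "\<And>n. x n \<in> D" and c: "form_cauchy t x"
  obtains C where "\<And>n. quad t (x n) \<le> C" "C \<ge> 0"
proof -
  obtain M where M: "\<And>m n. m \<ge> M \<Longrightarrow> n \<ge> M \<Longrightarrow> quad t (x m - x n) < 1"
    using null2D[OF c[unfolded form_cauchy_iff[OF x]], of 1] by auto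
  let ?C = "2 + (\<Sum>n\<le>M. 2 * quad t (x n))"
  have single: "2 * quad t (x n) \<le> (\<Sum>n\<le>M. 2 * quad t (x n))" if "n \<le> M" for n
    using that x Re_nonneg by (intro member_le_sum) auto
  have "quad t (x n) \<le> ?C" for n
  proof (cases "n \<le> M")
    case True
    then show ?thesis using single[OF True] Re_nonneg[OF x, of n] by simp
  next
    case False
    then show ?thesis
      using q_add_le[of "x n - x M" "x M"] M[of n M] single[of M] x by simp
  qed
  moreover have "?C \<ge> 0" using x Re_nonneg by (intro add_nonneg_nonneg sum_nonneg) auto
  ultimately show thesis by (rule that)
qed

lemma form_null_left:
  assumes "\<And>n. x n \<in> D" "\<And>n. y n \<in> D" "(\<lambda>n. quad t (x n)) \<longlonglongrightarrow> 0"
    and bd: "\<And>n. quad t (y n) \<le> C"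
  shows "(\<lambda>n. t (x n) (y n)) \<longlonglongrightarrow> 0" "(\<lambda>n. t (y n) (x n)) \<longlonglongrightarrow> 0"
proof -
  let ?B = "\<lambda>n. 2 * (1 + K) * sqrt (quad t (x n)) * sqrt C"
  have lim: "?B \<longlonglongrightarrow> 0"
    using tendsto_mult[OF tendsto_mult[OF tendsto_const tendsto_real_sqrt[OF assms(3)]] tendsto_const,
        of "2 * (1 + K)" "sqrt C"] by simp
  have "cmod (t (x n) (y n)) \<le> ?B n" "cmod (t (y n) (x n)) \<le> ?B n" for n
  proof -
    have "2 * (1 + K) * sqrt (quad t (x n)) * sqrt (quad t (y n)) \<le> ?B n"
      using bd[of n] K_nonneg Re_nonneg assms(1) by (intro mult_left_mono) auto
    then show "cmod (t (x n) (y n)) \<le> ?B n" "cmod (t (y n) (x n)) \<le> ?B n"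
      using Cauchy_Schwarz[of "x n" "y n"] Cauchy_Schwarz[of "y n" "x n"] assms(1,2)
      by (auto simp: mult_ac)
  qed
  then show "(\<lambda>n. t (x n) (y n)) \<longlonglongrightarrow> 0" "(\<lambda>n. t (y n) (x n)) \<longlonglongrightarrow> 0"
    by (auto intro: Lim_null_comparison[OF always_eventually lim])
qed

lemma form_tendsto:
  assumes "\<And>n. x n \<in> D" "\<And>n. y n \<in> D" "u \<in> D" "v \<in> D"
    and x: "(\<lambda>n. quad t (x n - u)) \<longlonglongrightarrow> 0"
    and y: "(\<lambda>n. quad t (y n - v)) \<longlonglongrightarrow> 0"
  shows "(\<lambda>n. t (x n) (y n)) \<longlonglongrightarrow> t u v"
proof -
  obtain C where C: "\<And>n. quad t (y n) \<le> C"
    using form_cauchy_bounded[OF assms(2) form_cauchy_if_limit[OF assms(2,4) y]] by blast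
  have "(\<lambda>n. t (x n - u) (y n)) \<longlonglongrightarrow> 0"
    using assms C by (intro form_null_left(1)[of _ _ C]) auto
  moreover have "(\<lambda>n. t u (y n - v)) \<longlonglongrightarrow> 0"
    using assms by (intro form_null_left(2)[where C = "quad t u"]) auto
  ultimately have "(\<lambda>n. t (x n - u) (y n) + t u (y n - v) + t u v) \<longlonglongrightarrow> 0 + 0 + t u v"
    by (intro tendsto_intros)
  moreover have "t (x n - u) (y n) + t u (y n - v) + t u v = t (x n) (y n)" for n
    using assms by (simp add: expand)
  ultimately show ?thesis by simp
qed

lemma tendsto_left:
  assumes "\<And>n. x n \<in> D" "u \<in> D" "(\<lambda>n. t (x n - u) (x n - u)) \<longlonglongrightarrow> 0" "v \<in> D"
  shows "(\<lambda>n. t (x n) v) \<longlonglongrightarrow> t u v"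
  using tendsto_Re[OF assms(3)] assms by (intro form_tendsto) (auto simp: expand)

lemma form_convergent:
  assumes x: "\<And>n. x n \<in> D" and cx: "form_cauchy t x"
    and y: "\<And>n. y n \<in> D" and cy: "form_cauchy t y"
  obtains c where "(\<lambda>n. t (x n) (y n)) \<longlonglongrightarrow> c"
proof -
  obtain C where C: "\<And>n. quad t (x n) \<le> C" "C \<ge> 0" using form_cauchy_bounded[OF x cx] by blast
  obtain C' where C': "\<And>n. quad t (y n) \<le> C'" "C' \<ge> 0" using form_cauchy_bounded[OF y cy] by blast
  define B where "B = (2 * (1 + K))\<^sup>2"
  have B: "B \<ge> 0" by (simp add: B_def)
  have CS: "(cmod (t u v))\<^sup>2 \<le> B * (quad t u * quad t v)" if "u \<in> D" "v \<in> D" for u v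
    using power_mono[OF Cauchy_Schwarz[OF that], of 2] Re_nonneg that
    by (simp add: B_def power_mult_distrib mult_ac)
  have "null2 (\<lambda>m n. (cmod (t (x m) (y m) - t (x n) (y n)))\<^sup>2)"
  proof (rule null2_le)
    show "null2 (\<lambda>m n. 2 * (B * C' * quad t (x m - x n) + B * C * quad t (y m - y n)))"
      using cx cy B C C' unfolding form_cauchy_iff[OF x] form_cauchy_iff[OF y]
      by (intro null2_cmult null2_add) auto
    fix m n
    define p q where "p = t (x m - x n) (y m)" and "q = t (x n) (y m - y n)"
    have "t (x m) (y m) - t (x n) (y n) = p + q" using x y by (simp add: p_def q_def expand)
    then have "(cmod (t (x m) (y m) - t (x n) (y n)))\<^sup>2 \<le> (cmod p + cmod q)\<^sup>2"
      using norm_triangle_ineq[of p q] by (intro power_mono) auto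
    also have "\<dots> \<le> 2 * ((cmod p)\<^sup>2 + (cmod q)\<^sup>2)"
      using sum_squares_bound[of "cmod p" "cmod q"] by (simp add: power2_sum)
    also have "(cmod p)\<^sup>2 \<le> B * (quad t (x m - x n) * C')"
      unfolding p_def using x y C' B Re_nonneg by (intro order_trans[OF CS] mult_left_mono) auto
    also have "(cmod q)\<^sup>2 \<le> B * (C * quad t (y m - y n))"
      unfolding q_def using x y C B Re_nonneg by (intro order_trans[OF CS] mult_left_mono mult_right_mono) auto
    finally show "(cmod (t (x m) (y m) - t (x n) (y n)))\<^sup>2
        \<le> 2 * (B * C' * quad t (x m - x n) + B * C * quad t (y m - y n))"
      by (simp add: mult_ac)
  qed
  from convergent_if_null2[OF this] show thesis using that by blast
qed

lemma form_cauchy_add: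
  assumes x: "\<And>n. x n \<in> D" "form_cauchy t x" and y: "\<And>n. y n \<in> D" "form_cauchy t y"
  shows "form_cauchy t (\<lambda>n. x n + y n)"
proof -
  have xy: "x n + y n \<in> D" for n using x y by simp
  show ?thesis
    unfolding form_cauchy_iff[OF xy]
  proof (rule null2_le)
    show "null2 (\<lambda>m n. 2 * quad t (x m - x n) + 2 * quad t (y m - y n))"
      using x(2) y(2) unfolding form_cauchy_iff[OF x(1)] form_cauchy_iff[OF y(1)]
      by (intro null2_cmult null2_add) auto
    show "quad t (x m + y m - (x n + y n)) \<le> 2 * quad t (x m - x n) + 2 * quad t (y m - y n)" for m n
      using q_add_le[of "x m - x n" "y m - y n"] x y by (simp add: algebra_simps)
  qed
qed

lemma form_cauchy_scale:
  assumes x: "\<And>n. x n \<in> D" "form_cauchy t x"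
  shows "form_cauchy t (\<lambda>n. c *\<^sub>C x n)"
proof -
  have "null2 (\<lambda>m n. (cmod c)\<^sup>2 * cmod (t (x m - x n) (x m - x n)))"
    using x(2) unfolding form_cauchy_def by (intro null2_cmult) auto
  moreover have "cmod (t (c *\<^sub>C x m - c *\<^sub>C x n) (c *\<^sub>C x m - c *\<^sub>C x n))
      = (cmod c)\<^sup>2 * cmod (t (x m - x n) (x m - x n))" for m n
    using x(1) by (simp add: scaleC_diff_right[symmetric] scale_left scale_right norm_mult power2_eq_square)
  ultimately show ?thesis unfolding form_cauchy_def by simp
qed

end

section \<open>Representation theorems\<close>

definition form_complete :: "'a::complex_vector set \<Rightarrow> ('a \<Rightarrow> 'a \<Rightarrow> complex) \<Rightarrow> bool" where
  "form_complete D t \<longleftrightarrow> (\<forall>x. (\<forall>n. x n \<in> D) \<and> form_cauchy t x \<longrightarrow>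
     (\<exists>u\<in>D. (\<lambda>n. t (x n - u) (x n - u)) \<longlonglongrightarrow> 0))"

definition bounded_antilinear ::
  "'a::complex_vector set \<Rightarrow> ('a \<Rightarrow> 'a \<Rightarrow> complex) \<Rightarrow> ('a \<Rightarrow> complex) \<Rightarrow> bool" where
  "bounded_antilinear D t \<phi> \<longleftrightarrow> (\<forall>u\<in>D. \<forall>v\<in>D. \<phi> (u + v) = \<phi> u + \<phi> v)
     \<and> (\<forall>c. \<forall>u\<in>D. \<phi> (c *\<^sub>C u) = cnj c * \<phi> u)
     \<and> (\<exists>C\<ge>0. \<forall>v\<in>D. cmod (\<phi> v) \<le> C * sqrt (quad t v))"

locale herm_form = sect_form D p 0 for D :: "'a::complex_vector set" and p +
  assumes herm: "u \<in> D \<Longrightarrow> v \<in> D \<Longrightarrow> p u v = cnj (p v u)"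

lemma herm_form_subspace:
  assumes "herm_form D p" "csubspace E" "E \<subseteq> D"
  shows "herm_form E p"
proof -
  interpret herm_form D p by (rule assms(1))
  show ?thesis
  proof
    show "sesquilinear_on E p"
      using sesq assms(2,3) unfolding sesquilinear_on_def by (simp add: subset_iff)
    fix u assume "u \<in> E"
    then have u: "u \<in> D" using assms(3) by blast
    show "0 \<le> quad p u" "\<bar>Im (p u u)\<bar> \<le> 0 * quad p u" by (rule Re_nonneg[OF u], rule Im_le[OF u])
    show "p u v = cnj (p v u)" if "v \<in> E" for v using herm[OF u] that assms(3) by blast
  qed simp
qed

text \<open>A minimizing sequence of the functional \<open>p[u,u] - 2 Re \<phi>(u)\<close> is a Cauchy sequence by the
  parallelogram identity, and its first variation tends to zero. No completeness is assumed, so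
  that the result also applies to forms that are not closed and to subspaces that are only dense.\<close>

lemma (in herm_form) approximate_Riesz:
  assumes "bounded_antilinear D p \<phi>"
  obtains y where "\<And>n. y n \<in> D" "form_cauchy p y" "\<And>v. v \<in> D \<Longrightarrow> (\<lambda>n. p (y n) v) \<longlonglongrightarrow> \<phi> v"
proof -
  have add: "\<And>u v. u \<in> D \<Longrightarrow> v \<in> D \<Longrightarrow> \<phi> (u + v) = \<phi> u + \<phi> v"
    and scale: "\<And>c u. u \<in> D \<Longrightarrow> \<phi> (c *\<^sub>C u) = cnj c * \<phi> u"
    using assms unfolding bounded_antilinear_def by auto
  obtain C where C: "C \<ge> 0" "\<And>v. v \<in> D \<Longrightarrow> cmod (\<phi> v) \<le> C * sqrt (quad p v)"
    using assms unfolding bounded_antilinear_def by auto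
  define J where "J u = quad p u - 2 * Re (\<phi> u)" for u
  have J_ge: "- C\<^sup>2 \<le> J u" if "u \<in> D" for u
  proof -
    have "Re (\<phi> u) \<le> C * sqrt (quad p u)"
      using C(2)[OF that] complex_Re_le_cmod[of "\<phi> u"] by linarith
    moreover have "0 \<le> (sqrt (quad p u) - C)\<^sup>2" by simp
    moreover have "(sqrt (quad p u) - C)\<^sup>2 = quad p u - 2 * (C * sqrt (quad p u)) + C\<^sup>2"
      using Re_nonneg[OF that] by (simp add: power2_diff)
    ultimately show ?thesis unfolding J_def by linarith
  qed
  define m where "m = Inf (J ` D)"
  have bdd: "bdd_below (J ` D)" using J_ge by (auto intro!: bdd_belowI2)
  have m_le: "m \<le> J u" if "u \<in> D" for u
    unfolding m_def using bdd that by (intro cInf_lower) auto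
  define e where "e n = inverse (real (Suc n))" for n
  have e: "e n > 0" for n by (simp add: e_def)
  have e0: "e \<longlonglongrightarrow> 0" unfolding e_def by (rule LIMSEQ_inverse_real_of_nat)
  have "\<exists>u\<in>D. J u < m + (e n)\<^sup>2" for n
  proof -
    have "Inf (J ` D) < m + (e n)\<^sup>2" using e[of n] by (simp add: m_def)
    then show ?thesis using bdd mem(1) by (subst (asm) cInf_less_iff) auto
  qed
  then obtain y where y: "\<And>n. y n \<in> D" "\<And>n. J (y n) < m + (e n)\<^sup>2" by metis
  have J_var: "J (u + complex_of_real s *\<^sub>C v) = J u + 2 * s * Re (p u v - \<phi> v) + s\<^sup>2 * quad p v"
    if "u \<in> D" "v \<in> D" for u v s
    using that herm[of v u] by (simp add: J_def expand add scale algebra_simps power2_eq_square)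
  have re_var: "\<bar>Re (p (y n) v - \<phi> v)\<bar> \<le> e n * (1 + quad p v)" if v: "v \<in> D" for n v
  proof -
    have "0 \<le> (e n)\<^sup>2 + 2 * s * Re (p (y n) v - \<phi> v) + s\<^sup>2 * quad p v" for s
      using m_le[of "y n + complex_of_real s *\<^sub>C v"] y(2)[of n] J_var[OF y(1)[of n] v, of s] y(1) v
      by auto
    \<comment> \<open>the first order term is bounded by the defect \<open>(e n)\<^sup>2\<close> plus the second order term\<close>
    from this[of "e n"] this[of "- e n"]
    have "e n * (2 * \<bar>Re (p (y n) v - \<phi> v)\<bar>) \<le> e n * (e n * (1 + quad p v))"
      by (simp add: abs_if algebra_simps power2_eq_square)
    then have "2 * \<bar>Re (p (y n) v - \<phi> v)\<bar> \<le> e n * (1 + quad p v)" using e[of n] by simp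
    then show ?thesis by linarith
  qed
  have var: "cmod (p (y n) v - \<phi> v) \<le> e n * (2 * (1 + quad p v))" if v: "v \<in> D" for n v
  proof -
    have "p (y n) (\<i> *\<^sub>C v) - \<phi> (\<i> *\<^sub>C v) = - \<i> * (p (y n) v - \<phi> v)"
      using v y by (simp add: expand scale algebra_simps)
    then have "\<bar>Im (p (y n) v - \<phi> v)\<bar> \<le> e n * (1 + quad p v)"
      using re_var[of "\<i> *\<^sub>C v" n] v by (simp add: q_scale)
    with re_var[OF v, of n] show ?thesis
      using Complex.cmod_le[of "p (y n) v - \<phi> v"] by (simp add: algebra_simps)
  qed
  have "(\<lambda>n. p (y n) v) \<longlonglongrightarrow> \<phi> v" if v: "v \<in> D" for v
  proof -
    have "(\<lambda>n. e n * (2 * (1 + quad p v))) \<longlonglongrightarrow> 0 * (2 * (1 + quad p v))"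
      by (intro tendsto_intros e0)
    then have "(\<lambda>n. p (y n) v - \<phi> v) \<longlonglongrightarrow> 0"
      using var[OF v]
      by (rule_tac Lim_null_comparison[of _ "\<lambda>n. e n * (2 * (1 + quad p v))"]) auto
    then show ?thesis by (simp add: LIM_zero_iff)
  qed
  moreover have "form_cauchy p y"
    unfolding form_cauchy_iff[OF y(1)]
  proof (rule null2_le)
    show "null2 (\<lambda>k n. 2 * ((e k)\<^sup>2 + (e n)\<^sup>2))"
      using tendsto_power[OF e0, of 2] by (intro null2_cmult null2_limit) auto
    show "quad p (y k - y n) \<le> 2 * ((e k)\<^sup>2 + (e n)\<^sup>2)" for k n
    proof -
      let ?h = "complex_of_real (1/2)"
      have "J (?h *\<^sub>C (y k + y n)) = (J (y k) + J (y n)) / 2 - quad p (y k - y n) / 4"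
        using y(1)[of k] y(1)[of n]
        by (simp add: J_def expand add scale algebra_simps) (simp add: field_simps)?
      moreover have "m \<le> J (?h *\<^sub>C (y k + y n))"
        using y(1)[of k] y(1)[of n] by (intro m_le) auto
      ultimately show ?thesis using y(2)[of k] y(2)[of n] by argo
    qed
  qed
  ultimately show thesis using y(1) that by blast
qed

lemma (in herm_form) Riesz:
  assumes "form_complete D p" "bounded_antilinear D p \<phi>"
  obtains u where "u \<in> D" "\<And>v. v \<in> D \<Longrightarrow> p u v = \<phi> v"
proof -
  obtain y where y: "\<And>n. y n \<in> D" "form_cauchy p y"
    "\<And>v. v \<in> D \<Longrightarrow> (\<lambda>n. p (y n) v) \<longlonglongrightarrow> \<phi> v"
    using approximate_Riesz[OF assms(2)] by blast
  from assms(1) y obtain u where u: "u \<in> D" "(\<lambda>n. p (y n - u) (y n - u)) \<longlonglongrightarrow> 0"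
    unfolding form_complete_def by blast
  show thesis
    using LIMSEQ_unique[OF tendsto_left[OF y(1) u] y(3)] by (intro that[OF u(1)]) auto
qed

text \<open>The functional \<open>p[u, -]\<close> is represented on the subspace by a Cauchy sequence, whose limit
  differs from \<open>u\<close> by a vector orthogonal to the subspace.\<close>

lemma (in herm_form) dense_if_orthogonal_trivial:
  assumes "form_complete D p" "csubspace E" "E \<subseteq> D"
    and orth: "\<And>v. v \<in> D \<Longrightarrow> (\<And>u. u \<in> E \<Longrightarrow> p v u = 0) \<Longrightarrow> quad p v = 0"
    and u: "u \<in> D"
  obtains x where "\<And>n. x n \<in> E" "(\<lambda>n. quad p (x n - u)) \<longlonglongrightarrow> 0"
proof -
  interpret E: herm_form E p
    using herm_form_subspace[OF herm_form_axioms assms(2,3)] .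
  have "bounded_antilinear E p (p u)"
    unfolding bounded_antilinear_def
  proof (intro conjI)
    show "\<exists>C\<ge>0. \<forall>v\<in>E. cmod (p u v) \<le> C * sqrt (quad p v)"
      using u assms(3) Cauchy_Schwarz[of u] Re_nonneg[OF u]
      by (intro exI[of _ "2 * sqrt (quad p u)"]) auto
  qed (use u assms(3) in \<open>auto simp: expand subset_iff\<close>)
  then obtain y where y: "\<And>n. y n \<in> E" "form_cauchy p y"
    "\<And>v. v \<in> E \<Longrightarrow> (\<lambda>n. p (y n) v) \<longlonglongrightarrow> p u v"
    using E.approximate_Riesz by blast
  have yD: "y n \<in> D" for n using y(1) assms(3) by auto
  from assms(1) y(2) yD obtain w where w: "w \<in> D" "(\<lambda>n. p (y n - w) (y n - w)) \<longlonglongrightarrow> 0"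
    unfolding form_complete_def by blast
  have "p (w - u) v = 0" if v: "v \<in> E" for v
    using LIMSEQ_unique[OF tendsto_left[OF yD w, of v] y(3)[OF v]] v assms(3) w u
    by (auto simp: expand subset_iff)
  then have wu: "quad p (w - u) = 0" using orth[of "w - u"] w u by auto
  have "(\<lambda>n. 2 * quad p (y n - w) + 2 * 0) \<longlonglongrightarrow> 2 * 0 + 2 * 0"
    using tendsto_Re[OF w(2)] by (intro tendsto_intros) auto
  moreover have "quad p (y n - u) \<le> 2 * quad p (y n - w) + 2 * 0" for n
    using q_add_le[of "y n - w" "w - u"] yD w u wu by simp
  ultimately have "(\<lambda>n. quad p (y n - u)) \<longlonglongrightarrow> 0"
    using Re_nonneg yD u
    by (rule_tac Lim_null_comparison[of _ "\<lambda>n. 2 * quad p (y n - w) + 2 * 0"]) auto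
  with y(1) show thesis by (rule that)
qed

context sect_form
begin

lemma form_re_self: "form_re t u u = complex_of_real (quad t u)"
  by (simp add: form_re_def form_adj_def complex_eq_iff)

lemma herm_form_re: "herm_form D (form_re t)"
proof
  show "sesquilinear_on D (form_re t)"
    using csub unfolding sesquilinear_on_def form_re_def form_adj_def
    by (auto simp: expand field_simps)
  show "form_re t u v = cnj (form_re t v u)" for u v
    by (simp add: form_re_def form_adj_def add.commute)
qed (simp_all add: form_re_self Re_nonneg)

lemma form_cauchy_re_iff:
  assumes "\<And>n. x n \<in> D"
  shows "form_cauchy (form_re t) x \<longleftrightarrow> form_cauchy t x"
  using herm_form.axioms(1)[OF herm_form_re, THEN sect_form.form_cauchy_iff, OF assms]
    form_cauchy_iff[OF assms] by (simp add: form_re_self)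

lemma form_null_re_iff:
  assumes "\<And>n. x n \<in> D"
  shows "(\<lambda>n. form_re t (x n) (x n)) \<longlonglongrightarrow> 0 \<longleftrightarrow> (\<lambda>n. t (x n) (x n)) \<longlonglongrightarrow> 0"
  using herm_form.axioms(1)[OF herm_form_re, THEN sect_form.form_null_iff, OF assms]
    form_null_iff[OF assms] by (simp add: form_re_self)

lemma form_complete_re: "form_complete D (form_re t) \<longleftrightarrow> form_complete D t"
proof -
  have "(\<exists>u\<in>D. (\<lambda>n. form_re t (x n - u) (x n - u)) \<longlonglongrightarrow> 0)
      \<longleftrightarrow> (\<exists>u\<in>D. (\<lambda>n. t (x n - u) (x n - u)) \<longlonglongrightarrow> 0)" if "\<forall>n. x n \<in> D" for x
    using that by (intro bex_cong refl form_null_re_iff) auto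
  then show ?thesis
    unfolding form_complete_def using form_cauchy_re_iff by blast
qed

text \<open>The vectors that represent the functionals \<open>t[u, -]\<close> with respect to the real part of the
  form make up a closed subspace \<open>M\<close>. A vector \<open>g\<close> orthogonal to \<open>M\<close> is orthogonal to the
  representative of \<open>t[g, -]\<close>, which means \<open>t[g,g] = 0\<close>.\<close>

theorem Lax_Milgram:
  assumes complete: "form_complete D t" and \<phi>: "bounded_antilinear D t \<phi>"
  obtains u where "u \<in> D" "\<And>v. v \<in> D \<Longrightarrow> t u v = \<phi> v"
proof -
  define p where "p = form_re t"
  interpret p: herm_form D p unfolding p_def by (rule herm_form_re)
  have q: "quad p u = quad t u" for u by (simp add: p_def form_re_self)
  have bp: "bounded_antilinear D p \<psi> \<longleftrightarrow> bounded_antilinear D t \<psi>" for \<psi>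
    by (simp add: bounded_antilinear_def q)
  have cp: "form_complete D p" using complete by (simp add: p_def form_complete_re)
  define M where "M = {w \<in> D. \<exists>u\<in>D. \<forall>v\<in>D. p w v = t u v}"
  have "csubspace M"
    unfolding csubspace_def
  proof (intro conjI ballI allI)
    show "0 \<in> M" unfolding M_def using zero_left p.zero_left by auto
    fix x assume "x \<in> M"
    then obtain u where u: "x \<in> D" "u \<in> D" "\<forall>v\<in>D. p x v = t u v" unfolding M_def by auto
    show "c *\<^sub>C x \<in> M" for c
      unfolding M_def using u by (auto simp: expand p.expand intro!: bexI[of _ "c *\<^sub>C u"])
    fix y assume "y \<in> M"
    then obtain u' where u': "y \<in> D" "u' \<in> D" "\<forall>v\<in>D. p y v = t u' v" unfolding M_def by auto
    show "x + y \<in> M"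
      unfolding M_def using u u' by (auto simp: expand p.expand intro!: bexI[of _ "u + u'"])
  qed
  then interpret M: herm_form M p
    by (rule herm_form_subspace[OF p.herm_form_axioms]) (auto simp: M_def)
  have "bounded_antilinear M p \<phi>"
    using \<phi> unfolding bp[symmetric] by (auto simp: bounded_antilinear_def M_def)
  then obtain y where y: "\<And>n. y n \<in> M" "form_cauchy p y"
    "\<And>v. v \<in> M \<Longrightarrow> (\<lambda>n. p (y n) v) \<longlonglongrightarrow> \<phi> v"
    using M.approximate_Riesz by blast
  have "\<exists>u\<in>D. \<forall>v\<in>D. p (y n) v = t u v" for n using y(1) by (auto simp: M_def)
  then obtain x where x: "\<And>n. x n \<in> D" "\<And>n v. v \<in> D \<Longrightarrow> p (y n) v = t (x n) v" by metis
  have yD: "y n \<in> D" for n using y(1) by (auto simp: M_def)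
  have coercive: "quad t u \<le> 4 * quad t w" if "u \<in> D" "w \<in> D" "p w u = t u u" for u w
  proof -
    have "quad t u \<le> cmod (p w u)" unfolding that(3) by (rule complex_Re_le_cmod)
    also have "\<dots> \<le> 2 * sqrt (quad t w) * sqrt (quad t u)"
      using p.Cauchy_Schwarz[of w u] that by (simp add: q)
    finally have "sqrt (quad t u) * sqrt (quad t u) \<le> 2 * sqrt (quad t w) * sqrt (quad t u)"
      using Re_nonneg[OF that(1)] by simp
    then have "sqrt (quad t u) \<le> 2 * sqrt (quad t w)"
      using Re_nonneg[OF that(1)] Re_nonneg[OF that(2)]
      by (metis mult_right_le_imp_le less_eq_real_def mult_nonneg_nonneg real_sqrt_ge_zero zero_le_numeral)
    then have "(sqrt (quad t u))\<^sup>2 \<le> (2 * sqrt (quad t w))\<^sup>2"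
      using Re_nonneg[OF that(1)] by (intro power_mono) auto
    then show ?thesis using Re_nonneg[OF that(1)] Re_nonneg[OF that(2)] by (simp add: power_mult_distrib)
  qed
  have "form_cauchy t x"
    unfolding form_cauchy_iff[OF x(1)]
  proof (rule null2_le)
    show "null2 (\<lambda>m n. 4 * quad p (y m - y n))"
      using y(2) unfolding p.form_cauchy_iff[OF yD] by (intro null2_cmult) auto
    show "quad t (x m - x n) \<le> 4 * quad p (y m - y n)" for m n
    proof -
      have "p (y m - y n) v = t (x m - x n) v" if "v \<in> D" for v
        using x yD that by (simp add: expand p.expand)
      then show ?thesis unfolding q using x(1) yD by (intro coercive) auto
    qed
  qed
  with complete x(1) obtain u where u: "u \<in> D" "(\<lambda>n. t (x n - u) (x n - u)) \<longlonglongrightarrow> 0"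
    unfolding form_complete_def by blast
  from cp y(2) yD obtain w where w: "w \<in> D" "(\<lambda>n. p (y n - w) (y n - w)) \<longlonglongrightarrow> 0"
    unfolding form_complete_def by blast
  have pw: "p w v = t u v" if v: "v \<in> D" for v
    using LIMSEQ_unique[OF p.tendsto_left[OF yD w v]] tendsto_left[OF x(1) u v] x(2)[OF v] by simp
  have p\<phi>: "p w v = \<phi> v" if v: "v \<in> M" for v
    using LIMSEQ_unique[OF p.tendsto_left[OF yD w] y(3)[OF v]] v by (auto simp: M_def)
  obtain f where f: "f \<in> D" "\<And>v. v \<in> D \<Longrightarrow> p f v = \<phi> v"
    using p.Riesz[OF cp] \<phi> bp by metis
  define g where "g = f - w"
  have g: "g \<in> D" using f w by (auto simp: g_def)
  have "bounded_antilinear D p (t g)"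
    unfolding bounded_antilinear_def
  proof (intro conjI)
    show "\<exists>C\<ge>0. \<forall>v\<in>D. cmod (t g v) \<le> C * sqrt (quad p v)"
      using Cauchy_Schwarz[OF g] Re_nonneg[OF g] K_nonneg
      by (intro exI[of _ "2 * (1 + K) * sqrt (quad t g)"]) (auto simp: q)
  qed (use g in \<open>auto simp: expand\<close>)
  then obtain w' where w': "w' \<in> D" "\<And>v. v \<in> D \<Longrightarrow> p w' v = t g v"
    using p.Riesz[OF cp] by metis
  then have "w' \<in> M" using g by (auto simp: M_def)
  then have "p g w' = 0" using p\<phi>[of w'] f(2)[OF w'(1)] f w w' by (simp add: g_def p.expand)
  then have "t g g = 0" using w'(2)[OF g] p.herm[OF w'(1) g] by simp
  then have "quad p g = 0" by (simp add: q)
  then have pg: "p g v = 0" if "v \<in> D" for v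
    using p.Cauchy_Schwarz[OF g that] by simp
  show thesis
  proof (rule that[OF u(1)])
    fix v assume v: "v \<in> D"
    show "t u v = \<phi> v" using pw[OF v] f(2)[OF v] pg[OF v] f w v by (simp add: g_def p.expand)
  qed
qed

end

section \<open>Closures of forms\<close>

text \<open>The ambient space is given by its carrier \<open>H\<close> and a seminorm \<open>N\<close>. Limits are
  sought inside \<open>H\<close> only, as the space \<open>\<H>'\<close> is a linear submanifold with its own norm.\<close>

locale closable_form = sect_form D t K for D :: "'a::complex_vector set" and t K +
  fixes H :: "'a set" and N :: "'a \<Rightarrow> real"
  assumes csubspace_H: "csubspace H" and D_subset: "D \<subseteq> H"
    and N_triangle: "\<And>x y. x \<in> H \<Longrightarrow> y \<in> H \<Longrightarrow> N (x + y) \<le> N x + N y"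
    and N_scale: "\<And>c x. x \<in> H \<Longrightarrow> N (c *\<^sub>C x) = cmod c * N x"
    and closable: "\<And>x. (\<And>n. x n \<in> D) \<Longrightarrow> (\<lambda>n. N (x n)) \<longlonglongrightarrow> 0 \<Longrightarrow> form_cauchy t x
      \<Longrightarrow> (\<lambda>n. t (x n) (x n)) \<longlonglongrightarrow> 0"
begin

lemmas memH [simp, intro] = csubspace_0[OF csubspace_H] csubspace_add[OF csubspace_H]
  csubspace_scaleC[OF csubspace_H] csubspace_uminus[OF csubspace_H] csubspace_diff[OF csubspace_H]

lemma DH: "x \<in> D \<Longrightarrow> x \<in> H" using D_subset by auto

lemma N_0: "N 0 = 0" using N_scale[of 0 0] by simp

lemma N_uminus: "x \<in> H \<Longrightarrow> N (- x) = N x" using N_scale[of x "-1"] by simp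

lemma N_nonneg: "x \<in> H \<Longrightarrow> 0 \<le> N x"
  using N_triangle[of x "- x"] by (auto simp: N_uminus N_0)

abbreviation conv :: "(nat \<Rightarrow> 'a) \<Rightarrow> 'a \<Rightarrow> bool" where
  "conv x u \<equiv> u \<in> H \<and> (\<forall>n. x n \<in> D) \<and> form_conv N t x u"

abbreviation Dbar :: "'a set" where "Dbar \<equiv> closure_dom H N D t"
abbreviation tbar :: "'a \<Rightarrow> 'a \<Rightarrow> complex" where "tbar \<equiv> closure_form N D t"

lemma N_null:
  assumes "\<And>n. x n \<in> H" "\<And>n. y n \<in> H" "(\<lambda>n. N (x n)) \<longlonglongrightarrow> 0" "(\<lambda>n. N (y n)) \<longlonglongrightarrow> 0"
  shows "(\<lambda>n. N (x n + y n)) \<longlonglongrightarrow> 0"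
proof -
  have "(\<lambda>n. N (x n) + N (y n)) \<longlonglongrightarrow> 0 + 0" by (intro tendsto_intros assms)
  then show ?thesis
    using assms N_triangle N_nonneg
    by (rule_tac Lim_null_comparison[of _ "\<lambda>n. N (x n) + N (y n)"]) auto
qed

lemma conv_add:
  assumes "conv x u" "conv y v"
  shows "conv (\<lambda>n. x n + y n) (u + v)"
proof -
  have "(\<lambda>n. N ((x n - u) + (y n - v))) \<longlonglongrightarrow> 0"
    using assms by (intro N_null) (auto simp: form_conv_iff DH)
  then have "(\<lambda>n. N (x n + y n - (u + v))) \<longlonglongrightarrow> 0" by (simp add: algebra_simps)
  then show ?thesis using assms form_cauchy_add[of x y] by (auto simp: form_conv_iff)
qed

lemma conv_scale:
  assumes "conv x u"
  shows "conv (\<lambda>n. c *\<^sub>C x n) (c *\<^sub>C u)"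
proof -
  have "N (c *\<^sub>C x n - c *\<^sub>C u) = cmod c * N (x n - u)" for n
    using assms N_scale[of "x n - u" c] by (auto simp: scaleC_diff_right DH)
  moreover have "(\<lambda>n. cmod c * N (x n - u)) \<longlonglongrightarrow> cmod c * 0"
    using assms by (intro tendsto_intros) (auto simp: form_conv_iff)
  ultimately show ?thesis using assms form_cauchy_scale[of x] by (auto simp: form_conv_iff)
qed

lemma conv_uminus: "conv x u \<Longrightarrow> conv (\<lambda>n. - x n) (- u)"
  using conv_scale[where c = "-1"] by fastforce

lemma conv_diff: "conv x u \<Longrightarrow> conv y v \<Longrightarrow> conv (\<lambda>n. x n - y n) (u - v)"
  using conv_add[OF _ conv_uminus] by fastforce

lemma conv_const: "u \<in> D \<Longrightarrow> conv (\<lambda>n. u) u"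
  by (auto simp: form_conv_iff N_0 form_cauchy_def null2_def expand DH)

lemma conv_unique:
  assumes "conv x u" "conv y u"
  shows "(\<lambda>n. quad t (x n - y n)) \<longlonglongrightarrow> 0"
proof -
  have "conv (\<lambda>n. x n - y n) 0" using conv_diff[OF assms] by simp
  then have "(\<lambda>n. t (x n - y n) (x n - y n)) \<longlonglongrightarrow> 0"
    by (intro closable) (auto simp: form_conv_iff)
  then show ?thesis using tendsto_Re by fastforce
qed

text \<open>Closability makes the limit independent of the approximating sequences, which is what turns
  the definite description in \<open>closure_form\<close> into a value.\<close>

lemma closure_form_lim:
  assumes x: "conv x u" and y: "conv y v"
  shows "(\<lambda>n. t (x n) (y n)) \<longlonglongrightarrow> tbar u v"
proof -
  obtain c where c: "(\<lambda>n. t (x n) (y n)) \<longlonglongrightarrow> c"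
    using form_convergent[of x y] x y by (auto simp: form_conv_iff)
  have "c' = c" if x': "conv x' u" and y': "conv y' v" and c': "(\<lambda>n. t (x' n) (y' n)) \<longlonglongrightarrow> c'" for x' y' c'
  proof -
    obtain C where C: "\<And>n. quad t (y' n) \<le> C"
      using form_cauchy_bounded[of y'] y' unfolding form_conv_iff by metis
    obtain C' where C': "\<And>n. quad t (x n) \<le> C'"
      using form_cauchy_bounded[of x] x unfolding form_conv_iff by metis
    have "(\<lambda>n. t (x' n - x n) (y' n)) \<longlonglongrightarrow> 0"
      using conv_unique[OF x' x] C x x' y' by (intro form_null_left(1)[of _ _ C]) auto
    moreover have "(\<lambda>n. t (x n) (y' n - y n)) \<longlonglongrightarrow> 0"
      using conv_unique[OF y' y] C' x y' y by (intro form_null_left(2)[of _ _ C']) auto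
    ultimately have "(\<lambda>n. t (x' n - x n) (y' n) + t (x n) (y' n - y n) + t (x n) (y n)) \<longlonglongrightarrow> 0 + 0 + c"
      using c by (intro tendsto_intros)
    moreover have "t (x' n - x n) (y' n) + t (x n) (y' n - y n) + t (x n) (y n) = t (x' n) (y' n)" for n
      using x x' y y' by (simp add: expand)
    ultimately show ?thesis using c' LIMSEQ_unique by fastforce
  qed
  then have "tbar u v = c"
    unfolding closure_form_def using x y c by (intro the_equality) blast+
  with c show ?thesis by simp
qed

lemma in_Dbar: "conv x u \<Longrightarrow> u \<in> Dbar"
  by (auto simp: closure_dom_def)

lemma Dbar_conv: "u \<in> Dbar \<Longrightarrow> \<exists>x. conv x u"
  by (auto simp: closure_dom_def)

lemma Dbar_subset: "Dbar \<subseteq> H" by (auto simp: closure_dom_def)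

lemma in_Dbar_if: "u \<in> D \<Longrightarrow> u \<in> Dbar"
  by (rule in_Dbar[OF conv_const])

lemma D_Dbar: "D \<subseteq> Dbar"
  using in_Dbar_if by (rule subsetI)

lemma tbar_eq: "u \<in> D \<Longrightarrow> v \<in> D \<Longrightarrow> tbar u v = t u v"
  using closure_form_lim[OF conv_const conv_const, of u v] by (simp add: LIMSEQ_const_iff)

lemma sect_form_closure: "sect_form Dbar tbar K"
proof
  have add_l: "tbar (u + v) w = tbar u w + tbar v w" if uvw: "u \<in> Dbar" "v \<in> Dbar" "w \<in> Dbar" for u v w
  proof -
    from uvw[THEN Dbar_conv] obtain x y z where xyz: "conv x u" "conv y v" "conv z w" by blast
    have "(\<lambda>n. t (x n + y n) (z n)) \<longlonglongrightarrow> tbar u w + tbar v w"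
      using xyz tendsto_add[OF closure_form_lim[OF xyz(1,3)] closure_form_lim[OF xyz(2,3)]]
      by (simp add: expand)
    then show ?thesis
      using closure_form_lim[OF conv_add[OF xyz(1,2)] xyz(3)] LIMSEQ_unique by blast
  qed
  have add_r: "tbar w (u + v) = tbar w u + tbar w v" if uvw: "u \<in> Dbar" "v \<in> Dbar" "w \<in> Dbar" for u v w
  proof -
    from uvw[THEN Dbar_conv] obtain x y z where xyz: "conv x u" "conv y v" "conv z w" by blast
    have "(\<lambda>n. t (z n) (x n + y n)) \<longlonglongrightarrow> tbar w u + tbar w v"
      using xyz tendsto_add[OF closure_form_lim[OF xyz(3,1)] closure_form_lim[OF xyz(3,2)]]
      by (simp add: expand)
    then show ?thesis
      using closure_form_lim[OF xyz(3) conv_add[OF xyz(1,2)]] LIMSEQ_unique by blast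
  qed
  have sc: "tbar (c *\<^sub>C u) v = c * tbar u v" "tbar u (c *\<^sub>C v) = cnj c * tbar u v"
    if uv: "u \<in> Dbar" "v \<in> Dbar" for c u v
  proof -
    from uv[THEN Dbar_conv] obtain x y where xy: "conv x u" "conv y v" by blast
    have "(\<lambda>n. t (c *\<^sub>C x n) (y n)) \<longlonglongrightarrow> c * tbar u v"
      using xy tendsto_mult[OF tendsto_const closure_form_lim[OF xy]] by (simp add: expand)
    then show "tbar (c *\<^sub>C u) v = c * tbar u v"
      using closure_form_lim[OF conv_scale[OF xy(1)] xy(2)] LIMSEQ_unique by blast
    have "(\<lambda>n. t (x n) (c *\<^sub>C y n)) \<longlonglongrightarrow> cnj c * tbar u v"
      using xy tendsto_mult[OF tendsto_const closure_form_lim[OF xy]] by (simp add: expand)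
    then show "tbar u (c *\<^sub>C v) = cnj c * tbar u v"
      using closure_form_lim[OF xy(1) conv_scale[OF xy(2)]] LIMSEQ_unique by blast
  qed
  have "csubspace Dbar"
    unfolding csubspace_def
  proof (intro conjI ballI allI)
    show "0 \<in> Dbar" by (simp add: in_Dbar_if)
    fix u assume u: "u \<in> Dbar"
    then obtain x where x: "conv x u" using Dbar_conv by blast
    show "c *\<^sub>C u \<in> Dbar" for c using in_Dbar[OF conv_scale[OF x]] .
    fix v assume "v \<in> Dbar"
    then obtain y where y: "conv y v" using Dbar_conv by blast
    show "u + v \<in> Dbar" using in_Dbar[OF conv_add[OF x y]] .
  qed
  then show "sesquilinear_on Dbar tbar"
    unfolding sesquilinear_on_def using add_l add_r sc by blast
  fix u assume "u \<in> Dbar"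
  then obtain x where x: "conv x u" using Dbar_conv by blast
  note lim = closure_form_lim[OF x x]
  show "0 \<le> quad tbar u"
    using tendsto_lowerbound[OF tendsto_Re[OF lim], of 0] Re_nonneg x by auto
  have "(\<lambda>n. K * quad t (x n) - \<bar>Im (t (x n) (x n))\<bar>) \<longlonglongrightarrow> K * quad tbar u - \<bar>Im (tbar u u)\<bar>"
    by (intro tendsto_intros lim)
  from tendsto_lowerbound[OF this, of 0] show "\<bar>Im (tbar u u)\<bar> \<le> K * quad tbar u"
    using Im_le x by auto
qed (rule K_nonneg)

sublocale bar: sect_form Dbar tbar K by (rule sect_form_closure)

text \<open>For fixed \<open>n\<close> the sequence \<open>x\<^sub>n - x\<^sub>m\<close> approximates \<open>x\<^sub>n - u\<close>, so the Cauchy condition bounds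
  the closure on the remainder.\<close>

lemma conv_tbar:
  assumes x: "conv x u"
  shows "(\<lambda>n. tbar (x n - u) (x n - u)) \<longlonglongrightarrow> 0"
proof -
  have xD: "\<And>n. x n \<in> D" using x by auto
  have u: "u \<in> Dbar" using in_Dbar[OF x] .
  have "(\<lambda>n. quad tbar (x n - u)) \<longlonglongrightarrow> 0"
  proof (rule LIMSEQ_I)
    fix e :: real assume "e > 0"
    then have "e / 2 > 0" by simp
    then obtain M where M: "\<And>m n. m \<ge> M \<Longrightarrow> n \<ge> M \<Longrightarrow> quad t (x m - x n) < e / 2"
      using null2D[of "\<lambda>m n. quad t (x m - x n)" "e / 2"] x unfolding form_conv_iff form_cauchy_iff[OF xD]
      by blast
    have "norm (quad tbar (x n - u) - 0) < e" if n: "n \<ge> M" for n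
    proof -
      have c: "conv (\<lambda>m. x n - x m) (x n - u)" using conv_diff[OF conv_const x] xD by blast
      have "quad tbar (x n - u) \<le> e / 2"
        using M[OF n] by (intro tendsto_upperbound[OF tendsto_Re[OF closure_form_lim[OF c c]]])
          (auto simp: eventually_sequentially intro!: exI[of _ M] less_imp_le)
      moreover have "0 \<le> quad tbar (x n - u)"
        using xD u by (intro bar.Re_nonneg) (simp add: in_Dbar_if)
      ultimately show ?thesis using \<open>e > 0\<close> by simp
    qed
    then show "\<exists>no. \<forall>n\<ge>no. norm (quad tbar (x n - u) - 0) < e" by blast
  qed
  moreover have "\<And>n. x n - u \<in> Dbar" using xD u by (simp add: in_Dbar_if)
  ultimately show ?thesis using bar.form_null_iff by simp
qed

text \<open>A sequence in the domain of the closure is replaced by one in the original domain that is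
  close to it both in the seminorm and in the form.\<close>

lemma closed_closure: "closed_form H N Dbar tbar"
  unfolding closed_form_def
proof (intro conjI allI impI, rule Dbar_subset)
  fix y u assume *: "(\<forall>n. y n \<in> Dbar) \<and> u \<in> H \<and> form_conv N tbar y u"
  then have y: "\<And>n. y n \<in> Dbar" and u: "u \<in> H" and Ny: "(\<lambda>n. N (y n - u)) \<longlonglongrightarrow> 0"
    and cy: "form_cauchy tbar y" by (auto simp: form_conv_iff)
  define e where "e n = inverse (real (Suc n))" for n
  have e: "e n > 0" for n by (simp add: e_def)
  have e0: "e \<longlonglongrightarrow> 0" unfolding e_def by (rule LIMSEQ_inverse_real_of_nat)
  have "\<exists>a\<in>D. N (a - y n) < e n \<and> quad tbar (a - y n) < e n" for n
  proof -
    obtain x where x: "conv x (y n)" using Dbar_conv y by blast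
    have "eventually (\<lambda>k. N (x k - y n) < e n) sequentially"
      using x e[of n] by (intro order_tendstoD(2)) (auto simp: form_conv_iff)
    moreover have "eventually (\<lambda>k. quad tbar (x k - y n) < e n) sequentially"
      using tendsto_Re[OF conv_tbar[OF x]] e[of n] by (intro order_tendstoD(2)) auto
    ultimately obtain k where "N (x k - y n) < e n" "quad tbar (x k - y n) < e n"
      using eventually_happens'[OF sequentially_bot eventually_conj] by blast
    then show ?thesis using x by (intro bexI[of _ "x k"]) simp_all
  qed
  then obtain x where x: "\<And>n. x n \<in> D" "\<And>n. N (x n - y n) < e n"
    "\<And>n. quad tbar (x n - y n) < e n" by metis
  have xb: "\<And>n. x n \<in> Dbar" using x(1) by (simp add: in_Dbar_if)
  have H: "\<And>n. x n \<in> H" "\<And>n. y n \<in> H" using xb y Dbar_subset by blast+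
  have Nd: "(\<lambda>n. N (x n - y n)) \<longlonglongrightarrow> 0"
    using x(2) N_nonneg H e0
    by (rule_tac Lim_null_comparison[of _ e]) (auto intro!: always_eventually less_imp_le)
  have "(\<lambda>n. N ((x n - y n) + (y n - u))) \<longlonglongrightarrow> 0"
    using H u Nd Ny by (intro N_null) auto
  then have Nx: "(\<lambda>n. N (x n - u)) \<longlonglongrightarrow> 0" by simp
  have xy0: "(\<lambda>n. quad tbar (x n - y n)) \<longlonglongrightarrow> 0"
    using x(3) bar.Re_nonneg xb y e0
    by (rule_tac Lim_null_comparison[of _ e]) (auto intro!: always_eventually less_imp_le)
  have dc: "form_cauchy tbar (\<lambda>n. x n - y n)"
    using xy0 xb y by (intro bar.form_cauchy_if_limit[where u = 0]) auto
  have "form_cauchy tbar (\<lambda>n. (x n - y n) + y n)"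
    by (rule bar.form_cauchy_add[OF _ dc y cy]) (use xb y in simp)
  then have "form_cauchy t x"
    using x(1) by (simp add: form_cauchy_def tbar_eq)
  then have cx: "conv x u" using x(1) u Nx by (simp add: form_conv_iff)
  have ub: "u \<in> Dbar" using in_Dbar[OF cx] .
  moreover have "(\<lambda>n. tbar (y n - u) (y n - u)) \<longlonglongrightarrow> 0"
  proof -
    have le: "quad tbar (y n - u)
        \<le> 2 * quad tbar (x n - y n) + 2 * quad tbar (x n - u)" for n
      using bar.q_add_le[of "- (x n - y n)" "x n - u"] xb y ub
        bar.q_uminus[of "x n - y n"] by auto
    have "(\<lambda>n. 2 * quad tbar (x n - y n) + 2 * quad tbar (x n - u)) \<longlonglongrightarrow> 2 * 0 + 2 * 0"
      using tendsto_Re[OF conv_tbar[OF cx]] xy0 by (intro tendsto_intros) auto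
    then have "(\<lambda>n. quad tbar (y n - u)) \<longlonglongrightarrow> 0"
      using le bar.Re_nonneg y ub
      by (rule_tac Lim_null_comparison[of _ "\<lambda>n. 2 * quad tbar (x n - y n) + 2 * quad tbar (x n - u)"]) auto
    moreover have "\<And>n. y n - u \<in> Dbar" using y ub by simp
    ultimately show ?thesis using bar.form_null_iff by simp
  qed
  ultimately show "u \<in> Dbar" "(\<lambda>n. tbar (y n - u) (y n - u)) \<longlonglongrightarrow> 0" by auto
qed

lemma admits_closure: "admits_closure H N D t"
  unfolding admits_closure_def sectorial_form_iff
  using sect_form_closure closed_closure D_Dbar tbar_eq by blast

end

text \<open>A sectorial form is closable as soon as Cauchy sequences tending to zero are weakly null
  for the form.\<close>

lemma (in sect_form) form_null_if_weakly_null: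
  assumes x: "\<And>n. x n \<in> D" and c: "form_cauchy t x"
    and weak: "\<And>n. (\<lambda>m. t (x n) (x m)) \<longlonglongrightarrow> 0"
  shows "(\<lambda>n. t (x n) (x n)) \<longlonglongrightarrow> 0"
proof -
  obtain C where C: "\<And>n. quad t (x n) \<le> C" "C \<ge> 0" using form_cauchy_bounded[OF x c] by blast
  define B where "B = 2 * (1 + K) * sqrt C + 1"
  have B: "B > 0" using C K_nonneg by (simp add: B_def add_nonneg_pos)
  show ?thesis
  proof (rule LIMSEQ_I)
    fix e :: real assume e: "e > 0"
    then have "(e / (2 * B))\<^sup>2 > 0" using B by simp
    then obtain M1 where M1: "\<And>m n. m \<ge> M1 \<Longrightarrow> n \<ge> M1 \<Longrightarrow> quad t (x m - x n) < (e / (2 * B))\<^sup>2"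
      using null2D c unfolding form_cauchy_iff[OF x] by blast
    have "norm (t (x n) (x n) - 0) < e" if n: "n \<ge> M1" for n
    proof -
      have "cmod (t (x n) (x n)) - cmod (t (x n) (x m)) \<le> e / 2" if "m \<ge> M1" for m
      proof -
        have s: "sqrt (quad t (x n - x m)) \<le> e / (2 * B)"
          using M1[of n m] n that e B by (intro real_le_lsqrt) auto
        have "cmod (t (x n) (x n)) - cmod (t (x n) (x m)) \<le> cmod (t (x n) (x n - x m))"
          using x norm_triangle_ineq2[of "t (x n) (x n)" "t (x n) (x m)"] by (simp add: expand)
        also have "\<dots> \<le> 2 * (1 + K) * sqrt (quad t (x n)) * sqrt (quad t (x n - x m))"
          using x by (intro Cauchy_Schwarz) auto
        also have "\<dots> \<le> 2 * (1 + K) * sqrt C * (e / (2 * B))"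
          using C K_nonneg s e B x Re_nonneg by (intro mult_mono) auto
        also have "\<dots> \<le> B * (e / (2 * B))"
          using e B by (intro mult_right_mono) (auto simp: B_def)
        also have "\<dots> = e / 2" using B by simp
        finally show ?thesis .
      qed
      moreover have "(\<lambda>m. cmod (t (x n) (x n)) - cmod (t (x n) (x m))) \<longlonglongrightarrow> cmod (t (x n) (x n)) - cmod 0"
        by (intro tendsto_intros weak)
      ultimately have "cmod (t (x n) (x n)) - cmod 0 \<le> e / 2"
        by (intro tendsto_upperbound[of _ _ sequentially])
          (auto simp: eventually_sequentially intro!: exI[of _ M1])
      then show ?thesis using e by simp
    qed
    then show "\<exists>no. \<forall>n\<ge>no. norm (t (x n) (x n) - 0) < e" by blast
  qed
qed

section \<open>Closed forms and operators in a Hilbert space\<close>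

lemma op_app_eq: "linear_operator T \<Longrightarrow> (u, h) \<in> T \<Longrightarrow> op_app T u = h"
  unfolding op_app_def linear_operator_def single_valued_def by (intro the_equality) auto

lemma op_app_in: "linear_operator T \<Longrightarrow> u \<in> Domain T \<Longrightarrow> (u, op_app T u) \<in> T"
  using op_app_eq by fastforce

lemma clinear_on_op_app:
  assumes T: "linear_operator T"
  shows "clinear_on (Domain T) (op_app T)"
proof -
  have 0: "(0, 0) \<in> T" using T unfolding linear_operator_def csubspace_def zero_prod_def by blast
  have add: "(u + v, op_app T u + op_app T v) \<in> T" if "u \<in> Domain T" "v \<in> Domain T" for u v
    using csubspace_add[OF _ op_app_in[OF T that(1)] op_app_in[OF T that(2)]] T
    by (simp add: linear_operator_def)
  have scale: "(c *\<^sub>C u, c *\<^sub>C op_app T u) \<in> T" if "u \<in> Domain T" for u c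
    using csubspace_scaleC[OF _ op_app_in[OF T that], of c] T
    by (simp add: linear_operator_def scaleC_prod_def)
  show ?thesis
    unfolding clinear_on_def csubspace_def
    using 0 add scale op_app_eq[OF T add] op_app_eq[OF T scale] by (blast intro: DomainI)
qed

definition sectorial_operator_with :: "real \<Rightarrow> ('a::complex_inner \<times> 'a) set \<Rightarrow> bool" where
  "sectorial_operator_with K T \<longleftrightarrow> linear_operator T \<and> 0 \<le> K
     \<and> (\<forall>(u, h)\<in>T. 0 \<le> Re (cinner h u) \<and> \<bar>Im (cinner h u)\<bar> \<le> K * Re (cinner h u))"

lemma ex_sectorial_angle_op_iff:
  assumes "linear_operator T"
  shows "(\<exists>\<alpha>. 0 \<le> \<alpha> \<and> \<alpha> < pi / 2 \<and> sectorial_angle_op \<alpha> T) \<longleftrightarrow> (\<exists>K. sectorial_operator_with K T)"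
  using assms ex_sector_iff[of "(\<lambda>(u, h). cinner h u) ` T"]
  unfolding sectorial_operator_with_def sectorial_angle_op_def by (auto simp: image_subset_iff)

abbreviation operator_form :: "('a::complex_inner \<times> 'a) set \<Rightarrow> 'a \<Rightarrow> 'a \<Rightarrow> complex" where
  "operator_form T \<equiv> \<lambda>u v. cinner (op_app T u) v"

lemma sect_form_operator:
  assumes "sectorial_operator_with K T"
  shows "sect_form (Domain T) (operator_form T) K"
proof -
  have T: "linear_operator T" using assms by (simp add: sectorial_operator_with_def)
  note lin = clinear_on_op_app[OF T]
  show ?thesis
  proof
    show "sesquilinear_on (Domain T) (operator_form T)"
      unfolding sesquilinear_on_def
      using clinear_on_csubspace[OF lin] clinear_on_add[OF lin] clinear_on_scaleC[OF lin]
      by (simp add: cinner_simps)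
  qed (use assms op_app_in[OF T] in \<open>auto simp: sectorial_operator_with_def\<close>)
qed

text \<open>If \<open>x\<^sub>n\<close> tends to zero, then \<open>(Tx\<^sub>n, x\<^sub>m)\<close> tends to zero as \<open>m\<close> grows, for each \<open>n\<close>. This is
  the weak condition that suffices for closability.\<close>

lemma closable_form_operator:
  assumes "sectorial_operator_with K (T :: ('a::complex_inner \<times> 'a) set)"
  shows "closable_form (Domain T) (operator_form T) K UNIV norm"
proof -
  interpret sect_form "Domain T" "operator_form T" K by (rule sect_form_operator[OF assms])
  show ?thesis
  proof
    show "csubspace (UNIV :: 'a set)" by (simp add: csubspace_def)
    fix x :: "nat \<Rightarrow> 'a" assume x: "\<And>n. x n \<in> Domain T" "(\<lambda>n. norm (x n)) \<longlonglongrightarrow> 0"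
      "form_cauchy (operator_form T) x"
    have x0: "x \<longlonglongrightarrow> 0" using x(2) by (simp add: tendsto_norm_zero_iff)
    have "(\<lambda>m. cinner (op_app T (x n)) (x m)) \<longlonglongrightarrow> cinner (op_app T (x n)) 0" for n
      by (intro tendsto_intros x0)
    then show "(\<lambda>n. cinner (op_app T (x n)) (x n)) \<longlonglongrightarrow> 0"
      by (intro form_null_if_weakly_null x) simp
  qed (auto simp: norm_triangle_ineq)
qed

context sect_form
begin

lemma sect_form_adj: "sect_form D (form_adj t) K"
proof
  show "sesquilinear_on D (form_adj t)"
    using csub unfolding sesquilinear_on_def form_adj_def by (simp add: expand)
qed (simp_all add: form_adj_def Re_nonneg Im_le K_nonneg)

lemma closed_form_adj: "closed_form H N D t \<Longrightarrow> closed_form H N D (form_adj t)"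
  unfolding closed_form_def form_conv_def form_adj_def
  by (simp add: lim_cnj[where l = 0 and F = sequentially, simplified]) blast

lemma closed_form_re: "closed_form H N D t \<Longrightarrow> closed_form H N D (form_re t)"
  unfolding closed_form_def form_conv_iff
proof (intro conjI allI impI)
  fix x u assume c: "D \<subseteq> H \<and> (\<forall>x u. (\<forall>n. x n \<in> D) \<and> u \<in> H \<and> (\<lambda>n. N (x n - u)) \<longlonglongrightarrow> 0 \<and> form_cauchy t x
      \<longrightarrow> u \<in> D \<and> (\<lambda>n. t (x n - u) (x n - u)) \<longlonglongrightarrow> 0)"
    and x: "(\<forall>n. x n \<in> D) \<and> u \<in> H \<and> (\<lambda>n. N (x n - u)) \<longlonglongrightarrow> 0 \<and> form_cauchy (form_re t) x"
  have "form_cauchy t x" using x form_cauchy_re_iff[of x] by simp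
  then have *: "u \<in> D" "(\<lambda>n. t (x n - u) (x n - u)) \<longlonglongrightarrow> 0" using c x by blast+
  show "u \<in> D" by (rule *)
  show "(\<lambda>n. form_re t (x n - u) (x n - u)) \<longlonglongrightarrow> 0"
    using * x form_null_re_iff[of "\<lambda>n. x n - u"] by simp
qed blast

lemma sect_form_re: "sect_form D (form_re t) 0"
  using herm_form_re by (rule herm_form.axioms(1))

end

text \<open>Closedness in a Hilbert space amounts to completeness after adding the inner product, which
  makes the Lax-Milgram theorem applicable to the shifted form.\<close>

locale closed_sect_form = sect_form D t K for D :: "'a::chilbert_space set" and t K +
  assumes closed: "closed_form UNIV norm D t"
begin

lemma sect_form_shift: "sect_form D (\<lambda>u v. t u v + cinner u v) K"
proof
  show "sesquilinear_on D (\<lambda>u v. t u v + cinner u v)"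
    unfolding sesquilinear_on_def using csub by (simp add: expand cinner_simps algebra_simps)
  fix u assume u: "u \<in> D"
  have n: "Re (cinner u u) \<ge> 0" by (simp add: norm_cinner)
  show "0 \<le> Re (t u u + cinner u u)" using Re_nonneg[OF u] n by simp
  have "K * quad t u \<le> K * Re (t u u + cinner u u)"
    using K_nonneg n by (intro mult_left_mono) auto
  then show "\<bar>Im (t u u + cinner u u)\<bar> \<le> K * Re (t u u + cinner u u)" using Im_le[OF u] by simp
qed (rule K_nonneg)

lemma form_complete_shift: "form_complete D (\<lambda>u v. t u v + cinner u v)"
proof -
  interpret s: sect_form D "\<lambda>u v. t u v + cinner u v" K by (rule sect_form_shift)
  have "\<exists>u\<in>D. (\<lambda>n. t (x n - u) (x n - u) + cinner (x n - u) (x n - u)) \<longlonglongrightarrow> 0"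
    if x: "\<And>n. x n \<in> D" and c: "form_cauchy (\<lambda>u v. t u v + cinner u v) x" for x
  proof -
    have c': "null2 (\<lambda>m n. quad t (x m - x n) + (norm (x m - x n))\<^sup>2)"
      using c unfolding s.form_cauchy_iff[OF x] by (simp add: norm_sq_cinner)
    have "quad t (x m - x n) \<ge> 0" for m n using x Re_nonneg by simp
    then have "null2 (\<lambda>m n. (norm (x m - x n))\<^sup>2)" using null2_le[OF c'] by simp
    from convergent_if_null2[OF this] obtain u where u: "x \<longlonglongrightarrow> u" by blast
    have ct: "form_cauchy t x" unfolding form_cauchy_iff[OF x] using null2_le[OF c'] by simp
    have d0: "(\<lambda>n. x n - u) \<longlonglongrightarrow> 0" using u by (simp add: LIM_zero)
    then have n0: "(\<lambda>n. norm (x n - u)) \<longlonglongrightarrow> 0" by (rule tendsto_norm_zero)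
    have "u \<in> D" "(\<lambda>n. t (x n - u) (x n - u)) \<longlonglongrightarrow> 0"
      using closed x ct n0 unfolding closed_form_def form_conv_iff by blast+
    moreover have "(\<lambda>n. cinner (x n - u) (x n - u)) \<longlonglongrightarrow> cinner (0::'a) 0"
      by (rule tendsto_cinner[OF d0 d0])
    ultimately show ?thesis using tendsto_add by fastforce
  qed
  then show ?thesis unfolding form_complete_def by blast
qed

lemma surjective_shift: obtains u where "u \<in> D" "\<And>v. v \<in> D \<Longrightarrow> t u v + cinner u v = cinner w v"
proof -
  interpret s: sect_form D "\<lambda>u v. t u v + cinner u v" K by (rule sect_form_shift)
  have "bounded_antilinear D (\<lambda>u v. t u v + cinner u v) (cinner w)"
    unfolding bounded_antilinear_def
  proof (intro conjI)
    have "cmod (cinner w v) \<le> norm w * sqrt (Re (t v v + cinner v v))" if "v \<in> D" for v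
    proof -
      have "norm v \<le> sqrt (Re (t v v + cinner v v))"
        using Re_nonneg[OF that] by (intro real_le_rsqrt) (simp add: norm_sq_cinner)
      then show ?thesis
        using cinner_Cauchy_Schwarz[of w v] mult_left_mono[of "norm v" _ "norm w"] by fastforce
    qed
    then show "\<exists>C\<ge>0. \<forall>v\<in>D. cmod (cinner w v) \<le> C * sqrt (Re (t v v + cinner v v))"
      by (intro exI[of _ "norm w"]) auto
  qed (simp_all add: cinner_simps)
  then show thesis using s.Lax_Milgram[OF form_complete_shift] that by blast
qed

end

lemma (in closed_sect_form) closed_limit:
  assumes "\<And>n. x n \<in> D" "x \<longlonglongrightarrow> u" "form_cauchy t x"
  shows "u \<in> D" "(\<lambda>n. quad t (x n - u)) \<longlonglongrightarrow> 0"
proof -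
  have "form_conv norm t x u"
    using assms by (simp add: form_conv_iff tendsto_norm_zero_iff LIM_zero_iff)
  then have *: "u \<in> D \<and> (\<lambda>n. t (x n - u) (x n - u)) \<longlonglongrightarrow> 0"
    using closed[unfolded closed_form_def, THEN conjunct2, rule_format, of x u] assms(1) by simp
  then show "u \<in> D" by simp
  show "(\<lambda>n. quad t (x n - u)) \<longlonglongrightarrow> 0"
    using tendsto_Re[OF conjunct2[OF *]] by simp
qed

lemma closed_sect_form_re:
  assumes "closed_sect_form D t K"
  shows "closed_sect_form D (form_re t) 0"
proof -
  interpret closed_sect_form D t K by (rule assms)
  show ?thesis
    using sect_form_re closed_form_re[OF closed]
    by (simp add: closed_sect_form_def closed_sect_form_axioms_def)
qed

lemma closed_sect_form_adj:
  assumes "closed_sect_form D t K"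
  shows "closed_sect_form D (form_adj t) K"
proof -
  interpret closed_sect_form D t K by (rule assms)
  show ?thesis
    using sect_form_adj closed_form_adj[OF closed]
    by (simp add: closed_sect_form_def closed_sect_form_axioms_def)
qed

lemma herm_form_shift:
  assumes "closed_sect_form D p 0" "herm_form D p"
  shows "herm_form D (\<lambda>u v. p u v + cinner u v)"
proof -
  interpret closed_sect_form D p 0 by (rule assms)
  interpret h: herm_form D p by (rule assms)
  have "p u v + cinner u v = cnj (p v u + cinner v u)" if "u \<in> D" "v \<in> D" for u v
    using h.herm[OF that] cinner_commute[of u v] by simp
  with sect_form_shift show ?thesis by (simp add: herm_form_def herm_form_axioms_def)
qed

lemma null_summands:
  assumes "\<And>n. 0 \<le> f n" "\<And>n. 0 \<le> g n" "(\<lambda>n. f n + g n :: real) \<longlonglongrightarrow> 0"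
  shows "f \<longlonglongrightarrow> 0" "g \<longlonglongrightarrow> 0"
  using assms by (auto intro: Lim_null_comparison[of _ "\<lambda>n. f n + g n"] always_eventually)

lemma core_if_orthogonal_trivial:
  assumes p: "closed_sect_form D p 0" "herm_form D p" and E: "csubspace E" "E \<subseteq> D"
    and orth: "\<And>v. v \<in> D \<Longrightarrow> (\<And>u. u \<in> E \<Longrightarrow> p u v + cinner u v = 0) \<Longrightarrow> v = 0"
    and u: "u \<in> D"
  obtains x where "\<And>n. x n \<in> E" "x \<longlonglongrightarrow> u" "(\<lambda>n. quad p (x n - u)) \<longlonglongrightarrow> 0"
proof -
  interpret closed_sect_form D p 0 by (rule p)
  let ?q = "\<lambda>u v. p u v + cinner u v"
  interpret q: herm_form D ?q by (rule herm_form_shift[OF p])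
  have "quad ?q v = 0" if v: "v \<in> D" and o: "\<And>u. u \<in> E \<Longrightarrow> ?q v u = 0" for v
  proof -
    have "?q u v = 0" if "u \<in> E" for u
      using q.herm[of u v] o[OF that] v E(2) that by auto
    then have "v = 0" by (rule orth[OF v])
    then show ?thesis using q.zero_left by simp
  qed
  then obtain x where x: "\<And>n. x n \<in> E" "(\<lambda>n. quad ?q (x n - u)) \<longlonglongrightarrow> 0"
    using q.dense_if_orthogonal_trivial[OF form_complete_shift E _ u] by blast
  have eq: "quad ?q (x n - u) = quad p (x n - u) + (norm (x n - u))\<^sup>2" for n
    by (simp add: norm_sq_cinner)
  have nn: "0 \<le> quad p (x n - u)" for n using x(1) E(2) u by (intro Re_nonneg) auto
  have "(\<lambda>n. (norm (x n - u))\<^sup>2) \<longlonglongrightarrow> 0"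
    using null_summands(2)[OF nn _ x(2)[unfolded eq]] by simp
  then have "x \<longlonglongrightarrow> u" by (simp only: norm_sq_null_iff LIM_zero_iff)
  moreover have "(\<lambda>n. quad p (x n - u)) \<longlonglongrightarrow> 0"
    using null_summands(1)[OF nn _ x(2)[unfolded eq]] by simp
  ultimately show thesis using x(1) that by blast
qed

text \<open>The zero form on a closed subspace is closed, so that orthogonal projections and the Riesz
  theorem on subspaces are instances of the theory of closed forms.\<close>

lemma closed_subspace_form:
  assumes V: "csubspace V" "closed (V :: 'a::chilbert_space set)"
  shows "closed_sect_form V (\<lambda>u v. 0) 0"
proof -
  have sc: "sect_form V (\<lambda>u v. 0) 0"
    by unfold_locales (auto simp: sesquilinear_on_def V)
  have "closed_form UNIV norm V (\<lambda>u v. 0)"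
    unfolding closed_form_def form_conv_iff
  proof (intro conjI allI impI subset_UNIV)
    fix y u assume "(\<forall>n. y n \<in> V) \<and> u \<in> UNIV \<and> (\<lambda>n. norm (y n - u)) \<longlonglongrightarrow> 0 \<and> form_cauchy (\<lambda>u v. 0) y"
    then show "u \<in> V" using V(2) closed_sequential_limits[of V]
      by (metis Lim_null tendsto_norm_zero_iff)
  qed auto
  with sc show ?thesis
    by (simp add: closed_sect_form_def closed_sect_form_axioms_def)
qed

lemma orthogonal_projection:
  assumes V: "csubspace V" "closed V"
  obtains m where "m \<in> V" "\<And>v. v \<in> V \<Longrightarrow> cinner (x - m) (v::'a::chilbert_space) = 0"
proof -
  interpret closed_sect_form V "\<lambda>u v. 0" 0 by (rule closed_subspace_form[OF V])
  obtain m where "m \<in> V" "\<And>v. v \<in> V \<Longrightarrow> 0 + cinner m v = cinner x v"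
    using surjective_shift by metis
  then show thesis by (intro that[of m]) (simp_all add: cinner_simps)
qed

lemma csubspace_closure:
  assumes "csubspace V"
  shows "csubspace (closure (V :: 'a::complex_inner set))"
  unfolding csubspace_def
proof (intro conjI ballI allI)
  show "0 \<in> closure V" using csubspace_0[OF assms] closure_subset by blast
  fix x assume "x \<in> closure V"
  then obtain x' where x: "\<And>n. x' n \<in> V" "x' \<longlonglongrightarrow> x" by (auto simp: closure_sequential)
  show "c *\<^sub>C x \<in> closure V" for c
    unfolding closure_sequential using x csubspace_scaleC[OF assms]
    by (intro exI[of _ "\<lambda>n. c *\<^sub>C x' n"]) (auto intro: tendsto_intros)
  fix y assume "y \<in> closure V"
  then obtain y' where y: "\<And>n. y' n \<in> V" "y' \<longlonglongrightarrow> y" by (auto simp: closure_sequential)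
  show "x + y \<in> closure V"
    unfolding closure_sequential using x y csubspace_add[OF assms]
    by (intro exI[of _ "\<lambda>n. x' n + y' n"]) (auto intro: tendsto_intros)
qed

lemma in_closure_if_orthogonal:
  assumes V: "csubspace V"
    and "\<And>w. (\<And>v. v \<in> V \<Longrightarrow> cinner w v = 0) \<Longrightarrow> cinner x w = 0"
  shows "x \<in> closure (V :: 'a::chilbert_space set)"
proof -
  obtain m where m: "m \<in> closure V" "\<And>v. v \<in> closure V \<Longrightarrow> cinner (x - m) v = 0"
    using orthogonal_projection[OF csubspace_closure[OF V]] by auto
  have "cinner x (x - m) = 0" using assms(2)[of "x - m"] m(2) closure_subset by blast
  moreover have "cinner m (x - m) = 0" using m(2)[OF m(1)] cinner_commute[of m "x - m"] by simp
  ultimately have "cinner (x - m) (x - m) = 0" by (simp add: cinner_diff_left)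
  then have "x = m" by (simp add: norm_cinner)
  then show ?thesis using m by simp
qed

lemma orthogonal_closure:
  assumes "\<And>v. v \<in> V \<Longrightarrow> cinner w (v::'a::complex_inner) = 0" "x \<in> closure V"
  shows "cinner w x = 0"
proof -
  obtain y where y: "\<And>n. y n \<in> V" "y \<longlonglongrightarrow> x" using assms(2) by (auto simp: closure_sequential)
  have "(\<lambda>n. cinner w (y n)) \<longlonglongrightarrow> cinner w x" by (intro tendsto_intros y)
  then show ?thesis using assms(1) y(1) LIMSEQ_unique[of "\<lambda>n. 0" 0] by simp
qed

section \<open>The Friedrichs extension and its square root\<close>

lemma selfadjointD:
  assumes "adjoint_op R = R"
  shows selfadjoint_sym: "\<And>u h v k. (u, h) \<in> R \<Longrightarrow> (v, k) \<in> R \<Longrightarrow> cinner h v = cinner u k"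
    and selfadjointI: "\<And>v w. (\<And>u h. (u, h) \<in> R \<Longrightarrow> cinner h v = cinner u w) \<Longrightarrow> (v, w) \<in> R"
proof -
  show "cinner h v = cinner u k" if "(u, h) \<in> R" "(v, k) \<in> R" for u h v k
  proof -
    have "(v, k) \<in> adjoint_op R" using that assms by simp
    then show ?thesis using that by (auto simp: adjoint_op_def)
  qed
  show "(v, w) \<in> R" if "\<And>u h. (u, h) \<in> R \<Longrightarrow> cinner h v = cinner u w" for v w
  proof -
    have "(v, w) \<in> adjoint_op R" using that by (auto simp: adjoint_op_def)
    then show ?thesis using assms by simp
  qed
qed

lemma selfadjoint_closed:
  assumes R: "adjoint_op R = R" and x: "\<And>n. (x n, y n) \<in> R" "x \<longlonglongrightarrow> u" "y \<longlonglongrightarrow> h"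
  shows "(u, h :: 'a::complex_inner) \<in> R"
proof (rule selfadjointI[OF R])
  fix v k assume v: "(v, k) \<in> R"
  have "(\<lambda>n. cinner k (x n)) \<longlonglongrightarrow> cinner k u" "(\<lambda>n. cinner v (y n)) \<longlonglongrightarrow> cinner v h"
    by (intro tendsto_intros x)+
  moreover have "cinner k (x n) = cinner v (y n)" for n using selfadjoint_sym[OF R v x(1)] .
  ultimately show "cinner k u = cinner v h" using LIMSEQ_unique by simp
qed

lemma (in closed_sect_form) csubspace_Range_form_operator: "csubspace (Range (form_operator D t))"
  unfolding csubspace_def
proof (intro conjI ballI allI)
  have "(0, 0) \<in> form_operator D t" by (simp add: form_operator_def expand)
  then show "0 \<in> Range (form_operator D t)" by blast
  fix x assume "x \<in> Range (form_operator D t)"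
  then obtain u where u: "(u, x) \<in> form_operator D t" by blast
  then have "(c *\<^sub>C u, c *\<^sub>C x) \<in> form_operator D t" for c
    by (simp add: form_operator_def expand cinner_simps)
  then show "c *\<^sub>C x \<in> Range (form_operator D t)" for c by blast
  fix y assume "y \<in> Range (form_operator D t)"
  then obtain v where v: "(v, y) \<in> form_operator D t" by blast
  then have "(u + v, x + y) \<in> form_operator D t"
    using u by (simp add: form_operator_def expand cinner_simps)
  then show "x + y \<in> Range (form_operator D t)" by blast
qed

locale friedrichs =
  fixes S R :: "('a::chilbert_space \<times> 'a) set" and G :: "'a \<Rightarrow> 'a" and K :: real
  assumes S_sect: "sectorial_operator_with K S"
    and S_dense: "densely_defined S"
    and S_sqrt: "is_sqrt_op (S_FR S) R"
    and S_GF: "is_GF S R G"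
begin

abbreviation D where "D \<equiv> DS S"
abbreviation a where "a \<equiv> S_form S"
abbreviation Rf where "Rf \<equiv> op_app R"
abbreviation V where "V \<equiv> ran_SF S"

sublocale s: closable_form "Domain S" "operator_form S" K UNIV norm
  by (rule closable_form_operator[OF S_sect])

sublocale a: closed_sect_form D a K
  using s.sect_form_closure s.closed_closure
  unfolding DS_def S_form_def by (simp add: closed_sect_form_def closed_sect_form_axioms_def)

sublocale p: closed_sect_form D "form_re a" 0
  by (rule closed_sect_form_re[OF a.closed_sect_form_axioms])

lemma S_linear: "linear_operator S"
  using S_sect by (simp add: sectorial_operator_with_def)

lemma dom_S_D: "u \<in> Domain S \<Longrightarrow> u \<in> D"
  using s.in_Dbar_if unfolding DS_def .

lemma a_dom_S: "u \<in> Domain S \<Longrightarrow> v \<in> Domain S \<Longrightarrow> a u v = cinner (op_app S u) v"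
  using s.tbar_eq unfolding S_form_def .

lemma core:
  assumes "u \<in> D"
  obtains x where "\<And>n. x n \<in> Domain S" "x \<longlonglongrightarrow> u" "(\<lambda>n. quad a (x n - u)) \<longlonglongrightarrow> 0"
proof -
  obtain x where x: "s.conv x u" using s.Dbar_conv assms unfolding DS_def by blast
  have "x \<longlonglongrightarrow> u" using x by (simp add: form_conv_iff tendsto_norm_zero_iff LIM_zero_iff)
  moreover have "(\<lambda>n. quad a (x n - u)) \<longlonglongrightarrow> 0"
    using tendsto_Re[OF s.conv_tbar[OF x]] unfolding S_form_def by simp
  ultimately show thesis using x that by blast
qed

lemma a_dom_S_left:
  assumes "u \<in> Domain S" "v \<in> D"
  shows "a u v = cinner (op_app S u) v"
proof -
  obtain x where x: "\<And>n. x n \<in> Domain S" "x \<longlonglongrightarrow> v" "(\<lambda>n. quad a (x n - v)) \<longlonglongrightarrow> 0"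
    using core[OF assms(2)] by blast
  have "(\<lambda>n. a u (x n)) \<longlonglongrightarrow> a u v"
    using x assms dom_S_D by (intro a.form_tendsto) (auto simp: a.expand)
  moreover have "(\<lambda>n. cinner (op_app S u) (x n)) \<longlonglongrightarrow> cinner (op_app S u) v"
    by (intro tendsto_intros x)
  ultimately show ?thesis using LIMSEQ_unique a_dom_S assms(1) x(1) by simp
qed

lemma closure_D: "closure D = UNIV"
  using S_dense closure_mono[of "Domain S" D] dom_S_D unfolding densely_defined_def by auto

lemma R_linear: "linear_operator R" and R_adj: "adjoint_op R = R" and R_sq: "R O R = S_FR S"
  using S_sqrt by (auto simp: is_sqrt_op_def nonneg_selfadjoint_def)

lemmas Rf_in = op_app_in[OF R_linear]
lemmas Rf_eq = op_app_eq[OF R_linear]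
lemmas Rf_lin = clinear_on_op_app[OF R_linear]

lemma S_FR_iff: "(u, h) \<in> S_FR S \<longleftrightarrow> u \<in> D \<and> (\<forall>v\<in>D. form_re a u v = cinner h v)"
  by (simp add: S_FR_def form_operator_def)

lemma S_FR_D: "u \<in> Domain (S_FR S) \<Longrightarrow> u \<in> D"
  using S_FR_iff by blast

lemma S_FR_R:
  assumes "(u, h) \<in> S_FR S"
  shows "u \<in> Domain R" "(Rf u, h) \<in> R"
proof -
  obtain y where y: "(u, y) \<in> R" "(y, h) \<in> R" using assms R_sq by blast
  then show "u \<in> Domain R" "(Rf u, h) \<in> R" using Rf_eq[OF y(1)] by auto
qed

lemma S_FR_form:
  assumes "u \<in> Domain (S_FR S)" "v \<in> Domain (S_FR S)"
  shows "form_re a u v = cinner (Rf u) (Rf v)"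
proof -
  obtain h where h: "(u, h) \<in> S_FR S" using assms by blast
  have "form_re a u v = cinner h v" using h S_FR_iff S_FR_D[OF assms(2)] by blast
  also have "\<dots> = cinner (Rf u) (Rf v)"
    using S_FR_R(1) assms(2) by (intro selfadjoint_sym[OF R_adj S_FR_R(2)[OF h]] Rf_in) blast
  finally show ?thesis .
qed

lemma csubspace_dom_S_FR: "csubspace (Domain (S_FR S))"
  unfolding csubspace_def
proof (intro conjI ballI allI)
  have "(0, 0) \<in> S_FR S" by (simp add: S_FR_iff p.expand)
  then show "0 \<in> Domain (S_FR S)" by blast
  fix x assume "x \<in> Domain (S_FR S)"
  then obtain h where u: "(x, h) \<in> S_FR S" by blast
  then have "(c *\<^sub>C x, c *\<^sub>C h) \<in> S_FR S" for c
    by (simp add: S_FR_iff p.expand cinner_simps)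
  then show "c *\<^sub>C x \<in> Domain (S_FR S)" for c by blast
  fix y assume "y \<in> Domain (S_FR S)"
  then obtain k where v: "(y, k) \<in> S_FR S" by blast
  then have "(x + y, h + k) \<in> S_FR S"
    using u by (simp add: S_FR_iff p.expand cinner_simps)
  then show "x + y \<in> Domain (S_FR S)" by blast
qed

lemma S_FR_shift_surjective: obtains u where "(u, f - u) \<in> S_FR S"
proof -
  obtain u where "u \<in> D" "\<And>v. v \<in> D \<Longrightarrow> form_re a u v + cinner u v = cinner f v"
    using p.surjective_shift by blast
  then have "(u, f - u) \<in> S_FR S"
    by (auto simp: S_FR_iff cinner_simps algebra_simps eq_diff_eq)
  then show thesis by (rule that)
qed

text \<open>The hermitian form of the square root, to be identified with the real part of the form of
  \<open>S\<close>.\<close>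

definition r where "r u v = cinner (Rf u) (Rf v)"

lemma R_form: "closed_sect_form (Domain R) r 0"
proof -
  have sf: "sect_form (Domain R) r 0"
  proof
    show "sesquilinear_on (Domain R) r"
      unfolding sesquilinear_on_def r_def
      using clinear_on_csubspace[OF Rf_lin] clinear_on_add[OF Rf_lin] clinear_on_scaleC[OF Rf_lin]
      by (simp add: cinner_simps)
  qed (simp_all add: r_def norm_cinner)
  interpret sect_form "Domain R" r 0 by (rule sf)
  have "closed_form UNIV norm (Domain R) r"
    unfolding closed_form_def form_conv_iff
  proof (intro conjI allI impI subset_UNIV)
    fix x u assume *: "(\<forall>n. x n \<in> Domain R) \<and> u \<in> UNIV \<and> (\<lambda>n. norm (x n - u)) \<longlonglongrightarrow> 0
        \<and> form_cauchy r x"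
    then have x: "\<And>n. x n \<in> Domain R" and c: "form_cauchy r x" and xu: "x \<longlonglongrightarrow> u"
      by (auto simp: tendsto_norm_zero_iff LIM_zero_iff)
    have r: "quad r u = (norm (Rf u))\<^sup>2" for u by (simp add: r_def norm_sq_cinner)
    have d: "Rf (x m - x n) = Rf (x m) - Rf (x n)" for m n
      by (rule clinear_on_diff[OF Rf_lin x x])
    obtain y where y: "(\<lambda>n. Rf (x n)) \<longlonglongrightarrow> y"
      using convergent_if_null2[OF c[unfolded form_cauchy_iff[OF x] r d]] by blast
    have uy: "(u, y) \<in> R" using selfadjoint_closed[OF R_adj Rf_in[OF x] xu y] .
    then show u: "u \<in> Domain R" by blast
    have "Rf (x n - u) = Rf (x n) - y" for n
      using clinear_on_diff[OF Rf_lin x u] Rf_eq[OF uy] by simp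
    moreover have "(\<lambda>n. cinner (Rf (x n) - y) (Rf (x n) - y)) \<longlonglongrightarrow> cinner (0::'a) 0"
      using y by (intro tendsto_cinner) (simp_all add: LIM_zero)
    ultimately show "(\<lambda>n. r (x n - u) (x n - u)) \<longlonglongrightarrow> 0" by (simp add: r_def)
  qed
  with sf show ?thesis by (simp add: closed_sect_form_def closed_sect_form_axioms_def)
qed

sublocale r: closed_sect_form "Domain R" r 0 by (rule R_form)

lemma r_self: "quad r u = (norm (Rf u))\<^sup>2" by (simp add: r_def norm_sq_cinner)

text \<open>Both \<open>D[S]\<close> and the domain of the square root have the domain of \<open>S\<^sub>F\<^sub>R\<close> as a core, because the
  range of \<open>S\<^sub>F\<^sub>R + I\<close> is the whole space. On this core the two forms agree, and both are closed, so
  they have the same domain.\<close>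

lemma dom_S_FR_core_D:
  assumes u: "u \<in> D"
  obtains x where "\<And>n. x n \<in> Domain (S_FR S)" "x \<longlonglongrightarrow> u" "(\<lambda>n. quad a (x n - u)) \<longlonglongrightarrow> 0"
proof -
  have "v = 0" if v: "v \<in> D" and o: "\<And>u. u \<in> Domain (S_FR S) \<Longrightarrow> form_re a u v + cinner u v = 0" for v
  proof -
    obtain u where u: "(u, v - u) \<in> S_FR S" using S_FR_shift_surjective .
    have "form_re a u v + cinner u v = cinner v v" using u v by (auto simp: S_FR_iff cinner_simps)
    moreover have "form_re a u v + cinner u v = 0" using o u by blast
    ultimately show ?thesis by (simp add: norm_cinner)
  qed
  then obtain x where x: "\<And>n. x n \<in> Domain (S_FR S)" "x \<longlonglongrightarrow> u"
    "(\<lambda>n. quad (form_re a) (x n - u)) \<longlonglongrightarrow> 0"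
    using core_if_orthogonal_trivial[OF p.closed_sect_form_axioms a.herm_form_re csubspace_dom_S_FR _ _ u]
      S_FR_D by blast
  show thesis by (rule that[OF x(1,2)]) (use x(3) in \<open>simp add: a.form_re_self\<close>)
qed

lemma dom_S_FR_core_R:
  assumes u: "u \<in> Domain R"
  obtains x where "\<And>n. x n \<in> Domain (S_FR S)" "x \<longlonglongrightarrow> u" "(\<lambda>n. quad r (x n - u)) \<longlonglongrightarrow> 0"
proof -
  have "r u v = cnj (r v u)" for u v unfolding r_def by (rule cinner_commute)
  then have h: "herm_form (Domain R) r"
    by (intro herm_form.intro herm_form_axioms.intro r.sect_form_axioms)
  have "v = 0" if v: "v \<in> Domain R" and o: "\<And>u. u \<in> Domain (S_FR S) \<Longrightarrow> r u v + cinner u v = 0" for v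
  proof -
    obtain u where u: "(u, v - u) \<in> S_FR S" using S_FR_shift_surjective .
    have "r u v = cinner (v - u) v"
      unfolding r_def using selfadjoint_sym[OF R_adj S_FR_R(2)[OF u] Rf_in[OF v]] by simp
    then have "r u v + cinner u v = cinner v v" by (simp add: cinner_simps)
    moreover have "r u v + cinner u v = 0" using o u by blast
    ultimately show ?thesis by (simp add: norm_cinner)
  qed
  then show thesis
    using core_if_orthogonal_trivial[OF r.closed_sect_form_axioms h csubspace_dom_S_FR _ _ u] S_FR_R(1) that
    by blast
qed

lemma form_eq_dom_S_FR:
  assumes "u \<in> Domain (S_FR S)" "v \<in> Domain (S_FR S)"
  shows "quad a (u - v) = quad r (u - v)"
  using S_FR_form[of "u - v" "u - v"] csubspace_diff[OF csubspace_dom_S_FR assms]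
  by (simp add: a.form_re_self r_def complex_eq_iff)

lemma dom_S_FR_conv:
  assumes x: "\<And>n. x n \<in> Domain (S_FR S)" "x \<longlonglongrightarrow> u"
  shows "(u \<in> D \<and> (\<lambda>n. quad a (x n - u)) \<longlonglongrightarrow> 0)
    \<longleftrightarrow> (u \<in> Domain R \<and> (\<lambda>n. quad r (x n - u)) \<longlonglongrightarrow> 0)"
proof -
  have xD: "x n \<in> D" and xR: "x n \<in> Domain R" for n
    using x(1)[of n] S_FR_D S_FR_R(1) by blast+
  have c: "form_cauchy a x \<longleftrightarrow> form_cauchy r x"
    unfolding a.form_cauchy_iff[OF xD] r.form_cauchy_iff[OF xR]
    using form_eq_dom_S_FR[OF x(1) x(1)] by simp
  show ?thesis
  proof
    assume *: "u \<in> D \<and> (\<lambda>n. quad a (x n - u)) \<longlonglongrightarrow> 0"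
    then have "form_cauchy r x" using a.form_cauchy_if_limit[OF xD, of u] c by simp
    then show "u \<in> Domain R \<and> (\<lambda>n. quad r (x n - u)) \<longlonglongrightarrow> 0"
      using r.closed_limit[OF xR x(2)] by simp
  next
    assume *: "u \<in> Domain R \<and> (\<lambda>n. quad r (x n - u)) \<longlonglongrightarrow> 0"
    then have "form_cauchy a x" using r.form_cauchy_if_limit[OF xR, of u] c by simp
    then show "u \<in> D \<and> (\<lambda>n. quad a (x n - u)) \<longlonglongrightarrow> 0"
      using a.closed_limit[OF xD x(2)] by simp
  qed
qed

lemma D_eq: "D = Domain R"
proof (intro set_eqI iffI)
  fix u assume u: "u \<in> D"
  obtain x where "\<And>n. x n \<in> Domain (S_FR S)" "x \<longlonglongrightarrow> u"
    "(\<lambda>n. quad a (x n - u)) \<longlonglongrightarrow> 0" using dom_S_FR_core_D[OF u] by blast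
  then show "u \<in> Domain R" using dom_S_FR_conv[of x u] u by blast
next
  fix u assume u: "u \<in> Domain R"
  obtain x where "\<And>n. x n \<in> Domain (S_FR S)" "x \<longlonglongrightarrow> u"
    "(\<lambda>n. quad r (x n - u)) \<longlonglongrightarrow> 0" using dom_S_FR_core_R[OF u] by blast
  then show "u \<in> D" using dom_S_FR_conv[of x u] u by blast
qed

text \<open>Together with the equality of the domains, this is the second representation theorem for the
  real part of the form.\<close>

lemma Re_a: "u \<in> D \<Longrightarrow> quad a u = (norm (Rf u))\<^sup>2"
proof -
  assume u: "u \<in> D"
  obtain x where x: "\<And>n. x n \<in> Domain (S_FR S)" "x \<longlonglongrightarrow> u"
    "(\<lambda>n. quad a (x n - u)) \<longlonglongrightarrow> 0" using dom_S_FR_core_D[OF u] by blast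
  have xD: "x n \<in> D" for n using x(1) S_FR_D by simp
  have "(\<lambda>n. quad a (x n)) \<longlonglongrightarrow> quad a u"
    using x u xD by (intro tendsto_Re a.form_tendsto) auto
  moreover have "(\<lambda>n. quad r (x n)) \<longlonglongrightarrow> quad r u"
    using x u xD dom_S_FR_conv[OF x(1,2)] D_eq by (intro tendsto_Re r.form_tendsto) auto
  moreover have "quad a (x n) = quad r (x n)" for n
    using form_eq_dom_S_FR[of "x n" 0] x(1) csubspace_0[OF csubspace_dom_S_FR] by simp
  ultimately show ?thesis using LIMSEQ_unique by (simp add: r_self)
qed

lemma Rf_D_in: "u \<in> D \<Longrightarrow> (u, Rf u) \<in> R"
  using Rf_in D_eq by simp

lemma Rf_linear: "clinear_on D Rf"
  using Rf_lin D_eq by simp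

lemmas Rf_add = clinear_on_add[OF Rf_linear]
lemmas Rf_diff = clinear_on_diff[OF Rf_linear]
lemmas Rf_scale = clinear_on_scaleC[OF Rf_linear]

lemma R_sym: "(u, h) \<in> R \<Longrightarrow> v \<in> D \<Longrightarrow> cinner h v = cinner u (Rf v)"
  using selfadjoint_sym[OF R_adj _ Rf_D_in] .

lemma Rf_tendsto:
  assumes "\<And>n. x n \<in> D" "u \<in> D"
  shows "(\<lambda>n. quad a (x n - u)) \<longlonglongrightarrow> 0 \<longleftrightarrow> (\<lambda>n. Rf (x n)) \<longlonglongrightarrow> Rf u"
proof -
  have "quad a (x n - u) = (norm (Rf (x n) - Rf u))\<^sup>2" for n
    using assms by (simp add: Re_a Rf_diff)
  then have "(\<lambda>n. quad a (x n - u)) \<longlonglongrightarrow> 0 \<longleftrightarrow> (\<lambda>n. (norm (Rf (x n) - Rf u))\<^sup>2) \<longlonglongrightarrow> 0"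
    by simp
  also have "\<dots> \<longleftrightarrow> (\<lambda>n. Rf (x n)) \<longlonglongrightarrow> Rf u"
    by (simp add: norm_sq_null_iff LIM_zero_iff)
  finally show ?thesis .
qed

lemma core_R:
  assumes "u \<in> D"
  obtains x where "\<And>n. x n \<in> Domain S" "x \<longlonglongrightarrow> u" "(\<lambda>n. Rf (x n)) \<longlonglongrightarrow> Rf u"
  using core[OF assms] Rf_tendsto[OF dom_S_D assms] by metis

lemma D_closedI:
  assumes "\<And>n. x n \<in> D" "x \<longlonglongrightarrow> u" "(\<lambda>n. Rf (x n)) \<longlonglongrightarrow> y"
  shows "u \<in> D" "Rf u = y"
proof -
  have "(u, y) \<in> R" using selfadjoint_closed[OF R_adj Rf_D_in[OF assms(1)] assms(2,3)] .
  then show "u \<in> D" "Rf u = y" using Rf_eq D_eq by auto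
qed

lemma S_F_iff: "(u, h) \<in> S_F S \<longleftrightarrow> u \<in> D \<and> (\<forall>v\<in>D. a u v = cinner h v)"
  by (simp add: S_F_def form_operator_def)

lemma csubspace_Range_S_F: "csubspace (Range (S_F S))"
  unfolding S_F_def by (rule a.csubspace_Range_form_operator)

lemma csubspace_V: "csubspace V" and closed_V: "closed V"
  unfolding ran_SF_def using csubspace_closure[OF csubspace_Range_S_F] by auto

lemmas memV [simp, intro] = csubspace_0[OF csubspace_V] csubspace_add[OF csubspace_V]
  csubspace_scaleC[OF csubspace_V] csubspace_uminus[OF csubspace_V] csubspace_diff[OF csubspace_V]

lemma V_lim: "(\<And>n. x n \<in> V) \<Longrightarrow> x \<longlonglongrightarrow> l \<Longrightarrow> l \<in> V"
  using closed_V closed_sequential_limits by blast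

text \<open>A vector orthogonal to the range of the m-sectorial operator \<open>S\<^sub>F\<close> lies in its kernel, hence is
  annihilated by the form and by the square root.\<close>

lemma Rf_V:
  assumes "u \<in> D"
  shows "Rf u \<in> V"
  unfolding ran_SF_def
proof (rule in_closure_if_orthogonal[OF csubspace_Range_S_F])
  fix w assume w: "\<And>v. v \<in> Range (S_F S) \<Longrightarrow> cinner w v = 0"
  obtain x where x: "x \<in> D" "\<And>v. v \<in> D \<Longrightarrow> a x v + cinner x v = cinner w v"
    using a.surjective_shift by blast
  then have ax: "a x v = cinner (w - x) v" if "v \<in> D" for v
    using that by (simp add: cinner_simps eq_diff_eq)
  then have "(x, w - x) \<in> S_F S" using x by (simp add: S_F_iff)
  then have "cinner w (w - x) = 0" using w by blast
  then have "Re (cinner (w - x) (w - x)) + Re (cinner x (w - x)) = 0"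
    by (simp add: cinner_simps)
  moreover have "Re (cinner x (w - x)) = quad a x"
    using ax[OF x(1)] cinner_commute[of x "w - x"] by simp
  ultimately have "(norm (w - x))\<^sup>2 \<le> 0"
    using a.Re_nonneg[OF x(1)] by (simp add: norm_sq_cinner)
  then have "w = x" by simp
  then have "w \<in> D" "quad a w = 0" using x(1) ax by auto
  then have "Rf w = 0" using Re_a by simp
  then show "cinner (Rf u) w = 0" using R_sym[OF Rf_D_in[OF assms] \<open>w \<in> D\<close>] by simp
qed

lemma kernel_R_V:
  assumes x: "x \<in> V" "(x, 0) \<in> R"
  shows "x = 0"
proof -
  have xD: "x \<in> D" "Rf x = 0" using Rf_eq[OF x(2)] x(2) D_eq by auto
  have "a u x = 0" if "u \<in> D" for u
    using a.Cauchy_Schwarz[OF that xD(1)] Re_a[OF xD(1)] xD(2) by simp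
  then have "cinner x h = 0" if "h \<in> Range (S_F S)" for h
    using that xD(1) by (subst cinner_commute) (force simp: S_F_iff)
  then have "cinner x x = 0" using x(1) orthogonal_closure unfolding ran_SF_def by blast
  then show ?thesis by (simp add: norm_cinner)
qed

lemma G_linear: "clinear_on V G" and G_V: "x \<in> V \<Longrightarrow> G x \<in> V"
  and G_sym: "x \<in> V \<Longrightarrow> y \<in> V \<Longrightarrow> cinner (G x) y = cinner x (G y)"
  and a_eq: "u \<in> D \<Longrightarrow> v \<in> D \<Longrightarrow> a u v = cinner (Rf u + \<i> *\<^sub>C G (Rf u)) (Rf v)"
  using S_GF unfolding is_GF_def by blast+

lemma G_bounded: obtains C where "C \<ge> 0" "\<And>x. x \<in> V \<Longrightarrow> norm (G x) \<le> C * norm x"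
proof -
  obtain C where C: "\<forall>x\<in>V. norm (G x) \<le> C * norm x" using S_GF unfolding is_GF_def by blast
  have "norm (G x) \<le> max C 0 * norm x" if "x \<in> V" for x
    using C that by (smt (verit, best) mult_right_mono norm_ge_zero)
  then show thesis by (intro that[of "max C 0"]) auto
qed

lemmas G_add = clinear_on_add[OF G_linear]
lemmas G_diff = clinear_on_diff[OF G_linear]
lemmas G_scale = clinear_on_scaleC[OF G_linear]
lemmas G_0 = clinear_on_0[OF G_linear]

lemma G_real: "x \<in> V \<Longrightarrow> Im (cinner (G x) x) = 0"
  using G_sym[of x x] cinner_commute[of x "G x"] by (metis complex_cnj_cancel_iff cnj.sel(2) equal_neg_zero)

lemma G_tendsto:
  assumes "\<And>n. x n \<in> V" "x \<longlonglongrightarrow> u"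
  shows "(\<lambda>n. G (x n)) \<longlonglongrightarrow> G u"
proof -
  obtain C where C: "C \<ge> 0" "\<And>x. x \<in> V \<Longrightarrow> norm (G x) \<le> C * norm x" using G_bounded by blast
  have u: "u \<in> V" using V_lim assms .
  have "(\<lambda>n. C * norm (x n - u)) \<longlonglongrightarrow> C * 0"
    using assms(2) by (intro tendsto_intros) (simp add: tendsto_norm_zero_iff LIM_zero_iff)
  then have "(\<lambda>n. G (x n) - G u) \<longlonglongrightarrow> 0"
    using C(2)[of "x n - u" for n] assms(1) u
    by (rule_tac Lim_null_comparison[of _ "\<lambda>n. C * norm (x n - u)"])
      (auto simp: G_diff[symmetric] intro!: always_eventually)
  then show ?thesis by (simp add: LIM_zero_iff)
qed

text \<open>The identity \<open>(h, v) = ((I + iG) S\<^sub>F\<^sub>R\<^sup>1\<^sup>/\<^sup>2 u, S\<^sub>F\<^sub>R\<^sup>1\<^sup>/\<^sup>2 v)\<close> for \<open>h = S\<^sub>F u\<close> says that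
  \<open>(I + iG) S\<^sub>F\<^sub>R\<^sup>1\<^sup>/\<^sup>2 u\<close> is in the domain of the adjoint of the square root.\<close>

lemma Range_S_F_R:
  assumes "(u, h) \<in> S_F S"
  shows "(Rf u + \<i> *\<^sub>C G (Rf u), h) \<in> R"
proof (rule selfadjointI[OF R_adj])
  fix v k assume v: "(v, k) \<in> R"
  then have vD: "v \<in> D" "Rf v = k" using Rf_eq D_eq by auto
  have "cinner h v = cinner (Rf u + \<i> *\<^sub>C G (Rf u)) k"
    using assms a_eq[of u v] vD by (auto simp: S_F_iff)
  then show "cinner k (Rf u + \<i> *\<^sub>C G (Rf u)) = cinner v h"
    by (metis cinner_commute)
qed

lemma Rf_core_dense:
  assumes x: "x \<in> V"
  obtains \<phi> where "\<And>n. \<phi> n \<in> Domain S" "(\<lambda>n. Rf (\<phi> n)) \<longlonglongrightarrow> x"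
proof -
  have "h \<in> closure (Rf ` Domain S)" if h: "h \<in> Range (S_F S)" for h
  proof -
    obtain v where "(v, h) \<in> R" using h Range_S_F_R by blast
    then have v: "v \<in> D" "Rf v = h" using Rf_eq D_eq by auto
    obtain y where y: "\<And>n. y n \<in> Domain S" "y \<longlonglongrightarrow> v" "(\<lambda>n. Rf (y n)) \<longlonglongrightarrow> Rf v"
    using core_R[OF v(1)] by blast
    show ?thesis
      unfolding closure_sequential using y v by (intro exI[of _ "\<lambda>n. Rf (y n)"]) auto
  qed
  then have "V \<subseteq> closure (Rf ` Domain S)"
    unfolding ran_SF_def by (intro closure_minimal) auto
  then obtain y where y: "\<And>n. y n \<in> Rf ` Domain S" "y \<longlonglongrightarrow> x"
    using x by (force simp: closure_sequential)
  have "\<exists>v\<in>Domain S. y n = Rf v" for n using y(1)[of n] by auto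
  then obtain \<phi> where "\<And>n. \<phi> n \<in> Domain S" "\<And>n. y n = Rf (\<phi> n)" by metis
  moreover from this(2) have "y = (\<lambda>n. Rf (\<phi> n))" by auto
  ultimately show thesis using y(2) by (intro that[of \<phi>]) auto
qed

text \<open>Although the form domain is not complete for the form of the square root alone, an approximate
  Riesz representation of the functional \<open>(w, -)\<close> yields a Cauchy sequence of images under the
  square root, whose limit is the preimage of \<open>w\<close>.\<close>

lemma in_Range_R:
  assumes w: "\<And>v. v \<in> Domain S \<Longrightarrow> cmod (cinner w v) \<le> C * norm (Rf v)" and C: "C \<ge> 0"
  obtains f where "f \<in> V" "(f, w) \<in> R"
proof -
  interpret h: herm_form D "form_re a" by (rule a.herm_form_re)
  have q: "quad (form_re a) u = (norm (Rf u))\<^sup>2" if "u \<in> D" for u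
    using that by (simp add: a.form_re_self Re_a)
  have wD: "cmod (cinner w v) \<le> C * norm (Rf v)" if v: "v \<in> D" for v
  proof -
    obtain x where x: "\<And>n. x n \<in> Domain S" "x \<longlonglongrightarrow> v" "(\<lambda>n. Rf (x n)) \<longlonglongrightarrow> Rf v"
    using core_R[OF v] by blast
    have "(\<lambda>n. C * norm (Rf (x n)) - cmod (cinner w (x n))) \<longlonglongrightarrow> C * norm (Rf v) - cmod (cinner w v)"
      by (intro tendsto_intros x)
    from tendsto_lowerbound[OF this, of 0] show ?thesis using w x(1) by simp
  qed
  have "bounded_antilinear D (form_re a) (cinner w)"
    unfolding bounded_antilinear_def using C wD by (auto simp: cinner_simps q)
  then obtain y where y: "\<And>n. y n \<in> D" "form_cauchy (form_re a) y"
    "\<And>v. v \<in> D \<Longrightarrow> (\<lambda>n. form_re a (y n) v) \<longlonglongrightarrow> cinner w v" using h.approximate_Riesz by blast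
  have "null2 (\<lambda>m n. (norm (Rf (y m) - Rf (y n)))\<^sup>2)"
    using y(2) unfolding p.form_cauchy_iff[OF y(1)] using y(1) by (simp add: q Rf_diff)
  from convergent_if_null2[OF this] obtain f where f: "(\<lambda>n. Rf (y n)) \<longlonglongrightarrow> f" by blast
  have re: "form_re a u v = cinner (Rf u) (Rf v)" if "u \<in> D" "v \<in> D" for u v
  proof -
    have "cinner (G (Rf v)) (Rf u) = cinner (Rf v) (G (Rf u))"
      using that Rf_V G_sym by simp
    then show ?thesis
      using that cinner_commute[of "Rf u" "Rf v"] cinner_commute[of "G (Rf u)" "Rf v"]
      by (simp add: form_re_def form_adj_def a_eq cinner_simps)
  qed
  have "(f, w) \<in> R"
  proof (rule selfadjointI[OF R_adj])
    fix v k assume "(v, k) \<in> R"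
    then have v: "v \<in> D" "Rf v = k" using Rf_eq D_eq by auto
    have "(\<lambda>n. cinner (Rf (y n)) k) \<longlonglongrightarrow> cinner f k" by (intro tendsto_intros f)
    then have "cinner f k = cinner w v"
      using y(3)[OF v(1)] re[OF y(1) v(1)] v(2) LIMSEQ_unique by simp
    then show "cinner k f = cinner v w" by (metis cinner_commute)
  qed
  moreover have "f \<in> V" using V_lim[OF _ f] Rf_V y(1) by simp
  ultimately show thesis using that by blast
qed

text \<open>Since \<open>G\<close> is symmetric, the form of \<open>I - iG\<close> has the real part \<open>\<parallel>x\<parallel>\<^sup>2\<close>, and the Lax-Milgram
  theorem applies.\<close>

lemma B_bij: "bij_betw (\<lambda>x. x - \<i> *\<^sub>C G x) V V"
proof -
  obtain C where C: "C \<ge> 0" "\<And>x. x \<in> V \<Longrightarrow> norm (G x) \<le> C * norm x" using G_bounded by blast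
  define b where "b x y = cinner (x - \<i> *\<^sub>C G x) y" for x y
  have Re_b: "quad b x = (norm x)\<^sup>2" if "x \<in> V" for x
    using G_real[OF that] by (simp add: b_def cinner_simps norm_sq_cinner)
  have "sect_form V b C"
  proof
    show "sesquilinear_on V b"
      unfolding sesquilinear_on_def b_def
      using csubspace_V by (simp add: cinner_simps G_add G_scale scaleC_add_right algebra_simps)
    fix u assume u: "u \<in> V"
    show "0 \<le> quad b u" by (simp add: Re_b u)
    have "\<bar>Im (b u u)\<bar> = \<bar>Re (cinner (G u) u)\<bar>" by (simp add: b_def cinner_simps)
    also have "\<dots> \<le> norm (G u) * norm u"
      using abs_Re_le_cmod cinner_Cauchy_Schwarz order_trans by blast
    also have "\<dots> \<le> C * norm u * norm u" using C u by (intro mult_right_mono) auto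
    finally show "\<bar>Im (b u u)\<bar> \<le> C * quad b u" by (simp add: Re_b u power2_eq_square)
  qed (rule C(1))
  then interpret b: sect_form V b C .
  have "form_complete V b"
    unfolding form_complete_def
  proof (intro allI impI)
    fix x assume *: "(\<forall>n. x n \<in> V) \<and> form_cauchy b x"
    then have x: "\<And>n. x n \<in> V" and c: "form_cauchy b x" by auto
    have "null2 (\<lambda>m n. (norm (x m - x n))\<^sup>2)"
      using c unfolding b.form_cauchy_iff[OF x] using x by (simp add: Re_b)
    from convergent_if_null2[OF this] obtain u where u: "x \<longlonglongrightarrow> u" by blast
    have uV: "u \<in> V" using V_lim[OF x u] .
    have "(\<lambda>n. (norm (x n - u))\<^sup>2) \<longlonglongrightarrow> 0"
      using u by (simp add: norm_sq_null_iff LIM_zero_iff)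
    then have "(\<lambda>n. b (x n - u) (x n - u)) \<longlonglongrightarrow> 0"
      using x uV by (simp add: b.form_null_iff Re_b)
    with uV show "\<exists>u\<in>V. (\<lambda>n. b (x n - u) (x n - u)) \<longlonglongrightarrow> 0" by blast
  qed
  have inj: "inj_on (\<lambda>x. x - \<i> *\<^sub>C G x) V"
  proof (rule inj_onI)
    fix x y assume xy: "x \<in> V" "y \<in> V" "x - \<i> *\<^sub>C G x = y - \<i> *\<^sub>C G y"
    then have "(x - y) - \<i> *\<^sub>C G (x - y) = 0"
      by (simp add: G_diff scaleC_diff_right algebra_simps)
    then have "b (x - y) (x - y) = 0" by (simp add: b_def)
    then have "(norm (x - y))\<^sup>2 = 0" using xy Re_b[of "x - y"] by auto
    then show "x = y" by simp
  qed
  have "w \<in> (\<lambda>x. x - \<i> *\<^sub>C G x) ` V" if w: "w \<in> V" for w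
  proof -
    have "bounded_antilinear V b (cinner w)"
      unfolding bounded_antilinear_def
    proof (intro conjI)
      show "\<exists>C\<ge>0. \<forall>v\<in>V. cmod (cinner w v) \<le> C * sqrt (quad b v)"
        using cinner_Cauchy_Schwarz[of w] by (intro exI[of _ "norm w"]) (simp add: Re_b)
    qed (simp_all add: cinner_simps)
    then obtain u where u: "u \<in> V" "\<And>v. v \<in> V \<Longrightarrow> b u v = cinner w v"
      using b.Lax_Milgram[OF \<open>form_complete V b\<close>] by blast
    let ?z = "u - \<i> *\<^sub>C G u - w"
    have z: "?z \<in> V" using u w G_V by simp
    have "cinner ?z ?z = 0" using u(2)[OF z] by (simp add: b_def cinner_diff_left)
    then have "u - \<i> *\<^sub>C G u = w" by (simp add: norm_cinner)
    with u show ?thesis by blast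
  qed
  then show ?thesis using inj G_V by (auto simp: bij_betw_def)
qed

end

section \<open>The bounded inverse theorem\<close>

text \<open>By Baire's theorem one of the closed sets on which the functionals are bounded by a fixed
  integer contains a ball.\<close>

lemma uniform_boundedness:
  fixes P :: "'h::chilbert_space set"
  assumes "\<And>e. \<exists>B. \<forall>h\<in>P. cmod (cinner e h) \<le> B"
  obtains C where "C \<ge> 0" "\<And>h. h \<in> P \<Longrightarrow> norm h \<le> C"
proof -
  define A where "A k = {e. \<forall>h\<in>P. cmod (cinner e h) \<le> real k}" for k :: nat
  have closed_A: "closed (A k)" for k
  proof -
    have "closed {e. cmod (cinner e h) \<le> real k}" for h :: 'h
      by (intro closed_Collect_le continuous_on_norm continuous_on_const
          bounded_bilinear.continuous_on[OF bounded_bilinear_cinner] continuous_on_id)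
    moreover have "A k = (\<Inter>h\<in>P. {e. cmod (cinner e h) \<le> real k})" by (auto simp: A_def)
    ultimately show ?thesis by auto
  qed
  have "\<exists>k. interior (A k) \<noteq> {}"
  proof (rule ccontr)
    assume "\<not> (\<exists>k. interior (A k) \<noteq> {})"
    then have "euclidean interior_of (\<Union>(range A)) = {}"
      using closed_A by (intro Baire_category_alt) (auto simp: completely_metrizable_space_euclidean)
    then have "interior (\<Union>(range A)) = {}" by simp
    moreover have "e \<in> \<Union>(range A)" for e
    proof -
      obtain B where B: "\<forall>h\<in>P. cmod (cinner e h) \<le> B" using assms by blast
      obtain k where "B \<le> real k" using real_arch_simple by blast
      then have "e \<in> A k" using B by (force simp: A_def)
      then show ?thesis by blast
    qed
    then have "\<Union>(range A) = UNIV" by blast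
    ultimately show False by simp
  qed
  then obtain k x r where r: "r > 0" "ball x r \<subseteq> A k" by (meson ex_in_conv mem_interior)
  have "norm h \<le> 4 * real k / r" if h: "h \<in> P" for h
  proof (cases "h = 0")
    case True
    then show ?thesis using r by simp
  next
    case False
    \<comment> \<open>\<open>e\<close> has norm \<open>r / 2\<close>, so that \<open>x + e\<close> stays in the ball\<close>
    define c where "c = complex_of_real (r / (2 * norm h))"
    define e where "e = c *\<^sub>C h"
    have c: "cmod c = r / (2 * norm h)" using r by (simp add: c_def norm_divide)
    have "norm e < r" using r False by (simp add: e_def c)
    then have "x \<in> A k" "x + e \<in> A k" using r by (auto simp: subset_iff dist_norm)
    then have *: "cmod (cinner x h) \<le> real k" "cmod (cinner (x + e) h) \<le> real k"
      using h by (auto simp: A_def)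
    have "cinner e h = cinner (x + e) h - cinner x h" by (simp add: cinner_simps)
    then have "cmod (cinner e h) \<le> 2 * real k"
      using * norm_triangle_ineq4[of "cinner (x + e) h" "cinner x h"] by simp
    moreover have "cmod (cinner e h) = r / 2 * norm h"
      using False r by (simp add: e_def cinner_simps norm_mult c norm_cinner power2_eq_square)
    ultimately show ?thesis using r by (simp add: field_simps)
  qed
  then show thesis using r by (intro that[of "4 * real k / r"]) auto
qed

lemma Riesz_closed_subspace:
  assumes V: "csubspace V" "closed (V :: 'a::chilbert_space set)"
    and "bounded_antilinear V cinner \<phi>"
  obtains u where "u \<in> V" "\<And>v. v \<in> V \<Longrightarrow> cinner u v = \<phi> v"
proof -
  interpret closed_sect_form V "\<lambda>u v. 0" 0 by (rule closed_subspace_form[OF V])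
  show thesis
    using sect_form.Lax_Milgram[OF sect_form_shift form_complete_shift, of \<phi>] assms(3) that by auto
qed

text \<open>The adjoint of a bounded bijection is bounded below by the uniform boundedness principle,
  and its range is dense, so duality bounds the inverse.\<close>

lemma bounded_inverse:
  fixes A :: "'a::chilbert_space \<Rightarrow> 'h::chilbert_space"
  assumes A: "clinear_on N A" and N: "closed N" and M: "\<And>w. w \<in> N \<Longrightarrow> norm (A w) \<le> M * norm w"
    and surj: "A ` N = UNIV" and inj: "\<And>w. w \<in> N \<Longrightarrow> A w = 0 \<Longrightarrow> w = 0"
  obtains C where "C \<ge> 0" "\<And>w. w \<in> N \<Longrightarrow> norm w \<le> C * norm (A w)"
proof -
  have subN: "csubspace N" by (rule clinear_on_csubspace[OF A])
  \<comment> \<open>the vectors that the adjoint maps into the unit ball\<close>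
  define P where "P = {h. \<forall>w\<in>N. cmod (cinner (A w) h) \<le> norm w}"
  have "\<exists>B. \<forall>h\<in>P. cmod (cinner e h) \<le> B" for e
  proof -
    obtain w where "w \<in> N" "A w = e" using surj by (metis UNIV_I imageE)
    then show ?thesis by (intro exI[of _ "norm w"]) (auto simp: P_def)
  qed
  then obtain C where C: "C \<ge> 0" "\<And>h. h \<in> P \<Longrightarrow> norm h \<le> C"
    using uniform_boundedness[of P] by blast
  have below: "norm h \<le> C * s" if s: "s \<ge> 0" and h: "\<And>w. w \<in> N \<Longrightarrow> cmod (cinner (A w) h) \<le> s * norm w" for h s
  proof -
    have pos: "norm h \<le> C * r" if r: "r > s" for r
    proof -
      have r0: "r > 0" using r s by simp
      have "complex_of_real (1 / r) *\<^sub>C h \<in> P"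
        unfolding P_def
      proof (intro CollectI ballI)
        fix w assume w: "w \<in> N"
        have "cmod (cinner (A w) h) \<le> r * norm w"
          using h[OF w] r mult_right_mono[of s r "norm w"] by simp
        then show "cmod (cinner (A w) (complex_of_real (1 / r) *\<^sub>C h)) \<le> norm w"
          using r0 by (simp add: cinner_simps norm_mult norm_divide field_simps)
      qed
      then have "norm (complex_of_real (1 / r) *\<^sub>C h) \<le> C" by (rule C(2))
      then show ?thesis using r0 by (simp add: norm_divide field_simps)
    qed
    have "(\<lambda>n. C * (s + inverse (real (Suc n)))) \<longlonglongrightarrow> C * (s + 0)"
      by (intro tendsto_intros LIMSEQ_inverse_real_of_nat)
    from tendsto_lowerbound[OF this] pos show ?thesis by simp
  qed
  \<comment> \<open>the range of the adjoint\<close>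
  define Q where "Q = {y \<in> N. \<exists>h. \<forall>w\<in>N. cinner (A w) h = cinner w y}"
  have subQ: "csubspace Q"
    unfolding csubspace_def
  proof (intro conjI ballI allI)
    show "0 \<in> Q" using csubspace_0[OF subN] by (auto simp: Q_def intro!: exI[of _ 0])
    fix x assume "x \<in> Q"
    then obtain h where x: "x \<in> N" "\<forall>w\<in>N. cinner (A w) h = cinner w x" by (auto simp: Q_def)
    show "c *\<^sub>C x \<in> Q" for c
      using x csubspace_scaleC[OF subN] by (auto simp: Q_def cinner_simps intro!: exI[of _ "c *\<^sub>C h"])
    fix y assume "y \<in> Q"
    then obtain k where y: "y \<in> N" "\<forall>w\<in>N. cinner (A w) k = cinner w y" by (auto simp: Q_def)
    show "x + y \<in> Q"
      using x y csubspace_add[OF subN] by (auto simp: Q_def cinner_simps intro!: exI[of _ "h + k"])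
  qed
  have adj: "\<exists>y\<in>Q. \<forall>w\<in>N. cinner (A w) h = cinner w y" for h
  proof -
    have "bounded_antilinear N cinner (\<lambda>v. cinner h (A v))"
      unfolding bounded_antilinear_def
    proof (intro conjI)
      have "cmod (cinner h (A v)) \<le> (norm h * max M 0) * sqrt (Re (cinner v v))" if v: "v \<in> N" for v
      proof -
        have "norm (A v) \<le> max M 0 * norm v"
          using M[OF v] mult_right_mono[of M "max M 0" "norm v"] by simp
        then have "norm h * norm (A v) \<le> norm h * (max M 0 * norm v)"
          by (intro mult_left_mono) auto
        then show ?thesis
          using cinner_Cauchy_Schwarz[of h "A v"] by (simp add: norm_cinner algebra_simps)
      qed
      then show "\<exists>C\<ge>0. \<forall>v\<in>N. cmod (cinner h (A v)) \<le> C * sqrt (Re (cinner v v))"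
        by (intro exI[of _ "norm h * max M 0"]) auto
    qed (auto simp: clinear_on_add[OF A] clinear_on_scaleC[OF A] cinner_simps)
    then obtain y where y: "y \<in> N" "\<And>v. v \<in> N \<Longrightarrow> cinner y v = cinner h (A v)"
      using Riesz_closed_subspace[OF subN N] by metis
    then have "\<forall>w\<in>N. cinner (A w) h = cinner w y" by (metis cinner_commute)
    with y show ?thesis by (auto simp: Q_def)
  qed
  have dense: "w \<in> closure Q" if w: "w \<in> N" for w
  proof (rule in_closure_if_orthogonal[OF subQ])
    fix x assume x: "\<And>v. v \<in> Q \<Longrightarrow> cinner x v = 0"
    obtain m where m: "m \<in> N" "\<And>v. v \<in> N \<Longrightarrow> cinner (x - m) v = 0"
      using orthogonal_projection[OF subN N] by metis
    obtain y where y: "y \<in> Q" "\<forall>w\<in>N. cinner (A w) (A m) = cinner w y" using adj by blast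
    have yN: "y \<in> N" using y by (simp add: Q_def)
    have "cinner (A m) (A m) = cinner m y" using y(2) m(1) by blast
    also have "\<dots> = cinner x y - cinner (x - m) y" by (simp add: cinner_simps)
    also have "\<dots> = 0" using x[OF y(1)] m(2)[OF yN] by simp
    finally have "m = 0" using inj[OF m(1)] by (simp add: norm_cinner)
    then have "cinner x w = 0" using m(2)[OF w] by simp
    then show "cinner w x = 0" using cinner_commute[of w x] by simp
  qed
  have "norm w \<le> C * norm (A w)" if w: "w \<in> N" for w
  proof -
    obtain y where y: "\<And>n. y n \<in> Q" "y \<longlonglongrightarrow> w"
      using dense[OF w] by (auto simp: closure_sequential)
    have *: "cmod (cinner w (y n)) \<le> norm (A w) * (C * norm (y n))" for n
    proof -
      obtain h where h: "\<forall>w\<in>N. cinner (A w) h = cinner w (y n)" using y(1)[of n] by (auto simp: Q_def)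
      have "norm h \<le> C * norm (y n)"
        using h cinner_Cauchy_Schwarz[of _ "y n"] by (intro below) (auto simp: mult.commute)
      then have "norm (A w) * norm h \<le> norm (A w) * (C * norm (y n))"
        by (intro mult_left_mono) auto
      moreover have "cinner w (y n) = cinner (A w) h" using h w by simp
      ultimately show ?thesis using cinner_Cauchy_Schwarz[of "A w" h] by simp
    qed
    have "(\<lambda>n. norm (A w) * (C * norm (y n)) - cmod (cinner w (y n)))
        \<longlonglongrightarrow> norm (A w) * (C * norm w) - cmod (cinner w w)"
      by (intro tendsto_intros y)
    from tendsto_lowerbound[OF this, of 0] have "cmod (cinner w w) \<le> norm (A w) * (C * norm w)"
      using * by simp
    then have "norm w * norm w \<le> C * norm (A w) * norm w"
      by (simp add: norm_cinner norm_power power2_eq_square norm_mult algebra_simps)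
    then show ?thesis using C(1) by (cases "w = 0") auto
  qed
  then show thesis using C(1) that by blast
qed

section \<open>Boundary pairs\<close>

context friedrichs
begin

lemma defect_iff: "w \<in> defect_space S z \<longleftrightarrow> (\<forall>\<phi>\<in>Domain S. cinner (op_app S \<phi>) w = cnj z * cinner \<phi> w)"
proof -
  have "w \<in> defect_space S z \<longleftrightarrow> (\<forall>(\<phi>, h)\<in>S. cinner h w = cnj z * cinner \<phi> w)"
    by (simp add: defect_space_def adjoint_op_def cinner_simps)
  also have "\<dots> \<longleftrightarrow> (\<forall>\<phi>\<in>Domain S. cinner (op_app S \<phi>) w = cnj z * cinner \<phi> w)"
    using op_app_in[OF S_linear] op_app_eq[OF S_linear] by fastforce
  finally show ?thesis .
qed

lemma csubspace_defect: "csubspace (defect_space S z)"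
  unfolding csubspace_def by (auto simp: defect_iff cinner_simps algebra_simps)

lemma closed_defect: "closed (defect_space S z)"
proof (unfold closed_sequential_limits, safe)
  fix x l assume x: "\<forall>n. x n \<in> defect_space S z" "x \<longlonglongrightarrow> l"
  show "l \<in> defect_space S z"
    unfolding defect_iff
  proof
    fix \<phi> assume \<phi>: "\<phi> \<in> Domain S"
    have "(\<lambda>n. cinner (op_app S \<phi>) (x n)) \<longlonglongrightarrow> cinner (op_app S \<phi>) l"
      "(\<lambda>n. cnj z * cinner \<phi> (x n)) \<longlonglongrightarrow> cnj z * cinner \<phi> l"
      by (intro tendsto_intros x(2))+
    then show "cinner (op_app S \<phi>) l = cnj z * cinner \<phi> l"
      using x(1) \<phi> LIMSEQ_unique by (simp add: defect_iff)
  qed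
qed

text \<open>The points \<open>i\<close> and \<open>-1\<close> lie outside the sector, which makes the shifted form coercive.\<close>

lemma coercive_shift:
  assumes c: "c \<in> D" and z: "z = \<i> \<or> z = -1"
  shows "(norm (Rf c))\<^sup>2 + (norm c)\<^sup>2 \<le> (2 + K) * cmod (a c c - cnj z * cinner c c)"
proof -
  have K: "K \<ge> 0" by (rule a.K_nonneg)
  have Re: "quad a c = (norm (Rf c))\<^sup>2" by (rule Re_a[OF c])
  have cc: "cinner c c = complex_of_real ((norm c)\<^sup>2)" by (rule norm_cinner)
  define m where "m = cmod (a c c - cnj z * cinner c c)"
  have m: "m \<ge> 0" by (simp add: m_def)
  from z show ?thesis
  proof
    assume z: "z = \<i>"
    have 1: "(norm (Rf c))\<^sup>2 \<le> m"
      using complex_Re_le_cmod[of "a c c - cnj z * cinner c c"] Re by (simp add: z cc m_def)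
    have "\<bar>Im (a c c) + (norm c)\<^sup>2\<bar> \<le> m"
      using abs_Im_le_cmod[of "a c c - cnj z * cinner c c"] by (simp add: z cc m_def)
    then have "(norm c)\<^sup>2 \<le> m + K * (norm (Rf c))\<^sup>2" using a.Im_le[OF c] Re by simp
    moreover have "K * (norm (Rf c))\<^sup>2 \<le> K * m" using K 1 by (intro mult_left_mono)
    ultimately show ?thesis using 1 unfolding m_def[symmetric] by (simp add: algebra_simps)
  next
    assume z: "z = -1"
    have "(norm (Rf c))\<^sup>2 + (norm c)\<^sup>2 \<le> m"
      using complex_Re_le_cmod[of "a c c - cnj z * cinner c c"] Re by (simp add: z cc m_def)
    also have "\<dots> \<le> (2 + K) * m" using K m mult_right_mono[of 1 "2 + K" m] by simp
    finally show ?thesis by (simp add: m_def)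
  qed
qed

text \<open>The identity extends from \<open>dom S\<close> to \<open>D[S]\<close> by density, and \<open>\<phi> = c\<close> makes the left-hand side
  the coercive quantity. This one estimate serves for the uniqueness of the decompositions, for the
  comparison of the points \<open>i\<close> and \<open>-1\<close>, and for recovering \<open>u\<^sub>F\<close> from \<open>u\<close> and \<open>\<xi>\<^sub>u\<close>.\<close>

lemma shift_estimate:
  assumes c: "c \<in> D" and z: "z = \<i> \<or> z = -1"
    and eq: "\<And>\<phi>. \<phi> \<in> Domain S \<Longrightarrow> a \<phi> c - cnj z * cinner \<phi> c = cinner (Rf \<phi>) x + cinner \<phi> y"
  shows "norm (Rf c) \<le> (2 + K) * (norm x + norm y)" "norm c \<le> (2 + K) * (norm x + norm y)"
proof -
  obtain \<phi> where \<phi>: "\<And>n. \<phi> n \<in> Domain S" "\<phi> \<longlonglongrightarrow> c" "(\<lambda>n. Rf (\<phi> n)) \<longlonglongrightarrow> Rf c"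
    using core_R[OF c] by blast
  have "(\<lambda>n. a (\<phi> n) c) \<longlonglongrightarrow> a c c"
  proof (rule a.form_tendsto)
    show "(\<lambda>n. quad a (\<phi> n - c)) \<longlonglongrightarrow> 0" using Rf_tendsto[OF dom_S_D[OF \<phi>(1)] c] \<phi>(3) by simp
  qed (use c dom_S_D \<phi>(1) in \<open>auto simp: a.expand\<close>)
  then have "(\<lambda>n. a (\<phi> n) c - cnj z * cinner (\<phi> n) c) \<longlonglongrightarrow> a c c - cnj z * cinner c c"
    by (intro tendsto_intros \<phi>)
  moreover have "(\<lambda>n. cinner (Rf (\<phi> n)) x + cinner (\<phi> n) y) \<longlonglongrightarrow> cinner (Rf c) x + cinner c y"
    by (intro tendsto_intros \<phi>)
  ultimately have "a c c - cnj z * cinner c c = cinner (Rf c) x + cinner c y"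
    using eq[OF \<phi>(1)] LIMSEQ_unique by simp
  then have le: "(norm (Rf c))\<^sup>2 + (norm c)\<^sup>2 \<le> (2 + K) * cmod (cinner (Rf c) x + cinner c y)"
    using coercive_shift[OF c z] by simp
  define s where "s = sqrt ((norm (Rf c))\<^sup>2 + (norm c)\<^sup>2)"
  have s2: "s\<^sup>2 = (norm (Rf c))\<^sup>2 + (norm c)\<^sup>2" by (simp add: s_def)
  have Rs: "norm (Rf c) \<le> s" and cs: "norm c \<le> s"
    unfolding s_def by (auto intro: real_le_rsqrt)
  have "cmod (cinner (Rf c) x + cinner c y) \<le> norm (Rf c) * norm x + norm c * norm y"
    by (intro norm_triangle_le add_mono cinner_Cauchy_Schwarz)
  also have "\<dots> \<le> s * norm x + s * norm y"
    using Rs cs by (intro add_mono mult_right_mono) auto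
  finally have "s * s \<le> (2 + K) * (s * norm x + s * norm y)"
    using order_trans[OF le mult_left_mono] a.K_nonneg
    unfolding power2_eq_square[symmetric] s2 by simp
  then have "s * s \<le> ((2 + K) * (norm x + norm y)) * s" by (simp add: algebra_simps)
  moreover have "0 \<le> (2 + K) * (norm x + norm y)" using a.K_nonneg by simp
  moreover have "s \<ge> 0" by (simp add: s_def)
  ultimately have "s \<le> (2 + K) * (norm x + norm y)"
    by (metis mult_le_cancel_right order_le_less)
  then show "norm (Rf c) \<le> (2 + K) * (norm x + norm y)" "norm c \<le> (2 + K) * (norm x + norm y)"
    using Rs cs by auto
qed

lemma D_defect:
  assumes "c \<in> D" "z = \<i> \<or> z = -1" "c \<in> defect_space S z"
  shows "c = 0"
proof -
  have "a \<phi> c - cnj z * cinner \<phi> c = cinner (Rf \<phi>) 0 + cinner \<phi> 0" if "\<phi> \<in> Domain S" for \<phi>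
    using assms that by (simp add: a_dom_S_left defect_iff)
  from shift_estimate(2)[OF assms(1,2) this] show ?thesis by simp
qed

lemma proj_eq:
  assumes z: "z = \<i> \<or> z = -1" and d: "d \<in> D" and w: "w \<in> defect_space S z"
  shows "projF S z (d + w) = d" "projN S z (d + w) = w"
proof -
  have uniq: "d' = d" if "d' \<in> D" "d + w - d' \<in> defect_space S z" for d'
  proof -
    have "d + w - d' - w \<in> defect_space S z"
      using csubspace_diff[OF csubspace_defect that(2) w] .
    then have "d - d' \<in> defect_space S z" by (simp add: algebra_simps)
    moreover have "d - d' \<in> D" using d that(1) by simp
    ultimately show ?thesis using D_defect[OF _ z] by fastforce
  qed
  show "projF S z (d + w) = d"
    unfolding projF_def by (rule the_equality) (use d w uniq in auto)
  show "projN S z (d + w) = w"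
    unfolding projN_def
  proof (rule the_equality)
    fix w' assume w': "w' \<in> defect_space S z \<and> d + w - w' \<in> D"
    then have "d + w - (d + w - w') \<in> defect_space S z" by simp
    then have "d + w - w' = d" using uniq w' by blast
    then show "w' = w" by simp
  qed (use d w in auto)
qed

abbreviation Ni where "Ni \<equiv> defect_space S \<i>"

text \<open>The component \<open>c\<close> in \<open>D[S]\<close> solves an equation for the adjoint form shifted by the inner
  product.\<close>

lemma Ni_shift:
  assumes w: "w \<in> Ni"
  obtains c where "c \<in> D" "w - c \<in> defect_space S (-1)"
    "norm (Rf c) \<le> (2 + K) * (2 * norm w)" "norm c \<le> (2 + K) * (2 * norm w)"
proof -
  interpret adj: closed_sect_form D "form_adj a" K
    by (rule closed_sect_form_adj[OF a.closed_sect_form_axioms])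
  obtain c where c: "c \<in> D" "\<And>v. v \<in> D \<Longrightarrow> form_adj a c v + cinner c v = cinner ((1 + \<i>) *\<^sub>C w) v"
    using adj.surjective_shift by blast
  have eq: "a \<phi> c + cinner \<phi> c = (1 - \<i>) * cinner \<phi> w" if "\<phi> \<in> Domain S" for \<phi>
  proof -
    have "cnj (form_adj a c \<phi> + cinner c \<phi>) = cnj (cinner ((1 + \<i>) *\<^sub>C w) \<phi>)"
      using c(2)[OF dom_S_D[OF that]] by simp
    then show ?thesis
      using cinner_commute[of c \<phi>] cinner_commute[of w \<phi>] by (simp add: form_adj_def cinner_simps)
  qed
  have "w - c \<in> defect_space S (-1)"
    unfolding defect_iff
  proof
    fix \<phi> assume \<phi>: "\<phi> \<in> Domain S"
    have "cinner (op_app S \<phi>) w = - \<i> * cinner \<phi> w" using w \<phi> by (simp add: defect_iff)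
    moreover have "cinner (op_app S \<phi>) c = a \<phi> c" using a_dom_S_left[OF \<phi> c(1)] by simp
    ultimately show "cinner (op_app S \<phi>) (w - c) = cnj (-1) * cinner \<phi> (w - c)"
      using eq[OF \<phi>] by (simp add: cinner_simps algebra_simps)
  qed
  moreover have "a \<phi> c - cnj (-1) * cinner \<phi> c = cinner (Rf \<phi>) 0 + cinner \<phi> ((1 + \<i>) *\<^sub>C w)"
    if "\<phi> \<in> Domain S" for \<phi>
    using eq[OF that] by (simp add: cinner_simps)
  note est = shift_estimate[OF c(1) _ this]
  have "cmod (1 + \<i>) \<le> 2" using norm_triangle_ineq[of 1 \<i>] by simp
  then have "norm ((1 + \<i>) *\<^sub>C w) \<le> 2 * norm w" by (simp add: mult_right_mono)
  then have "(2 + K) * (norm (0::'a) + norm ((1 + \<i>) *\<^sub>C w)) \<le> (2 + K) * (2 * norm w)"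
    using a.K_nonneg by (intro mult_left_mono) auto
  then have "norm (Rf c) \<le> (2 + K) * (2 * norm w)" "norm c \<le> (2 + K) * (2 * norm w)"
    using est by force+
  ultimately show thesis using c(1) that by blast
qed

text \<open>On the defect space the norm of \<open>\<LL>\<close>, which refers to the point \<open>-1\<close>, is controlled by the norm
  of the Hilbert space. Hence the boundary map is bounded there in the ordinary norm.\<close>

lemma LL_norm_Ni:
  obtains C where "C \<ge> 0" "\<And>w. w \<in> Ni \<Longrightarrow> LL_norm S R w \<le> C * norm w"
proof -
  let ?C = "4 * (2 + K) + 2"
  have "LL_norm S R w \<le> ?C * norm w" if w: "w \<in> Ni" for w
  proof -
    obtain c where c: "c \<in> D" "w - c \<in> defect_space S (-1)"
      "norm (Rf c) \<le> (2 + K) * (2 * norm w)" "norm c \<le> (2 + K) * (2 * norm w)"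
      using Ni_shift[OF w] by blast
    have "projF S (-1) w = c" "projN S (-1) w = w - c"
      using proj_eq[of "-1" c "w - c"] c by auto
    then have "LL_norm S R w = sqrt ((norm (Rf c))\<^sup>2 + (norm (w - c))\<^sup>2 + (norm w)\<^sup>2)"
      by (simp add: LL_norm_def LL_inner_def norm_sq_cinner)
    also have "\<dots> \<le> norm (Rf c) + norm (w - c) + norm w"
      by (intro order_trans[OF sqrt_add_le_add_sqrt] add_mono) auto
    also have "\<dots> \<le> norm (Rf c) + norm c + 2 * norm w"
      using norm_triangle_ineq4[of w c] by simp
    also have "\<dots> \<le> ?C * norm w" using c(3,4) by (simp add: algebra_simps)
    finally show ?thesis .
  qed
  then show thesis using a.K_nonneg by (intro that[of ?C]) auto
qed

end

locale boundary = friedrichs S R G K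
  for S R :: "('a::chilbert_space \<times> 'a) set" and G K +
  fixes \<Gamma> :: "'a \<Rightarrow> 'h::chilbert_space"
  assumes bp: "boundary_pair S R \<Gamma>"
begin

abbreviation L where "L \<equiv> LL S"
abbreviation PF where "PF \<equiv> projF S \<i>"
abbreviation g where "g \<equiv> gamma_field S \<Gamma> \<i>"

lemma \<Gamma>_linear: "clinear_on L \<Gamma>"
  and \<Gamma>_0_iff: "u \<in> L \<Longrightarrow> \<Gamma> u = 0 \<longleftrightarrow> u \<in> D"
  and \<Gamma>_surj: "\<Gamma> ` L = UNIV"
  using bp unfolding boundary_pair_def by blast+

lemma csubspace_L: "csubspace L" by (rule clinear_on_csubspace[OF \<Gamma>_linear])

lemma L_I: "d \<in> D \<Longrightarrow> w \<in> Ni \<Longrightarrow> d + w \<in> L"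
  unfolding LL_def by blast

lemma D_L: "d \<in> D \<Longrightarrow> d \<in> L"
  using L_I[of d 0] csubspace_0[OF csubspace_defect] by simp

lemma Ni_L: "w \<in> Ni \<Longrightarrow> w \<in> L"
  using L_I[of 0 w] by simp

lemma \<Gamma>_D: "d \<in> D \<Longrightarrow> \<Gamma> d = 0"
  using \<Gamma>_0_iff D_L by blast

lemma \<Gamma>_add: "d \<in> D \<Longrightarrow> w \<in> Ni \<Longrightarrow> \<Gamma> (d + w) = \<Gamma> w"
  using clinear_on_add[OF \<Gamma>_linear D_L Ni_L] \<Gamma>_D by simp

lemma \<Gamma>_Ni_linear: "clinear_on Ni \<Gamma>"
  using \<Gamma>_linear csubspace_defect Ni_L unfolding clinear_on_def by blast

lemma \<Gamma>_Ni_0: "w \<in> Ni \<Longrightarrow> \<Gamma> w = 0 \<Longrightarrow> w = 0"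
  using \<Gamma>_0_iff Ni_L D_defect by blast

lemma \<Gamma>_Ni_inj: "inj_on \<Gamma> Ni"
proof (rule inj_onI)
  fix x y assume xy: "x \<in> Ni" "y \<in> Ni" "\<Gamma> x = \<Gamma> y"
  then have "\<Gamma> (x - y) = 0" by (simp add: clinear_on_diff[OF \<Gamma>_Ni_linear])
  then have "x - y = 0" using csubspace_diff[OF csubspace_defect xy(1,2)] by (intro \<Gamma>_Ni_0)
  then show "x = y" by simp
qed

lemma \<Gamma>_Ni_surj: "\<Gamma> ` Ni = UNIV"
proof -
  have "\<Gamma> u \<in> \<Gamma> ` Ni" if "u \<in> L" for u
    using that \<Gamma>_add unfolding LL_def by auto
  then show ?thesis using \<Gamma>_surj by (metis UNIV_eq_I UNIV_I imageE)
qed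

lemma g_Ni: "g e \<in> Ni" and \<Gamma>_g: "\<Gamma> (g e) = e"
  unfolding gamma_field_def
  using the_inv_into_into[OF \<Gamma>_Ni_inj, of e Ni] f_the_inv_into_f[OF \<Gamma>_Ni_inj, of e] \<Gamma>_Ni_surj by auto

lemma g_\<Gamma>: "w \<in> Ni \<Longrightarrow> g (\<Gamma> w) = w"
  unfolding gamma_field_def by (rule the_inv_into_f_f[OF \<Gamma>_Ni_inj])

lemma g_add: "g (e + e') = g e + g e'"
  using g_\<Gamma>[OF csubspace_add[OF csubspace_defect g_Ni g_Ni], of e e']
  by (simp add: clinear_on_add[OF \<Gamma>_Ni_linear g_Ni g_Ni] \<Gamma>_g)

lemma g_scale: "g (c *\<^sub>C e) = c *\<^sub>C g e"
  using g_\<Gamma>[OF csubspace_scaleC[OF csubspace_defect g_Ni], of c e]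
  by (simp add: clinear_on_scaleC[OF \<Gamma>_Ni_linear g_Ni] \<Gamma>_g)

lemma g_diff: "g (e - e') = g e - g e'"
  using g_add[of e "(-1) *\<^sub>C e'"] by (simp only: g_scale) simp

lemma \<Gamma>_Ni_bounded: obtains C where "C \<ge> 0" "\<And>w. w \<in> Ni \<Longrightarrow> norm (\<Gamma> w) \<le> C * norm w"
proof -
  obtain A where A: "\<And>u. u \<in> L \<Longrightarrow> norm (\<Gamma> u) \<le> A * LL_norm S R u"
    using bp unfolding boundary_pair_def by blast
  obtain B where B: "B \<ge> 0" "\<And>w. w \<in> Ni \<Longrightarrow> LL_norm S R w \<le> B * norm w"
    using LL_norm_Ni by blast
  have "norm (\<Gamma> w) \<le> (max A 0 * B) * norm w" if w: "w \<in> Ni" for w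
  proof -
    have "LL_norm S R w \<ge> 0" by (simp add: LL_norm_def LL_inner_def norm_cinner)
    then have "norm (\<Gamma> w) \<le> max A 0 * LL_norm S R w"
      using A[OF Ni_L[OF w]] mult_right_mono[of A "max A 0"] by fastforce
    also have "\<dots> \<le> max A 0 * (B * norm w)" using B(2)[OF w] by (intro mult_left_mono) auto
    finally show ?thesis by simp
  qed
  then show thesis using B(1) by (intro that[of "max A 0 * B"]) auto
qed

text \<open>Closedness of the defect space makes the bounded inverse theorem applicable to the restricted
  boundary map.\<close>

lemma g_bounded: obtains C where "C \<ge> 0" "\<And>e. norm (g e) \<le> C * norm e"
proof -
  obtain M where "M \<ge> 0" "\<And>w. w \<in> Ni \<Longrightarrow> norm (\<Gamma> w) \<le> M * norm w" using \<Gamma>_Ni_bounded by blast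
  then obtain C where C: "C \<ge> 0" "\<And>w. w \<in> Ni \<Longrightarrow> norm w \<le> C * norm (\<Gamma> w)"
    using bounded_inverse[OF \<Gamma>_Ni_linear closed_defect _ \<Gamma>_Ni_surj \<Gamma>_Ni_0] by blast
  show thesis using C(1) C(2)[OF g_Ni] by (intro that[of C]) (simp_all add: \<Gamma>_g)
qed

lemma g_tendsto: "e \<longlonglongrightarrow> l \<Longrightarrow> (\<lambda>n. g (e n)) \<longlonglongrightarrow> g l"
proof -
  assume e: "e \<longlonglongrightarrow> l"
  obtain C where C: "C \<ge> 0" "\<And>e. norm (g e) \<le> C * norm e" using g_bounded by blast
  have "(\<lambda>n. C * norm (e n - l)) \<longlonglongrightarrow> C * 0"
    using e by (intro tendsto_intros) (simp add: tendsto_norm_zero_iff LIM_zero_iff)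
  then have "(\<lambda>n. g (e n) - g l) \<longlonglongrightarrow> 0"
    using C(2) by (rule_tac Lim_null_comparison[of _ "\<lambda>n. C * norm (e n - l)"])
      (auto simp: g_diff[symmetric] intro!: always_eventually)
  then show ?thesis by (simp add: LIM_zero_iff)
qed

lemma L_decomp:
  assumes "u \<in> L"
  shows PF_D: "PF u \<in> D" and L_split: "u = PF u + g (\<Gamma> u)" and PN_eq: "projN S \<i> u = g (\<Gamma> u)"
proof -
  obtain d w where dw: "u = d + w" "d \<in> D" "w \<in> Ni" using assms unfolding LL_def by blast
  then have "PF u = d" "projN S \<i> u = w" "g (\<Gamma> u) = w"
    using proj_eq[of \<i> d w] \<Gamma>_add g_\<Gamma> by auto
  then show "PF u \<in> D" "u = PF u + g (\<Gamma> u)" "projN S \<i> u = g (\<Gamma> u)" using dw by auto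
qed

lemma L_glue: "d \<in> D \<Longrightarrow> d + g e \<in> L" "d \<in> D \<Longrightarrow> PF (d + g e) = d" "d \<in> D \<Longrightarrow> \<Gamma> (d + g e) = e"
  using L_I g_Ni proj_eq[of \<i> d "g e"] \<Gamma>_add \<Gamma>_g by auto

lemma \<Gamma>_lin: "u \<in> L \<Longrightarrow> v \<in> L \<Longrightarrow> \<Gamma> (u + v) = \<Gamma> u + \<Gamma> v" "u \<in> L \<Longrightarrow> \<Gamma> (c *\<^sub>C u) = c *\<^sub>C \<Gamma> u"
  "u \<in> L \<Longrightarrow> v \<in> L \<Longrightarrow> \<Gamma> (u - v) = \<Gamma> u - \<Gamma> v"
  using clinear_on_add[OF \<Gamma>_linear] clinear_on_scaleC[OF \<Gamma>_linear] clinear_on_diff[OF \<Gamma>_linear] by auto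

lemma PF_lin:
  shows PF_add: "u \<in> L \<Longrightarrow> v \<in> L \<Longrightarrow> PF (u + v) = PF u + PF v"
    and PF_scale: "u \<in> L \<Longrightarrow> PF (c *\<^sub>C u) = c *\<^sub>C PF u"
proof -
  assume u: "u \<in> L"
  have "c *\<^sub>C u = c *\<^sub>C PF u + g (c *\<^sub>C \<Gamma> u)"
    using L_split[OF u] by (metis g_scale scaleC_add_right)
  then show "PF (c *\<^sub>C u) = c *\<^sub>C PF u" using L_glue(2) PF_D[OF u] a.mem(3) by metis
  assume v: "v \<in> L"
  have "u + v = (PF u + PF v) + g (\<Gamma> u + \<Gamma> v)"
    using L_split[OF u] L_split[OF v] unfolding g_add by (metis add.assoc add.left_commute)
  then show "PF (u + v) = PF u + PF v" using L_glue(2) PF_D[OF u] PF_D[OF v] a.mem(2) by metis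
qed

lemma PF_diff: "u \<in> L \<Longrightarrow> v \<in> L \<Longrightarrow> PF (u - v) = PF u - PF v"
  using PF_add[of u "(-1) *\<^sub>C v"] PF_scale[of v "-1"] csubspace_scaleC[OF csubspace_L, of v "-1"] by simp

lemma PF_id: "u \<in> D \<Longrightarrow> PF u = u"
  using L_glue(2)[of u 0] g_scale[of 0 0] by simp

lemmas memL [simp, intro] = csubspace_0[OF csubspace_L] csubspace_add[OF csubspace_L]
  csubspace_scaleC[OF csubspace_L] csubspace_uminus[OF csubspace_L] csubspace_diff[OF csubspace_L]

section \<open>The Krein-von Neumann extension and the map \<open>\<xi>\<close>\<close>

abbreviation Dom0 where "Dom0 \<equiv> D0 S R \<Gamma>"
abbreviation X\<^sub>0 where "X\<^sub>0 \<equiv> X0 S R G \<Gamma>"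
abbreviation \<Omega> where "\<Omega> \<equiv> Omega0 S R G \<Gamma>"
abbreviation N' where "N' \<equiv> H'_norm S R G \<Gamma>"

(* Keeps the factor -i a scalar, which the rules for the inner product then pull out. *)
declare scaleC_minus_left [simp del]

definition B where "B x = x - \<i> *\<^sub>C G x"

lemma B_V: "x \<in> V \<Longrightarrow> B x \<in> V"
  by (simp add: B_def G_V)

lemma B_lin: "x \<in> V \<Longrightarrow> y \<in> V \<Longrightarrow> B (x + y) = B x + B y" "x \<in> V \<Longrightarrow> B (c *\<^sub>C x) = c *\<^sub>C B x"
  "x \<in> V \<Longrightarrow> y \<in> V \<Longrightarrow> B (x - y) = B x - B y"
  by (simp_all add: B_def G_add G_scale G_diff scaleC_add_right scaleC_diff_right scaleC_scaleC mult.commute)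

lemma B_adj: "x \<in> V \<Longrightarrow> y \<in> V \<Longrightarrow> cinner (x + \<i> *\<^sub>C G x) y = cinner x (B y)"
  by (simp add: B_def cinner_simps G_sym)

lemma B_tendsto: "(\<And>n. x n \<in> V) \<Longrightarrow> x \<longlonglongrightarrow> l \<Longrightarrow> (\<lambda>n. B (x n)) \<longlonglongrightarrow> B l"
  unfolding B_def by (intro tendsto_intros G_tendsto)

lemma inv_sqrt_eq:
  assumes "f \<in> V" "(f, w) \<in> R"
  shows "SFR_inv_sqrt S R w = f"
  unfolding SFR_inv_sqrt_def
proof (rule the_equality)
  fix x assume x: "x \<in> V \<and> (x, w) \<in> R"
  then have "(x - f, 0) \<in> R"
    using assms csubspace_diff[of R "(x, w)" "(f, w)"] R_linear by (simp add: linear_operator_def)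
  then have "x - f = 0" using x assms by (intro kernel_R_V) auto
  then show "x = f" by simp
qed (use assms in auto)

lemma B_inv: "x \<in> V \<Longrightarrow> inv_I_minus_iG S G (B x) = x"
  unfolding inv_I_minus_iG_def B_def
  using the_inv_into_f_f[of "\<lambda>x. x - \<i> *\<^sub>C G x" V x] B_bij by (simp add: bij_betw_def)

text \<open>The vector \<open>X\<^sub>0 e\<close> is the unique \<open>x\<close> in the closed range for which \<open>-i(I - iG)x\<close> is a preimage
  of \<open>\<gamma>(i)e\<close> under the square root. In this form linearity and limits are immediate, without
  reference to the inverses in the definition.\<close>

lemma X0_iff:
  "e \<in> Dom0 \<and> X\<^sub>0 e = x \<longleftrightarrow> x \<in> V \<and> ((- \<i>) *\<^sub>C B x, g e) \<in> R"
  and D0_iff: "e \<in> Dom0 \<longleftrightarrow> (\<exists>x\<in>V. ((- \<i>) *\<^sub>C B x, g e) \<in> R)"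
proof -
  have 1: "e \<in> Dom0 \<and> X\<^sub>0 e = x" if x: "x \<in> V" "((- \<i>) *\<^sub>C B x, g e) \<in> R" for x
  proof
    show "e \<in> Dom0" unfolding D0_def using x by blast
    have "(- \<i>) *\<^sub>C B x = B ((- \<i>) *\<^sub>C x)" using x by (simp add: B_lin)
    moreover have "SFR_inv_sqrt S R (g e) = (- \<i>) *\<^sub>C B x"
      using x B_V by (intro inv_sqrt_eq) auto
    ultimately have "X\<^sub>0 e = \<i> *\<^sub>C (- \<i>) *\<^sub>C x" unfolding X0_def using x B_inv by (metis memV(3))
    then show "X\<^sub>0 e = x" by (simp add: scaleC_scaleC)
  qed
  have 2: "\<exists>x\<in>V. ((- \<i>) *\<^sub>C B x, g e) \<in> R" if eD: "e \<in> Dom0"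
  proof -
    obtain y where y: "(y, g e) \<in> R" using eD unfolding D0_def by blast
    have "cmod (cinner (g e) v) \<le> norm y * norm (Rf v)" if "v \<in> Domain S" for v
      using R_sym[OF y dom_S_D[OF that]] cinner_Cauchy_Schwarz by metis
    then obtain f where f: "f \<in> V" "(f, g e) \<in> R" using in_Range_R by (metis norm_ge_zero)
    have "\<i> *\<^sub>C f \<in> V" using f by simp
    then obtain x where x: "x \<in> V" "B x = \<i> *\<^sub>C f"
      using B_bij unfolding B_def by (metis (no_types, lifting) bij_betw_def imageE)
    have "(- \<i>) *\<^sub>C B x = f" unfolding x(2) scaleC_scaleC by simp
    then have "((- \<i>) *\<^sub>C B x, g e) \<in> R" using f(2) by (simp only:)
    with x(1) show ?thesis by blast
  qed
  show "e \<in> Dom0 \<longleftrightarrow> (\<exists>x\<in>V. ((- \<i>) *\<^sub>C B x, g e) \<in> R)" using 1 2 by blast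
  show "e \<in> Dom0 \<and> X\<^sub>0 e = x \<longleftrightarrow> x \<in> V \<and> ((- \<i>) *\<^sub>C B x, g e) \<in> R"
    using 1 2 by blast
qed

lemma D0_I:
  assumes "x \<in> V" "((- \<i>) *\<^sub>C B x, g e) \<in> R"
  shows "e \<in> Dom0" "X\<^sub>0 e = x"
  using X0_iff[of e x] D0_iff[of e] assms by blast+

lemma X0_V: "e \<in> Dom0 \<Longrightarrow> X\<^sub>0 e \<in> V" and X0_R: "e \<in> Dom0 \<Longrightarrow> ((- \<i>) *\<^sub>C B (X\<^sub>0 e), g e) \<in> R"
  using X0_iff[of e "X\<^sub>0 e"] by blast+

lemma X0_linear: "clinear_on Dom0 X\<^sub>0"
proof -
  have R: "csubspace R" using R_linear by (simp add: linear_operator_def)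
  have add: "e + e' \<in> Dom0 \<and> X\<^sub>0 (e + e') = X\<^sub>0 e + X\<^sub>0 e'" if "e \<in> Dom0" "e' \<in> Dom0" for e e'
  proof -
    have "((- \<i>) *\<^sub>C B (X\<^sub>0 e + X\<^sub>0 e'), g (e + e')) \<in> R"
      using csubspace_add[OF R X0_R[OF that(1)] X0_R[OF that(2)]] X0_V that
      by (simp add: B_lin scaleC_add_right g_add)
    from D0_I[OF memV(2)[OF X0_V[OF that(1)] X0_V[OF that(2)]] this] show ?thesis by simp
  qed
  have scale: "c *\<^sub>C e \<in> Dom0 \<and> X\<^sub>0 (c *\<^sub>C e) = c *\<^sub>C X\<^sub>0 e" if "e \<in> Dom0" for c e
  proof -
    have "((- \<i>) *\<^sub>C B (c *\<^sub>C X\<^sub>0 e), g (c *\<^sub>C e)) \<in> R"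
      using csubspace_scaleC[OF R X0_R[OF that], of c] X0_V that
      by (simp add: B_lin g_scale scaleC_prod_def scaleC_scaleC mult.commute)
    from D0_I[OF memV(3)[OF X0_V[OF that]] this] show ?thesis by simp
  qed
  have "0 \<in> Dom0"
    using D0_I(1)[of 0 0] csubspace_0[OF R] g_scale[of 0 0] G_0 by (simp add: B_def zero_prod_def)
  then show ?thesis unfolding clinear_on_def csubspace_def using add scale by simp
qed

lemmas csubspace_D0 = clinear_on_csubspace[OF X0_linear]
lemmas mem0 [simp, intro] = csubspace_0[OF csubspace_D0] csubspace_add[OF csubspace_D0]
  csubspace_scaleC[OF csubspace_D0] csubspace_uminus[OF csubspace_D0] csubspace_diff[OF csubspace_D0]
lemmas X0_lin = clinear_on_add[OF X0_linear] clinear_on_scaleC[OF X0_linear]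
  clinear_on_diff[OF X0_linear]

lemma Omega_eq:
  assumes e: "e \<in> Dom0" and h: "h \<in> Dom0"
  shows "\<Omega> e h = \<i> * cinner (g e) (g h) + cinner (X\<^sub>0 e + \<i> *\<^sub>C G (X\<^sub>0 e)) (X\<^sub>0 h)"
proof -
  have f: "SFR_inv_sqrt S R (g e) = (- \<i>) *\<^sub>C B (X\<^sub>0 e)" if "e \<in> Dom0" for e
    using that X0_R X0_V B_V by (intro inv_sqrt_eq) auto
  have "(- \<i>) *\<^sub>C B (X\<^sub>0 e) = B ((- \<i>) *\<^sub>C X\<^sub>0 e)"
    using X0_V[OF e] by (simp add: B_lin)
  then have "inv_I_minus_iG S G ((- \<i>) *\<^sub>C B (X\<^sub>0 e)) = (- \<i>) *\<^sub>C X\<^sub>0 e"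
    using B_inv X0_V[OF e] by (metis memV(3))
  then have "\<Omega> e h = \<i> * cinner (g e) (g h) + cinner ((- \<i>) *\<^sub>C X\<^sub>0 e) ((- \<i>) *\<^sub>C B (X\<^sub>0 h))"
    unfolding Omega0_def f[OF e] f[OF h] by simp
  also have "\<dots> = \<i> * cinner (g e) (g h) + cinner (X\<^sub>0 e) (B (X\<^sub>0 h))"
    by (simp add: cinner_simps)
  finally show ?thesis using B_adj X0_V e h by simp
qed

lemma Omega_adj:
  assumes e: "e \<in> Dom0" and h: "h \<in> Dom0"
  shows "\<Omega> e h + form_adj \<Omega> e h = 2 * cinner (X\<^sub>0 e) (X\<^sub>0 h)"
proof -
  have "cnj (cinner (X\<^sub>0 h + \<i> *\<^sub>C G (X\<^sub>0 h)) (X\<^sub>0 e)) = cinner (X\<^sub>0 e) (X\<^sub>0 h + \<i> *\<^sub>C G (X\<^sub>0 h))"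
    by (rule cinner_commute[symmetric])
  moreover have "cnj (cinner (g h) (g e)) = cinner (g e) (g h)"
    by (rule cinner_commute[symmetric])
  ultimately show ?thesis
    using X0_V[OF e] X0_V[OF h] G_sym
    by (simp add: form_adj_def Omega_eq e h cinner_simps)
qed

text \<open>The norm of \<open>\<H>'\<close> is the graph norm of \<open>X\<^sub>0\<close>.\<close>

lemma N'_eq: "N' e = norm (e, X\<^sub>0 e)"
  by (simp add: H'_norm_def norm_prod_def norm_cinner)

lemma N'_tendsto:
  assumes "\<And>n. e n \<in> Dom0" "l \<in> Dom0"
  shows "(\<lambda>n. N' (e n - l)) \<longlonglongrightarrow> 0 \<longleftrightarrow> e \<longlonglongrightarrow> l \<and> (\<lambda>n. X\<^sub>0 (e n)) \<longlonglongrightarrow> X\<^sub>0 l"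
proof -
  have "N' (e n - l) = norm ((e n, X\<^sub>0 (e n)) - (l, X\<^sub>0 l))" for n
    using assms by (simp add: N'_eq X0_lin)
  then have "(\<lambda>n. N' (e n - l)) \<longlonglongrightarrow> 0 \<longleftrightarrow> (\<lambda>n. (e n, X\<^sub>0 (e n))) \<longlonglongrightarrow> (l, X\<^sub>0 l)"
    by (simp only: tendsto_norm_zero_iff LIM_zero_iff)
  also have "\<dots> \<longleftrightarrow> e \<longlonglongrightarrow> l \<and> (\<lambda>n. X\<^sub>0 (e n)) \<longlonglongrightarrow> X\<^sub>0 l"
    by (auto dest: tendsto_fst tendsto_snd intro: tendsto_Pair)
  finally show ?thesis .
qed

definition L0 where "L0 = {u \<in> L. \<Gamma> u \<in> Dom0}"
definition \<xi> where "\<xi> u = Rf (PF u) + X\<^sub>0 (\<Gamma> u)"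

lemma L0D: "u \<in> L0 \<Longrightarrow> u \<in> L" "u \<in> L0 \<Longrightarrow> \<Gamma> u \<in> Dom0"
  by (auto simp: L0_def)

lemma csubspace_L0: "csubspace L0"
  unfolding csubspace_def L0_def using \<Gamma>_D[OF a.mem(1)] by (auto simp: \<Gamma>_lin)

lemmas memL0 [simp, intro] = csubspace_0[OF csubspace_L0] csubspace_add[OF csubspace_L0]
  csubspace_scaleC[OF csubspace_L0] csubspace_uminus[OF csubspace_L0] csubspace_diff[OF csubspace_L0]

lemma D_L0: "u \<in> D \<Longrightarrow> u \<in> L0"
  by (simp add: L0_def D_L \<Gamma>_D)

lemma \<xi>_linear: "clinear_on L0 \<xi>"
  unfolding clinear_on_def
  using csubspace_L0
  by (simp add: \<xi>_def L0D \<Gamma>_lin PF_lin X0_lin Rf_add Rf_scale PF_D scaleC_add_right)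

lemmas \<xi>_lin = clinear_on_add[OF \<xi>_linear] clinear_on_scaleC[OF \<xi>_linear] clinear_on_diff[OF \<xi>_linear]

lemma \<xi>_V: "u \<in> L0 \<Longrightarrow> \<xi> u \<in> V"
  by (simp add: \<xi>_def L0D X0_V Rf_V PF_D)

lemma \<xi>_D: "u \<in> D \<Longrightarrow> \<xi> u = Rf u"
  using clinear_on_0[OF X0_linear] by (simp add: \<xi>_def PF_id \<Gamma>_D)

text \<open>Completing the square: for boundary values in \<open>\<D>\<^sub>0\<close> the cross terms of \<open>l\<close> are absorbed into
  the form \<open>((I + iG)\<xi>\<^sub>u, \<xi>\<^sub>v)\<close> of the Krein-von Neumann extension.\<close>

lemma l_form_eq:
  assumes u: "u \<in> L0" and v: "v \<in> L0"
  shows "l_form S u v = cinner (\<xi> u + \<i> *\<^sub>C G (\<xi> u)) (\<xi> v) - \<Omega> (\<Gamma> u) (\<Gamma> v)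
    - 2 * cinner (X\<^sub>0 (\<Gamma> u)) (Rf (PF v))"
proof -
  define x y p q where "x = Rf (PF u)" and "y = Rf (PF v)" and "p = X\<^sub>0 (\<Gamma> u)" and "q = X\<^sub>0 (\<Gamma> v)"
  have V: "x \<in> V" "y \<in> V" "p \<in> V" "q \<in> V"
    using u v by (simp_all add: x_def y_def p_def q_def L0D Rf_V PF_D X0_V)
  have 1: "cinner (g (\<Gamma> u)) (PF v) = - \<i> * cinner (B p) y"
    unfolding p_def y_def
    using R_sym[OF X0_R[OF L0D(2)[OF u]] PF_D[OF L0D(1)[OF v]]] by (simp add: cinner_simps)
  have "cinner (g (\<Gamma> v)) (PF u) = - \<i> * cinner (B q) x"
    unfolding q_def x_def
    using R_sym[OF X0_R[OF L0D(2)[OF v]] PF_D[OF L0D(1)[OF u]]] by (simp add: cinner_simps)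
  then have 2: "cinner (PF u) (g (\<Gamma> v)) = \<i> * cinner x (B q)"
    using cinner_commute[of "PF u" "g (\<Gamma> v)"] cinner_commute[of x "B q"] by simp
  have "l_form S u v = cinner (x + \<i> *\<^sub>C G x) y - cinner (B p) y + cinner x (B q)
      - \<i> * cinner (g (\<Gamma> u)) (g (\<Gamma> v))"
    using u v PF_D unfolding l_form_def
    by (simp add: PN_eq L0D a_eq 1 2 x_def y_def algebra_simps)
  also have "cinner x (B q) = cinner (x + \<i> *\<^sub>C G x) q" using B_adj V by simp
  finally show ?thesis
    using u v V unfolding \<xi>_def x_def[symmetric] y_def[symmetric] p_def[symmetric] q_def[symmetric]
    by (simp add: Omega_eq L0D p_def[symmetric] q_def[symmetric] G_add B_def cinner_simps scaleC_add_right algebra_simps)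
qed

text \<open>The vector \<open>\<xi>\<^sub>u\<close> is determined by the functional \<open>(S\<phi>, u)\<close> alone. This makes \<open>\<xi>\<close> closed as an
  operator, and it gives bounds on \<open>u\<^sub>F\<close> in terms of \<open>u\<close> and \<open>\<xi>\<^sub>u\<close>.\<close>

lemma S_\<xi>:
  assumes u: "u \<in> L0" and \<phi>: "\<phi> \<in> Domain S"
  shows "cinner (op_app S \<phi>) u = cinner (Rf \<phi>) (B (\<xi> u))"
proof -
  have \<phi>D: "\<phi> \<in> D" by (rule dom_S_D[OF \<phi>])
  note uL = L0D(1)[OF u] and uD0 = L0D(2)[OF u]
  have "cinner (op_app S \<phi>) (PF u) = cinner (Rf \<phi>) (B (Rf (PF u)))"
    using a_dom_S_left[OF \<phi> PF_D[OF uL]] a_eq[OF \<phi>D PF_D[OF uL]] B_adj Rf_V[OF \<phi>D] Rf_V[OF PF_D[OF uL]]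
    by simp
  moreover have "cinner (op_app S \<phi>) (g (\<Gamma> u)) = - \<i> * cinner \<phi> (g (\<Gamma> u))"
    using g_Ni \<phi> by (simp add: defect_iff)
  moreover have "cinner \<phi> (g (\<Gamma> u)) = cnj (cinner ((- \<i>) *\<^sub>C B (X\<^sub>0 (\<Gamma> u))) (Rf \<phi>))"
    using R_sym[OF X0_R[OF uD0] \<phi>D] cinner_commute by metis
  then have "- \<i> * cinner \<phi> (g (\<Gamma> u)) = cinner (Rf \<phi>) (B (X\<^sub>0 (\<Gamma> u)))"
    using cinner_commute[of "Rf \<phi>" "B (X\<^sub>0 (\<Gamma> u))"] by (simp add: cinner_simps)
  moreover have "cinner (op_app S \<phi>) u = cinner (op_app S \<phi>) (PF u) + cinner (op_app S \<phi>) (g (\<Gamma> u))"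
    using L_split[OF uL] cinner_add_right by metis
  ultimately show ?thesis
    using X0_V[OF uD0] Rf_V[OF PF_D[OF uL]] by (simp add: \<xi>_def B_lin cinner_simps)
qed

lemma PF_estimate:
  obtains C where "\<And>u. u \<in> L0 \<Longrightarrow> norm (Rf (PF u)) \<le> C * (norm (B (\<xi> u)) + norm u)"
    "\<And>u. u \<in> L0 \<Longrightarrow> norm (PF u) \<le> C * (norm (B (\<xi> u)) + norm u)"
proof -
  have eq: "a \<phi> (PF u) - cnj \<i> * cinner \<phi> (PF u) = cinner (Rf \<phi>) (B (\<xi> u)) + cinner \<phi> ((- \<i>) *\<^sub>C u)"
    if u: "u \<in> L0" and \<phi>: "\<phi> \<in> Domain S" for u \<phi>
  proof -
    note uL = L0D(1)[OF u]
    have "cinner (op_app S \<phi>) (g (\<Gamma> u)) = - \<i> * cinner \<phi> (g (\<Gamma> u))"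
      using g_Ni \<phi> by (simp add: defect_iff)
    moreover have "cinner \<psi> u = cinner \<psi> (PF u) + cinner \<psi> (g (\<Gamma> u))" for \<psi>
      using L_split[OF uL] cinner_add_right by metis
    ultimately show ?thesis
      using S_\<xi>[OF u \<phi>] a_dom_S_left[OF \<phi> PF_D[OF uL]]
      by (simp add: cinner_scaleC_right algebra_simps)
  qed
  have n: "norm ((- \<i>) *\<^sub>C u) = norm u" for u :: 'a by (simp only: norm_scaleC) simp
  show thesis
    using shift_estimate[OF PF_D[OF L0D(1)] _ eq] by (intro that[of "2 + K"]) (simp_all only: n simp_thms)
qed

text \<open>The bounds on \<open>u\<^sub>F\<close> make the components in \<open>D[S]\<close> a Cauchy sequence in the graph norm of the
  square root, so the components in the defect space converge as well, and with them the boundary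
  values and the vectors \<open>X\<^sub>0\<Gamma>u\<^sub>n = \<xi> - S\<^sub>F\<^sub>R\<^sup>1\<^sup>/\<^sup>2 u\<^sub>F\<close>.\<close>

lemma \<xi>_closed:
  assumes x: "\<And>n. x n \<in> L0" and xu: "x \<longlonglongrightarrow> u" and x\<xi>: "(\<lambda>n. \<xi> (x n)) \<longlonglongrightarrow> y"
  shows "u \<in> L0" "\<xi> u = y" "(\<lambda>n. \<Gamma> (x n)) \<longlonglongrightarrow> \<Gamma> u" "(\<lambda>n. X\<^sub>0 (\<Gamma> (x n))) \<longlonglongrightarrow> X\<^sub>0 (\<Gamma> u)"
proof -
  obtain C where C: "\<And>u. u \<in> L0 \<Longrightarrow> norm (Rf (PF u)) \<le> C * (norm (B (\<xi> u)) + norm u)"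
    "\<And>u. u \<in> L0 \<Longrightarrow> norm (PF u) \<le> C * (norm (B (\<xi> u)) + norm u)" using PF_estimate by blast
  note xL = L0D(1)[OF x] and xD0 = L0D(2)[OF x]
  have nb: "null2 (\<lambda>m n. (norm (B (\<xi> (x m)) - B (\<xi> (x n))))\<^sup>2)" and nx: "null2 (\<lambda>m n. (norm (x m - x n))\<^sup>2)"
    unfolding Cauchy_iff_null2[symmetric]
    using B_tendsto[OF \<xi>_V[OF x] x\<xi>] xu LIMSEQ_imp_Cauchy by blast+
  have conv: "\<exists>l. f \<longlonglongrightarrow> l"
    if f: "\<And>m n. norm (f m - f n) \<le> C * (norm (B (\<xi> (x m)) - B (\<xi> (x n))) + norm (x m - x n))"
    for f :: "nat \<Rightarrow> 'a"
  proof -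
    have "null2 (\<lambda>m n. (norm (f m - f n))\<^sup>2)"
    proof (rule null2_le)
      show "null2 (\<lambda>m n. (2 * C\<^sup>2) * ((norm (B (\<xi> (x m)) - B (\<xi> (x n))))\<^sup>2 + (norm (x m - x n))\<^sup>2))"
        by (intro null2_cmult null2_add nb nx) simp
      fix m n
      let ?p = "norm (B (\<xi> (x m)) - B (\<xi> (x n)))" and ?q = "norm (x m - x n)"
      have "(norm (f m - f n))\<^sup>2 \<le> (C * (?p + ?q))\<^sup>2" using f by (intro power_mono) auto
      also have "\<dots> \<le> C\<^sup>2 * (2 * (?p\<^sup>2 + ?q\<^sup>2))"
        using sum_squares_bound[of ?p ?q] unfolding power_mult_distrib
        by (intro mult_left_mono) (simp_all add: power2_sum)
      finally show "(norm (f m - f n))\<^sup>2 \<le> (2 * C\<^sup>2) * (?p\<^sup>2 + ?q\<^sup>2)"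
        by (simp only: mult_ac)
    qed
    then show ?thesis by (rule convergent_if_null2)
  qed
  have d: "\<xi> (x m - x n) = \<xi> (x m) - \<xi> (x n)" "PF (x m - x n) = PF (x m) - PF (x n)"
    "B (\<xi> (x m) - \<xi> (x n)) = B (\<xi> (x m)) - B (\<xi> (x n))" for m n
    using x xL by (simp_all add: \<xi>_lin PF_diff B_lin \<xi>_V)
  have "\<exists>z. (\<lambda>n. Rf (PF (x n))) \<longlonglongrightarrow> z"
    using C(1)[of "x m - x n" for m n] x xL PF_D by (intro conv) (simp add: d Rf_diff)
  then obtain z where z: "(\<lambda>n. Rf (PF (x n))) \<longlonglongrightarrow> z" by blast
  have "\<exists>c. (\<lambda>n. PF (x n)) \<longlonglongrightarrow> c"
    using C(2)[of "x m - x n" for m n] x by (intro conv) (simp add: d)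
  then obtain c where c: "(\<lambda>n. PF (x n)) \<longlonglongrightarrow> c" by blast
  have cD: "c \<in> D" "Rf c = z" using D_closedI[OF PF_D[OF xL] c z] by auto
  have gx: "g (\<Gamma> (x n)) = x n - PF (x n)" for n using L_split[OF xL[of n]] by (metis add_diff_cancel_left')
  have gl: "(\<lambda>n. g (\<Gamma> (x n))) \<longlonglongrightarrow> u - c" unfolding gx by (intro tendsto_intros xu c)
  have w: "u - c \<in> Ni" by (rule closed_sequentially[OF closed_defect g_Ni gl])
  have u: "c + (u - c) \<in> L" using L_I[OF cD(1) w] .
  have PFu: "PF u = c" and gu: "g (\<Gamma> u) = u - c"
    using proj_eq(1)[OF _ cD(1) w] PN_eq[OF u] proj_eq(2)[OF _ cD(1) w] by auto
  obtain C' where C': "C' \<ge> 0" "\<And>w. w \<in> Ni \<Longrightarrow> norm (\<Gamma> w) \<le> C' * norm w" using \<Gamma>_Ni_bounded by blast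
  have "(\<lambda>n. C' * norm (g (\<Gamma> (x n)) - (u - c))) \<longlonglongrightarrow> C' * 0"
    using gl by (intro tendsto_intros) (simp add: tendsto_norm_zero_iff LIM_zero_iff)
  moreover have "norm (\<Gamma> (x n) - \<Gamma> u) \<le> C' * norm (g (\<Gamma> (x n)) - (u - c))" for n
    using C'(2)[OF g_Ni, of "\<Gamma> (x n) - \<Gamma> u"] unfolding \<Gamma>_g by (simp add: g_diff gu)
  ultimately have "(\<lambda>n. \<Gamma> (x n) - \<Gamma> u) \<longlonglongrightarrow> 0"
    by (rule_tac Lim_null_comparison[of _ "\<lambda>n. C' * norm (g (\<Gamma> (x n)) - (u - c))"])
      (auto intro!: always_eventually)
  then show "(\<lambda>n. \<Gamma> (x n)) \<longlonglongrightarrow> \<Gamma> u" by (simp add: LIM_zero_iff)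
  have "(\<lambda>n. \<xi> (x n) - Rf (PF (x n))) \<longlonglongrightarrow> y - z" by (intro tendsto_intros x\<xi> z)
  then have X0l: "(\<lambda>n. X\<^sub>0 (\<Gamma> (x n))) \<longlonglongrightarrow> y - z" by (simp add: \<xi>_def)
  have yz: "y - z \<in> V" using V_lim[OF X0_V[OF xD0] X0l] .
  have "(\<lambda>n. (- \<i>) *\<^sub>C B (X\<^sub>0 (\<Gamma> (x n)))) \<longlonglongrightarrow> (- \<i>) *\<^sub>C B (y - z)"
    by (intro tendsto_scaleC tendsto_const B_tendsto X0_V xD0 X0l)
  then have "((- \<i>) *\<^sub>C B (y - z), g (\<Gamma> u)) \<in> R"
    using selfadjoint_closed[OF R_adj X0_R[OF xD0] _ gl] gu by simp
  then have *: "\<Gamma> u \<in> Dom0" "X\<^sub>0 (\<Gamma> u) = y - z" using D0_I[OF yz] by auto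
  then show "u \<in> L0" using u by (simp add: L0_def)
  show "\<xi> u = y" by (simp add: \<xi>_def * PFu cD)
  show "(\<lambda>n. X\<^sub>0 (\<Gamma> (x n))) \<longlonglongrightarrow> X\<^sub>0 (\<Gamma> u)" using X0l * by simp
qed

end

section \<open>Sectoriality of an extension in terms of its boundary data\<close>

text \<open>The coupling term is at most \<open>\<delta>\<close> times the sum of the two diagonal terms, by the inequality
  between arithmetic and geometric means.\<close>

lemma (in friedrichs) coupled_form_bounds:
  assumes x\<xi>: "\<xi> \<in> V" and w: "0 \<le> Re w" "\<bar>Im w\<bar> \<le> k * Re w" "0 \<le> k"
    and \<delta>: "0 \<le> \<delta>" "\<delta> < 1" "(norm x)\<^sup>2 \<le> \<delta>\<^sup>2 * Re w"
    and C: "\<And>x. x \<in> V \<Longrightarrow> norm (G x) \<le> C * norm x" "0 \<le> C"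
    and \<tau>: "\<tau> = cinner (\<xi> + \<i> *\<^sub>C G \<xi>) \<xi> + 2 * cinner x \<xi> + w"
  shows "(1 - \<delta>) * ((norm \<xi>)\<^sup>2 + Re w) \<le> Re \<tau>"
    and "Re \<tau> \<le> 2 * ((norm \<xi>)\<^sup>2 + Re w)"
    and "\<bar>Im \<tau>\<bar> \<le> (C + 1 + k) * ((norm \<xi>)\<^sup>2 + Re w)"
proof -
  have Re: "Re \<tau> = (norm \<xi>)\<^sup>2 + 2 * Re (cinner x \<xi>) + Re w"
    and Im: "Im \<tau> = Re (cinner (G \<xi>) \<xi>) + 2 * Im (cinner x \<xi>) + Im w"
    using G_real[OF x\<xi>] by (simp_all add: \<tau> cinner_simps norm_sq_cinner)
  have "norm x \<le> \<delta> * sqrt (Re w)"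
    using real_sqrt_le_mono[OF \<delta>(3)] \<delta>(1) by (simp add: real_sqrt_mult)
  then have "cmod (cinner x \<xi>) \<le> \<delta> * sqrt (Re w) * norm \<xi>"
    using cinner_Cauchy_Schwarz[of x \<xi>] mult_right_mono[of "norm x" _ "norm \<xi>"] by fastforce
  moreover have "2 * (sqrt (Re w) * norm \<xi>) \<le> (norm \<xi>)\<^sup>2 + Re w"
    using sum_squares_bound[of "sqrt (Re w)" "norm \<xi>"] w(1) by (simp add: algebra_simps)
  then have "\<delta> * (2 * (sqrt (Re w) * norm \<xi>)) \<le> \<delta> * ((norm \<xi>)\<^sup>2 + Re w)"
    using \<delta>(1) by (intro mult_left_mono)
  ultimately have x: "2 * cmod (cinner x \<xi>) \<le> \<delta> * ((norm \<xi>)\<^sup>2 + Re w)" by (simp add: mult.assoc)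
  have \<delta>1: "\<delta> * ((norm \<xi>)\<^sup>2 + Re w) \<le> 1 * ((norm \<xi>)\<^sup>2 + Re w)"
    using \<delta> w by (intro mult_right_mono) auto
  show "(1 - \<delta>) * ((norm \<xi>)\<^sup>2 + Re w) \<le> Re \<tau>"
    using abs_Re_le_cmod[of "cinner x \<xi>"] x unfolding Re by (simp add: algebra_simps)
  show "Re \<tau> \<le> 2 * ((norm \<xi>)\<^sup>2 + Re w)"
    using abs_Re_le_cmod[of "cinner x \<xi>"] x \<delta>1 unfolding Re by (simp add: algebra_simps)
  have "\<bar>Re (cinner (G \<xi>) \<xi>)\<bar> \<le> norm (G \<xi>) * norm \<xi>"
    using abs_Re_le_cmod cinner_Cauchy_Schwarz order_trans by blast
  also have "\<dots> \<le> C * norm \<xi> * norm \<xi>" using C x\<xi> by (intro mult_right_mono) auto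
  finally have "\<bar>Re (cinner (G \<xi>) \<xi>)\<bar> \<le> C * (norm \<xi>)\<^sup>2" by (simp add: power2_eq_square)
  moreover have "C * Re w \<ge> 0" "k * (norm \<xi>)\<^sup>2 \<ge> 0" using w C(2) by auto
  moreover have "2 * \<bar>Im (cinner x \<xi>)\<bar> \<le> (norm \<xi>)\<^sup>2 + Re w"
    using abs_Im_le_cmod[of "cinner x \<xi>"] x \<delta>1 by simp
  ultimately show "\<bar>Im \<tau>\<bar> \<le> (C + 1 + k) * ((norm \<xi>)\<^sup>2 + Re w)"
    using w(2) unfolding Im by (simp add: algebra_simps)
qed

locale extension = boundary S R G K \<Gamma>
  for S R :: "('a::chilbert_space \<times> 'a) set" and G K and \<Gamma> :: "'a \<Rightarrow> 'h::chilbert_space" +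
  fixes Z :: "('h \<times> 'h) set" and X :: "'h \<Rightarrow> 'a" and T :: "('a \<times> 'a) set" and Y :: "'a \<Rightarrow> 'h"
  assumes adm: "admissible_pair S Z X"
    and T_linear: "linear_operator T" and S_T: "S \<subseteq> T" and T_L: "Domain T \<subseteq> LL S"
    and Y_linear: "clinear_on (Domain T) Y"
    and Z_eq: "Z = {(\<Gamma> u, Y u) | u. u \<in> Domain T}"
    and T_form: "\<And>u v. u \<in> Domain T \<Longrightarrow> v \<in> LL S \<Longrightarrow>
      cinner (op_app T u) v = l_form S u v + cinner (Y u) (\<Gamma> v)
        + 2 * cinner (X (\<Gamma> u)) (op_app R (projF S \<i> v))"
begin

abbreviation \<omega> where "\<omega> \<equiv> omega S R G \<Gamma> Z X"

lemma Z_csubspace: "csubspace Z"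
  and Z_accretive: "(e, h) \<in> Z \<Longrightarrow> 0 \<le> Re (cinner h e)"
  and X_linear: "clinear_on (Domain Z) X"
  using adm unfolding admissible_pair_def m_accretive_rel_def accretive_def by auto

lemma X_V: "e \<in> Domain Z \<Longrightarrow> X e \<in> V"
  using adm unfolding admissible_pair_def by blast

lemma dom_Z: "Domain Z = \<Gamma> ` Domain T"
  unfolding Z_eq by auto

lemma csubspace_dom_Z: "csubspace (Domain Z)"
  by (rule clinear_on_csubspace[OF X_linear])

lemma csubspace_dom_T: "csubspace (Domain T)"
  by (rule clinear_on_csubspace[OF Y_linear])

lemma dom_S_T: "u \<in> Domain S \<Longrightarrow> u \<in> Domain T"
  using S_T by blast

lemma T_S: "u \<in> Domain S \<Longrightarrow> op_app T u = op_app S u"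
  using op_app_in[OF S_linear] op_app_eq[OF T_linear] S_T by blast

lemma Z_I: "u \<in> Domain T \<Longrightarrow> (\<Gamma> u, Y u) \<in> Z"
  unfolding Z_eq by blast

text \<open>Adding large multiples of \<open>d\<close> to an element of the relation would violate accretivity unless
  \<open>d\<close> is orthogonal to the domain.\<close>

lemma mul_Z_orthogonal:
  assumes d: "(0, d) \<in> Z" and k: "k \<in> Domain Z"
  shows "cinner d k = 0"
proof (rule ccontr)
  assume nz: "cinner d k \<noteq> 0"
  obtain m where m: "(k, m) \<in> Z" using k by blast
  define w where "w = cinner d k"
  \<comment> \<open>chosen so that the real part becomes \<open>-1\<close>\<close>
  define s where "s = (Re (cinner m k) + 1) / (cmod w)\<^sup>2"
  define c where "c = - complex_of_real s * cnj w"
  have "(k, m + c *\<^sub>C d) \<in> Z"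
    using csubspace_add[OF Z_csubspace m csubspace_scaleC[OF Z_csubspace d, of c]]
    by (simp add: scaleC_prod_def)
  then have "0 \<le> Re (cinner (m + c *\<^sub>C d) k)" by (rule Z_accretive)
  also have "cinner (m + c *\<^sub>C d) k = cinner m k - complex_of_real s * (w * cnj w)"
    by (simp add: cinner_simps c_def w_def[symmetric] algebra_simps)
  also have "Re \<dots> = Re (cinner m k) - s * (cmod w)\<^sup>2"
    by (simp add: complex_norm_square[symmetric] flip: of_real_power of_real_mult)
  also have "\<dots> = - 1" using nz by (simp add: s_def w_def)
  finally show False by simp
qed

lemma rel_form_eq:
  assumes e: "(e, h) \<in> Z" and k: "k \<in> Domain Z"
  shows "rel_form Z e k = cinner h k"
  unfolding rel_form_def
proof (rule the_equality)
  show "\<exists>h'. (e, h') \<in> Z \<and> cinner h k = cinner h' k" using e by blast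
  fix c assume "\<exists>h'. (e, h') \<in> Z \<and> c = cinner h' k"
  then obtain h' where h': "(e, h') \<in> Z" "c = cinner h' k" by blast
  have "(0, h' - h) \<in> Z" using csubspace_diff[OF Z_csubspace h'(1) e] by simp
  then have "cinner (h' - h) k = 0" using mul_Z_orthogonal k by blast
  then show "c = cinner h k" by (simp add: h' cinner_simps)
qed

lemma \<omega>_eq:
  assumes "u \<in> Domain T" "k \<in> Domain Z"
  shows "\<omega> (\<Gamma> u) k = cinner (Y u) k - \<Omega> (\<Gamma> u) k - 2 * cinner (X (\<Gamma> u) - X\<^sub>0 (\<Gamma> u)) (X\<^sub>0 k)"
  unfolding omega_def using rel_form_eq[OF Z_I[OF assms(1)] assms(2)] by simp

lemma \<omega>_alt:
  assumes "e \<in> Dom0" "k \<in> Dom0"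
  shows "\<omega> e k = rel_form Z e k + form_adj \<Omega> e k - 2 * cinner (X e) (X\<^sub>0 k)"
  unfolding omega_def using Omega_adj[OF assms] by (simp add: cinner_simps algebra_simps)

text \<open>The form of the extension splits into the form of the Krein-von Neumann extension in the
  variable \<open>\<xi>\<close>, the form \<open>\<omega>\<close> of the boundary values, and one coupling term.\<close>

lemma T_split:
  assumes u: "u \<in> Domain T" and uD: "\<Gamma> u \<in> Dom0" and v: "v \<in> L0"
  shows "cinner (op_app T u) v = cinner (\<xi> u + \<i> *\<^sub>C G (\<xi> u)) (\<xi> v)
    + 2 * cinner (X (\<Gamma> u) - X\<^sub>0 (\<Gamma> u)) (\<xi> v)
    + (cinner (Y u) (\<Gamma> v) - \<Omega> (\<Gamma> u) (\<Gamma> v) - 2 * cinner (X (\<Gamma> u) - X\<^sub>0 (\<Gamma> u)) (X\<^sub>0 (\<Gamma> v)))"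
proof -
  have uL: "u \<in> L0" using u uD T_L by (auto simp: L0_def)
  have "cinner (X (\<Gamma> u) - X\<^sub>0 (\<Gamma> u)) (\<xi> v) - cinner (X (\<Gamma> u) - X\<^sub>0 (\<Gamma> u)) (X\<^sub>0 (\<Gamma> v))
      = cinner (X (\<Gamma> u)) (Rf (PF v)) - cinner (X\<^sub>0 (\<Gamma> u)) (Rf (PF v))"
    unfolding \<xi>_def by (simp add: cinner_simps)
  then have d: "2 * cinner (X (\<Gamma> u)) (Rf (PF v)) - 2 * cinner (X\<^sub>0 (\<Gamma> u)) (Rf (PF v))
      = 2 * cinner (X (\<Gamma> u) - X\<^sub>0 (\<Gamma> u)) (\<xi> v) - 2 * cinner (X (\<Gamma> u) - X\<^sub>0 (\<Gamma> u)) (X\<^sub>0 (\<Gamma> v))"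
    by (simp only: right_diff_distrib[symmetric])
  have "cinner (op_app T u) v = cinner (\<xi> u + \<i> *\<^sub>C G (\<xi> u)) (\<xi> v) - \<Omega> (\<Gamma> u) (\<Gamma> v) + cinner (Y u) (\<Gamma> v)
      + (2 * cinner (X (\<Gamma> u)) (Rf (PF v)) - 2 * cinner (X\<^sub>0 (\<Gamma> u)) (Rf (PF v)))"
    unfolding T_form[OF u L0D(1)[OF v]] l_form_eq[OF uL v] by simp
  then show ?thesis unfolding d by simp
qed

lemma sesq_\<omega>:
  assumes sub: "Domain Z \<subseteq> Dom0"
  shows "sesquilinear_on (Domain Z) \<omega>"
proof -
  note subD = subsetD[OF sub]
  note mem = csubspace_add[OF csubspace_dom_Z] csubspace_scaleC[OF csubspace_dom_Z]
  note lin = X0_lin clinear_on_add[OF X_linear] clinear_on_scaleC[OF X_linear] G_add G_scale X0_V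
    g_add g_scale cinner_simps scaleC_add_right subD
  have eq: "\<omega> e k = cinner h k - (\<i> * cinner (g e) (g k) + cinner (X\<^sub>0 e + \<i> *\<^sub>C G (X\<^sub>0 e)) (X\<^sub>0 k))
      - 2 * cinner (X e - X\<^sub>0 e) (X\<^sub>0 k)" if "(e, h) \<in> Z" "k \<in> Domain Z" for e h k
    unfolding omega_def rel_form_eq[OF that] Omega_eq[OF subD[OF DomainI[OF that(1)]] subD[OF that(2)]] ..
  have lin_\<omega>: "\<omega> (e + e') k = \<omega> e k + \<omega> e' k" "\<omega> k (e + e') = \<omega> k e + \<omega> k e'"
    "\<omega> (c *\<^sub>C e) k = c * \<omega> e k" "\<omega> k (c *\<^sub>C e) = cnj c * \<omega> k e"
    if e: "e \<in> Domain Z" and e': "e' \<in> Domain Z" and k: "k \<in> Domain Z" for e e' k c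
  proof -
    obtain h h' m where h: "(e, h) \<in> Z" "(e', h') \<in> Z" "(k, m) \<in> Z" using e e' k by blast
    have sum: "(e + e', h + h') \<in> Z" using csubspace_add[OF Z_csubspace h(1,2)] by simp
    have sc: "(c *\<^sub>C e, c *\<^sub>C h) \<in> Z"
      using csubspace_scaleC[OF Z_csubspace h(1), of c] by (simp add: scaleC_prod_def)
    show "\<omega> (e + e') k = \<omega> e k + \<omega> e' k"
      unfolding eq[OF sum k] eq[OF h(1) k] eq[OF h(2) k] using e e' k by (simp add: lin algebra_simps)
    show "\<omega> k (e + e') = \<omega> k e + \<omega> k e'"
      unfolding eq[OF h(3) mem(1)[OF e e']] eq[OF h(3) e] eq[OF h(3) e']
      using e e' k by (simp add: lin algebra_simps)
    show "\<omega> (c *\<^sub>C e) k = c * \<omega> e k"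
      unfolding eq[OF sc k] eq[OF h(1) k] using e k by (simp add: lin algebra_simps)
    show "\<omega> k (c *\<^sub>C e) = cnj c * \<omega> k e"
      unfolding eq[OF h(3) mem(2)[OF e]] eq[OF h(3) e] using e k by (simp add: lin algebra_simps)
  qed
  show ?thesis
    unfolding sesquilinear_on_def by (intro conjI ballI allI csubspace_dom_Z lin_\<omega>)
qed

lemma sectorial_if:
  assumes sub: "Domain Z \<subseteq> Dom0" and sect: "sect_form (Domain Z) \<omega> k"
    and \<delta>: "0 \<le> \<delta>" "\<delta> < 1" "\<And>e. e \<in> Domain Z \<Longrightarrow> (norm (X e - X\<^sub>0 e))\<^sup>2 \<le> \<delta>\<^sup>2 * quad \<omega> e"
  shows "\<exists>k. sectorial_operator_with k T"
proof -
  interpret w: sect_form "Domain Z" \<omega> k by (rule sect)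
  obtain C where C: "C \<ge> 0" "\<And>x. x \<in> V \<Longrightarrow> norm (G x) \<le> C * norm x" using G_bounded by blast
  let ?k = "(C + 1 + k) / (1 - \<delta>)"
  have "0 \<le> Re (cinner h u) \<and> \<bar>Im (cinner h u)\<bar> \<le> ?k * Re (cinner h u)" if uh: "(u, h) \<in> T" for u h
  proof -
    have u: "u \<in> Domain T" and h: "h = op_app T u" using uh op_app_eq[OF T_linear uh] by auto
    have e: "\<Gamma> u \<in> Domain Z" using u dom_Z by blast
    have uL: "u \<in> L0" using u e sub T_L by (auto simp: L0_def)
    have eq: "cinner h u = cinner (\<xi> u + \<i> *\<^sub>C G (\<xi> u)) (\<xi> u) + 2 * cinner (X (\<Gamma> u) - X\<^sub>0 (\<Gamma> u)) (\<xi> u)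
        + \<omega> (\<Gamma> u) (\<Gamma> u)"
      unfolding h \<omega>_eq[OF u e] using T_split[OF u _ uL] e sub by blast
    let ?q = "(norm (\<xi> u))\<^sup>2 + quad \<omega> (\<Gamma> u)"
    have q: "?q \<ge> 0" using w.Re_nonneg[OF e] by simp
    note b = coupled_form_bounds[OF \<xi>_V[OF uL] w.Re_nonneg[OF e] w.Im_le[OF e] w.K_nonneg \<delta>(1,2) \<delta>(3)[OF e] C(2,1) eq]
    have 1: "0 \<le> Re (cinner h u)" using b(1) q \<delta>(2) by (smt (verit) mult_nonneg_nonneg)
    have "\<bar>Im (cinner h u)\<bar> \<le> (C + 1 + k) * ?q" by (rule b(3))
    also have "\<dots> = ?k * ((1 - \<delta>) * ?q)" using \<delta>(2) by simp
    also have "\<dots> \<le> ?k * Re (cinner h u)"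
      using b(1) C(1) w.K_nonneg \<delta>(2) by (intro mult_left_mono) auto
    finally show ?thesis using 1 by blast
  qed
  then have "sectorial_operator_with ?k T"
    using T_linear C(1) w.K_nonneg \<delta>(2) by (auto simp: sectorial_operator_with_def)
  then show ?thesis by blast
qed

text \<open>For \<open>v \<in> dom S\<close> all terms of \<open>(Tu,v)\<close> other than \<open>(\<gamma>(i)\<Gamma>u, v)\<close> are bounded by a multiple of the
  norm of \<open>S\<^sub>F\<^sub>R\<^sup>1\<^sup>/\<^sup>2 v\<close>, and so is \<open>(Tu,v)\<close> itself when the extension is sectorial. This bound
  characterizes the range of the square root.\<close>

lemma dom_Z_D0_if_sectorial:
  assumes T_sect: "sectorial_operator_with k T"
  shows "Domain Z \<subseteq> Dom0"
proof
  fix e assume "e \<in> Domain Z"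
  then obtain u where u: "u \<in> Domain T" "e = \<Gamma> u" unfolding dom_Z by blast
  interpret t: sect_form "Domain T" "operator_form T" k by (rule sect_form_operator[OF T_sect])
  have uL: "u \<in> L" using u T_L by blast
  note uD = PF_D[OF uL]
  let ?C = "2 * (1 + k) * sqrt (Re (cinner (op_app T u) u)) + 2 * (1 + K) * norm (Rf (PF u)) + 2 * norm (X e)"
  have "cmod (cinner (g e) v) \<le> ?C * norm (Rf v)" if v: "v \<in> Domain S" for v
  proof -
    have vD: "v \<in> D" by (rule dom_S_D[OF v])
    have "projN S \<i> v = 0"
      using PN_eq[OF D_L[OF vD]] \<Gamma>_D[OF vD] g_scale[of 0 0] by simp
    then have "cinner (op_app T u) v = a (PF u) v - \<i> * cinner (g e) v + 2 * cinner (X e) (Rf v)"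
      using T_form[OF u(1) D_L[OF vD]] \<Gamma>_D[OF vD] PF_id[OF vD] PN_eq[OF uL] u(2)
      by (simp add: l_form_def)
    then have "\<i> * cinner (g e) v = a (PF u) v + 2 * cinner (X e) (Rf v) - cinner (op_app T u) v"
      by (simp add: algebra_simps)
    then have "cmod (cinner (g e) v) = cmod (a (PF u) v + 2 * cinner (X e) (Rf v) - cinner (op_app T u) v)"
      by (metis norm_mult norm_ii mult_1)
    also have "\<dots> \<le> cmod (a (PF u) v) + 2 * cmod (cinner (X e) (Rf v)) + cmod (cinner (op_app T u) v)"
      by (intro order_trans[OF norm_triangle_ineq4] add_mono order_trans[OF norm_triangle_ineq])
        (simp_all add: norm_mult)
    also have "cmod (a (PF u) v) \<le> 2 * (1 + K) * norm (Rf (PF u)) * norm (Rf v)"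
      using a.Cauchy_Schwarz[OF uD vD] by (simp add: Re_a uD vD)
    also have "2 * cmod (cinner (X e) (Rf v)) \<le> 2 * (norm (X e) * norm (Rf v))"
      using cinner_Cauchy_Schwarz[of "X e" "Rf v"] by simp
    also have "cmod (cinner (op_app T u) v) \<le> 2 * (1 + k) * sqrt (Re (cinner (op_app T u) u)) * norm (Rf v)"
    proof -
      have "Re (cinner (op_app T v) v) = (norm (Rf v))\<^sup>2"
        using a_dom_S[OF v v] Re_a[OF vD] T_S[OF v] by simp
      then show ?thesis using t.Cauchy_Schwarz[OF u(1) dom_S_T[OF v]] by simp
    qed
    finally show ?thesis by (simp add: algebra_simps)
  qed
  moreover have "?C \<ge> 0" using t.Re_nonneg[OF u(1)] t.K_nonneg a.K_nonneg by simp
  ultimately obtain f where "(f, g e) \<in> R" using in_Range_R by blast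
  then show "e \<in> Dom0" unfolding D0_def by blast
qed

text \<open>Adding elements of \<open>dom S\<close> does not change the boundary value but moves \<open>\<xi>\<close> through a dense
  subset of the closed range. Hence the sector condition holds with \<open>\<xi>\<close> replaced by an arbitrary
  vector of the closed range.\<close>

lemma sector_condition_free:
  assumes T_sect: "sectorial_operator_with k T" and e: "e \<in> Domain Z" and \<eta>: "\<eta> \<in> V"
    and \<tau>: "\<tau> = cinner (\<eta> + \<i> *\<^sub>C G \<eta>) \<eta> + 2 * cinner (X e - X\<^sub>0 e) \<eta> + \<omega> e e"
  shows "0 \<le> Re \<tau>" "\<bar>Im \<tau>\<bar> \<le> k * Re \<tau>"
proof -
  interpret t: sect_form "Domain T" "operator_form T" k by (rule sect_form_operator[OF T_sect])
  note sub = subsetD[OF dom_Z_D0_if_sectorial[OF T_sect]]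
  obtain u where u: "u \<in> Domain T" "e = \<Gamma> u" using e unfolding dom_Z by blast
  have uL: "u \<in> L0" using u e sub T_L by (auto simp: L0_def)
  obtain \<phi> where \<phi>: "\<And>n. \<phi> n \<in> Domain S" "(\<lambda>n. Rf (\<phi> n)) \<longlonglongrightarrow> \<eta> - \<xi> u"
    using Rf_core_dense[OF memV(5)[OF \<eta> \<xi>_V[OF uL]]] by blast
  define v where "v n = u + \<phi> n" for n
  have \<phi>D: "\<phi> n \<in> D" for n by (rule dom_S_D[OF \<phi>(1)])
  have vT: "v n \<in> Domain T" for n
    unfolding v_def using csubspace_add[OF csubspace_dom_T u(1) dom_S_T[OF \<phi>(1)]] .
  have \<Gamma>v: "\<Gamma> (v n) = e" for n
    unfolding v_def using \<Gamma>_lin(1)[OF L0D(1)[OF uL] D_L[OF \<phi>D]] \<Gamma>_D[OF \<phi>D] u(2) by simp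
  have vL: "v n \<in> L0" for n unfolding v_def using uL D_L0[OF \<phi>D] by simp
  have \<xi>v: "\<xi> (v n) = \<xi> u + Rf (\<phi> n)" for n
    unfolding v_def using \<xi>_lin(1)[OF uL D_L0[OF \<phi>D]] \<xi>_D[OF \<phi>D] by simp
  have "(\<lambda>n. \<xi> u + Rf (\<phi> n)) \<longlonglongrightarrow> \<xi> u + (\<eta> - \<xi> u)" by (intro tendsto_intros \<phi>)
  then have lim: "(\<lambda>n. \<xi> (v n)) \<longlonglongrightarrow> \<eta>" by (simp add: \<xi>v)
  have eq: "cinner (op_app T (v n)) (v n) = cinner (\<xi> (v n) + \<i> *\<^sub>C G (\<xi> (v n))) (\<xi> (v n))
      + 2 * cinner (X e - X\<^sub>0 e) (\<xi> (v n)) + \<omega> e e" for n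
    using T_split[OF vT _ vL, of n n] \<omega>_eq[OF vT e, of n] sub[OF e] unfolding \<Gamma>v by simp
  have "(\<lambda>n. cinner (op_app T (v n)) (v n)) \<longlonglongrightarrow> \<tau>"
    unfolding eq \<tau> by (intro tendsto_intros lim G_tendsto \<xi>_V vL)
  note lim = this
  show "0 \<le> Re \<tau>"
    using tendsto_lowerbound[OF tendsto_Re[OF lim], of 0] t.Re_nonneg[OF vT] by simp
  have "(\<lambda>n. k * Re (cinner (op_app T (v n)) (v n)) - \<bar>Im (cinner (op_app T (v n)) (v n))\<bar>)
      \<longlonglongrightarrow> k * Re \<tau> - \<bar>Im \<tau>\<bar>"
    by (intro tendsto_intros lim)
  from tendsto_lowerbound[OF this, of 0] t.Im_le[OF vT] show "\<bar>Im \<tau>\<bar> \<le> k * Re \<tau>" by simp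
qed

lemma sect_form_\<omega>:
  assumes T_sect: "sectorial_operator_with k T"
  shows "sect_form (Domain Z) \<omega> k"
proof
  show "sesquilinear_on (Domain Z) \<omega>" by (rule sesq_\<omega>[OF dom_Z_D0_if_sectorial[OF T_sect]])
  show "0 \<le> k" using T_sect by (simp add: sectorial_operator_with_def)
  fix e assume e: "e \<in> Domain Z"
  from sector_condition_free[OF T_sect e, of 0]
  show "0 \<le> quad \<omega> e" "\<bar>Im (\<omega> e e)\<bar> \<le> k * quad \<omega> e" by auto
qed

text \<open>Write \<open>x = (X - X\<^sub>0)e\<close>. Taking \<open>\<eta> = -x\<close> gives \<open>\<parallel>x\<parallel>\<^sup>2 \<le> Re \<omega>[e]\<close>. If the difference were small
  compared to \<open>\<parallel>x\<parallel>\<^sup>2\<close>, then the perturbation \<open>\<eta> = (-1 + is)x\<close> would change the imaginary part to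
  first order in \<open>s\<close> but the real part only to second order, which would leave the sector. Hence
  the difference controls \<open>\<parallel>x\<parallel>\<^sup>2\<close>.\<close>

lemma X_contraction:
  assumes T_sect: "sectorial_operator_with k T"
  shows "\<exists>\<delta>. 0 \<le> \<delta> \<and> \<delta> < 1 \<and> (\<forall>e\<in>Domain Z. (norm (X e - X\<^sub>0 e))\<^sup>2 \<le> \<delta>\<^sup>2 * quad \<omega> e)"
proof -
  have k: "k \<ge> 0" using T_sect by (simp add: sectorial_operator_with_def)
  obtain C where C: "C \<ge> 0" "\<And>x. x \<in> V \<Longrightarrow> norm (G x) \<le> C * norm x" using G_bounded by blast
  \<comment> \<open>small enough for the second order terms to cost at most half of the first order one\<close>
  define s where "s = 1 / (C + k + 1)"
  have s: "s > 0" "s * (C + k) \<le> 1" using C k by (auto simp: s_def)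
  define M where "M = 2 * k / s"
  have M: "M \<ge> 0" using k s by (simp add: M_def)
  have main: "(norm (X e - X\<^sub>0 e))\<^sup>2 \<le> M * (quad \<omega> e - (norm (X e - X\<^sub>0 e))\<^sup>2)" if e: "e \<in> Domain Z" for e
  proof -
    define x where "x = X e - X\<^sub>0 e"
    define n where "n = (norm x)\<^sup>2"
    define \<gamma> where "\<gamma> = Re (cinner (G x) x)"
    have x: "x \<in> V"
      unfolding x_def using X_V[OF e] X0_V dom_Z_D0_if_sectorial[OF T_sect] e by auto
    have Gx: "cinner (G x) x = complex_of_real \<gamma>"
      using G_real[OF x] by (simp add: \<gamma>_def complex_eq_iff)
    have xx: "cinner x x = complex_of_real n" by (simp add: n_def norm_cinner)
    have \<gamma>: "\<bar>\<gamma>\<bar> \<le> C * n"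
    proof -
      have "\<bar>\<gamma>\<bar> \<le> norm (G x) * norm x"
        unfolding \<gamma>_def using abs_Re_le_cmod cinner_Cauchy_Schwarz order_trans by blast
      also have "\<dots> \<le> C * norm x * norm x" using C x by (intro mult_right_mono) auto
      finally show ?thesis by (simp add: n_def power2_eq_square)
    qed
    have \<tau>: "cinner (c *\<^sub>C x + \<i> *\<^sub>C G (c *\<^sub>C x)) (c *\<^sub>C x) + 2 * cinner x (c *\<^sub>C x) + \<omega> e e
        = c * cnj c * (complex_of_real n + \<i> * complex_of_real \<gamma>) + 2 * cnj c * complex_of_real n + \<omega> e e" for c
      using x by (simp add: G_scale cinner_simps Gx xx algebra_simps)
    define \<tau>' where "\<tau>' c = c * cnj c * (complex_of_real n + \<i> * complex_of_real \<gamma>) + 2 * cnj c * complex_of_real n + \<omega> e e" for c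
    have sc: "0 \<le> Re (\<tau>' c)" "\<bar>Im (\<tau>' c)\<bar> \<le> k * Re (\<tau>' c)" for c
      using sector_condition_free[OF T_sect e memV(3)[OF x, of c], folded x_def, OF \<tau>[of c, symmetric]]
      unfolding \<tau>'_def by auto
    define r where "r = quad \<omega> e - n"
    have "Re (\<tau>' (-1)) = r" "Im (\<tau>' (-1)) = \<gamma> + Im (\<omega> e e)"
      by (simp_all add: \<tau>'_def r_def)
    then have 1: "0 \<le> r" "\<bar>\<gamma> + Im (\<omega> e e)\<bar> \<le> k * r" using sc[of "-1"] by auto
    define c where "c = Complex (-1) s"
    have cc: "c * cnj c = complex_of_real (1 + s\<^sup>2)"
      by (simp add: c_def complex_eq_iff power2_eq_square)
    have "Re (\<tau>' c) = r + s\<^sup>2 * n" "Im (\<tau>' c) = (1 + s\<^sup>2) * \<gamma> - 2 * s * n + Im (\<omega> e e)"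
      unfolding \<tau>'_def cc by (simp_all add: c_def r_def algebra_simps)
    then have 2: "\<bar>(1 + s\<^sup>2) * \<gamma> - 2 * s * n + Im (\<omega> e e)\<bar> \<le> k * (r + s\<^sup>2 * n)"
      using sc(2)[of c] by simp
    have "2 * s * n \<le> \<bar>\<gamma> + Im (\<omega> e e)\<bar> + s\<^sup>2 * \<bar>\<gamma>\<bar> + k * (r + s\<^sup>2 * n)"
    proof -
      have "s\<^sup>2 * \<gamma> \<le> s\<^sup>2 * \<bar>\<gamma>\<bar>" by (intro mult_left_mono) auto
      then show ?thesis using 2 by (simp add: algebra_simps)
    qed
    also have "\<dots> \<le> k * r + s\<^sup>2 * (C * n) + k * (r + s\<^sup>2 * n)"
      using 1 \<gamma> k by (intro add_mono mult_left_mono) auto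
    also have "\<dots> = 2 * k * r + s * (C + k) * (s * n)" by (simp add: algebra_simps power2_eq_square)
    also have "\<dots> \<le> 2 * k * r + 1 * (s * n)"
      using s mult_right_mono[OF s(2), of "s * n"] by (simp add: n_def)
    finally have "s * n \<le> 2 * k * r" by (simp add: mult_ac)
    then have "n \<le> 2 * k * r / s" using s(1) by (simp add: pos_le_divide_eq mult_ac)
    then have "n \<le> M * r" by (simp add: M_def)
    then show ?thesis by (simp add: n_def r_def x_def)
  qed
  define \<delta> where "\<delta> = sqrt (M / (1 + M))"
  have \<delta>2: "\<delta>\<^sup>2 = M / (1 + M)" using M by (simp add: \<delta>_def)
  have "0 \<le> \<delta>" "\<delta> < 1" using M by (auto simp: \<delta>_def)
  moreover have "(norm (X e - X\<^sub>0 e))\<^sup>2 \<le> \<delta>\<^sup>2 * quad \<omega> e" if "e \<in> Domain Z" for e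
  proof -
    have "(1 + M) * (norm (X e - X\<^sub>0 e))\<^sup>2 \<le> M * quad \<omega> e"
      using main[OF that] by (simp add: algebra_simps)
    then show ?thesis using M by (simp add: \<delta>2 field_simps)
  qed
  ultimately show ?thesis by blast
qed

lemma N'_triangle: "e \<in> Dom0 \<Longrightarrow> e' \<in> Dom0 \<Longrightarrow> N' (e + e') \<le> N' e + N' e'"
  using norm_triangle_ineq[of "(e, X\<^sub>0 e)" "(e', X\<^sub>0 e')"] by (simp add: N'_eq X0_lin)

lemma N'_scale: "e \<in> Dom0 \<Longrightarrow> N' (c *\<^sub>C e) = cmod c * N' e"
proof -
  assume "e \<in> Dom0"
  then have "N' (c *\<^sub>C e) = sqrt ((cmod c)\<^sup>2 * ((norm e)\<^sup>2 + (norm (X\<^sub>0 e))\<^sup>2))"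
    by (simp add: N'_eq X0_lin norm_prod_def power_mult_distrib algebra_simps)
  then show ?thesis by (simp add: N'_eq norm_prod_def real_sqrt_mult)
qed

text \<open>A null sequence of boundary values in \<open>\<H>'\<close> lifts to a null sequence in the domain of the
  extension along which \<open>\<xi>\<close> vanishes as well, so that closability is inherited from the operator.
  The gamma field maps the boundary values to a null sequence because it is bounded, and the
  components in \<open>D[S]\<close> are almost cancelled by elements of \<open>dom S\<close>.\<close>

lemma closable_\<omega>:
  assumes T_sect: "sectorial_operator_with k T"
  shows "closable_form (Domain Z) \<omega> k Dom0 N'"
proof -
  note sub = dom_Z_D0_if_sectorial[OF T_sect]
  note subD = subsetD[OF sub]
  interpret w: sect_form "Domain Z" \<omega> k by (rule sect_form_\<omega>[OF T_sect])
  interpret t: closable_form "Domain T" "operator_form T" k UNIV norm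
    by (rule closable_form_operator[OF T_sect])
  obtain \<delta> where \<delta>: "0 \<le> \<delta>" "\<delta> < 1" "\<And>e. e \<in> Domain Z \<Longrightarrow> (norm (X e - X\<^sub>0 e))\<^sup>2 \<le> \<delta>\<^sup>2 * quad \<omega> e"
    using X_contraction[OF T_sect] by blast
  have x_le: "(norm (X e - X\<^sub>0 e))\<^sup>2 \<le> quad \<omega> e" if "e \<in> Domain Z" for e
  proof -
    have "\<delta>\<^sup>2 * quad \<omega> e \<le> 1 * quad \<omega> e"
      using \<delta> w.Re_nonneg[OF that] by (intro mult_right_mono) (auto simp: power_le_one)
    then show ?thesis using \<delta>(3)[OF that] by simp
  qed
  obtain C where C: "C \<ge> 0" "\<And>x. x \<in> V \<Longrightarrow> norm (G x) \<le> C * norm x" using G_bounded by blast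
  have cl: "(\<lambda>n. \<omega> (e n) (e n)) \<longlonglongrightarrow> 0"
    if e: "\<And>n. e n \<in> Domain Z" and N0: "(\<lambda>n. N' (e n)) \<longlonglongrightarrow> 0" and ce: "form_cauchy \<omega> e" for e
  proof -
    have lims: "e \<longlonglongrightarrow> 0" "(\<lambda>n. X\<^sub>0 (e n)) \<longlonglongrightarrow> 0"
      using N'_tendsto[of e 0] subD[OF e] N0 clinear_on_0[OF X0_linear] by auto
    have ge: "(\<lambda>n. g (e n)) \<longlonglongrightarrow> 0" using g_tendsto[OF lims(1)] g_scale[of 0 0] by simp
    have "\<exists>v\<in>Domain T. \<Gamma> v = e n \<and> norm (v - g (e n)) \<le> inverse (real (Suc n))
        \<and> norm (\<xi> v - X\<^sub>0 (e n)) \<le> inverse (real (Suc n))" for n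
    proof -
      obtain u where u: "u \<in> Domain T" "e n = \<Gamma> u" using e[of n] unfolding dom_Z by blast
      have uL: "u \<in> L0" using u subD[OF e[of n]] T_L by (auto simp: L0_def)
      note uD = PF_D[OF L0D(1)[OF uL]]
      obtain \<phi> where \<phi>: "\<And>n. \<phi> n \<in> Domain S" "\<phi> \<longlonglongrightarrow> - PF u" "(\<lambda>n. Rf (\<phi> n)) \<longlonglongrightarrow> Rf (- PF u)"
        using core_R[of "- PF u"] uD by auto
      have pos: "0 < inverse (real (Suc n))" by simp
      have "eventually (\<lambda>j. dist (\<phi> j) (- PF u) < inverse (real (Suc n))) sequentially"
        using \<phi>(2) pos by (rule tendstoD)
      moreover have "eventually (\<lambda>j. dist (Rf (\<phi> j)) (Rf (- PF u)) < inverse (real (Suc n))) sequentially"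
        using \<phi>(3) pos by (rule tendstoD)
      ultimately obtain j where j: "dist (\<phi> j) (- PF u) < inverse (real (Suc n))"
        "dist (Rf (\<phi> j)) (Rf (- PF u)) < inverse (real (Suc n))"
        using eventually_happens'[OF sequentially_bot eventually_conj] by blast
      have \<phi>D: "\<phi> j \<in> D" by (rule dom_S_D[OF \<phi>(1)])
      have uT: "u + \<phi> j \<in> Domain T" using csubspace_add[OF csubspace_dom_T u(1) dom_S_T[OF \<phi>(1)]] .
      have 0: "\<Gamma> (u + \<phi> j) = e n"
        using \<Gamma>_lin(1)[OF L0D(1)[OF uL] D_L[OF \<phi>D]] \<Gamma>_D[OF \<phi>D] u(2) by simp
      have 1: "u + \<phi> j - g (e n) = \<phi> j - (- PF u)"
        using L_split[OF L0D(1)[OF uL]] u(2) by (metis add.commute add_diff_cancel_right' diff_add_eq diff_minus_eq_add)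
      have 2: "\<xi> (u + \<phi> j) - X\<^sub>0 (e n) = Rf (\<phi> j) - Rf (- PF u)"
        using \<xi>_lin(1)[OF uL D_L0[OF \<phi>D]] \<xi>_D[OF \<phi>D] u(2) clinear_on_uminus[OF Rf_linear uD]
        by (simp add: \<xi>_def)
      have "norm (u + \<phi> j - g (e n)) \<le> inverse (real (Suc n))"
        unfolding 1 using j(1) by (simp only: dist_norm less_imp_le)
      moreover have "norm (\<xi> (u + \<phi> j) - X\<^sub>0 (e n)) \<le> inverse (real (Suc n))"
        unfolding 2 using j(2) by (simp only: dist_norm less_imp_le)
      ultimately show ?thesis using uT 0 by blast
    qed
    then obtain v where v: "\<And>n. v n \<in> Domain T" "\<And>n. \<Gamma> (v n) = e n"
      "\<And>n. norm (v n - g (e n)) \<le> inverse (real (Suc n))"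
      "\<And>n. norm (\<xi> (v n) - X\<^sub>0 (e n)) \<le> inverse (real (Suc n))" by metis
    have vL: "v n \<in> L0" for n using v(1,2)[of n] subD[OF e] T_L by (auto simp: L0_def)
    have "(\<lambda>n. v n - g (e n)) \<longlonglongrightarrow> 0" "(\<lambda>n. \<xi> (v n) - X\<^sub>0 (e n)) \<longlonglongrightarrow> 0"
      by (rule Lim_null_comparison[OF always_eventually LIMSEQ_inverse_real_of_nat], use v in blast)+
    from tendsto_add[OF this(1) ge] tendsto_add[OF this(2) lims(2)]
    have v0: "v \<longlonglongrightarrow> 0" and \<xi>0: "(\<lambda>n. \<xi> (v n)) \<longlonglongrightarrow> 0" by auto
    have split: "cinner (op_app T u) u = cinner (\<xi> u + \<i> *\<^sub>C G (\<xi> u)) (\<xi> u)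
        + 2 * cinner (X (\<Gamma> u) - X\<^sub>0 (\<Gamma> u)) (\<xi> u) + \<omega> (\<Gamma> u) (\<Gamma> u)" if u: "u \<in> Domain T" for u
    proof -
      have eu: "\<Gamma> u \<in> Domain Z" using u dom_Z by blast
      then have uL: "u \<in> L0" using u subD T_L by (auto simp: L0_def)
      show ?thesis unfolding \<omega>_eq[OF u eu] by (rule T_split[OF u subD[OF eu] uL])
    qed
    have cv: "form_cauchy (operator_form T) v"
      unfolding t.form_cauchy_iff[OF v(1)]
    proof (rule null2_le)
      show "null2 (\<lambda>m n. 2 * ((norm (\<xi> (v m) - \<xi> (v n)))\<^sup>2 + quad \<omega> (e m - e n)))"
        using LIMSEQ_imp_Cauchy[OF \<xi>0] ce unfolding Cauchy_iff_null2 w.form_cauchy_iff[OF e]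
        by (intro null2_cmult null2_add) auto
      fix m n
      have d: "v m - v n \<in> Domain T" using csubspace_diff[OF csubspace_dom_T v(1) v(1)] .
      have \<Gamma>d: "\<Gamma> (v m - v n) = e m - e n" using \<Gamma>_lin(3)[OF L0D(1)[OF vL] L0D(1)[OF vL]] v(2) by simp
      have \<xi>d: "\<xi> (v m - v n) = \<xi> (v m) - \<xi> (v n)" using \<xi>_lin(3)[OF vL vL] .
      have ed: "e m - e n \<in> Domain Z" using e by simp
      show "Re (cinner (op_app T (v m - v n)) (v m - v n))
          \<le> 2 * ((norm (\<xi> (v m) - \<xi> (v n)))\<^sup>2 + quad \<omega> (e m - e n))"
        using coupled_form_bounds(2)[OF \<xi>_V[OF memL0(5)[OF vL vL]] w.Re_nonneg[OF ed] w.Im_le[OF ed]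
            w.K_nonneg \<delta>(1,2) \<delta>(3)[OF ed] C(2,1) split[OF d, unfolded \<Gamma>d]]
        unfolding \<xi>d .
    qed
    have T0: "(\<lambda>n. cinner (op_app T (v n)) (v n)) \<longlonglongrightarrow> 0"
      using t.closable[OF v(1) tendsto_norm_zero[OF v0] cv] .
    have x0: "(\<lambda>n. cinner (X (e n) - X\<^sub>0 (e n)) (\<xi> (v n))) \<longlonglongrightarrow> 0"
    proof -
      obtain B where B: "\<And>n. quad \<omega> (e n) \<le> B" using w.form_cauchy_bounded[OF e ce] by blast
      have "cmod (cinner (X (e n) - X\<^sub>0 (e n)) (\<xi> (v n))) \<le> sqrt B * norm (\<xi> (v n))" for n
      proof -
        have "norm (X (e n) - X\<^sub>0 (e n)) \<le> sqrt B"
          using x_le[OF e, of n] B[of n] by (intro real_le_rsqrt) simp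
        then show ?thesis
          using cinner_Cauchy_Schwarz[of "X (e n) - X\<^sub>0 (e n)" "\<xi> (v n)"]
            mult_right_mono[of "norm (X (e n) - X\<^sub>0 (e n))" "sqrt B" "norm (\<xi> (v n))"] by simp
      qed
      moreover have "(\<lambda>n. sqrt B * norm (\<xi> (v n))) \<longlonglongrightarrow> sqrt B * 0"
        by (intro tendsto_intros tendsto_norm_zero \<xi>0)
      ultimately show ?thesis
        by (rule_tac Lim_null_comparison[of _ "\<lambda>n. sqrt B * norm (\<xi> (v n))"]) (auto intro!: always_eventually)
    qed
    have "(\<lambda>n. cinner (\<xi> (v n) + \<i> *\<^sub>C G (\<xi> (v n))) (\<xi> (v n))) \<longlonglongrightarrow> cinner (0 + \<i> *\<^sub>C G 0) 0"
      by (intro tendsto_intros \<xi>0 G_tendsto \<xi>_V vL)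
    from tendsto_diff[OF tendsto_diff[OF T0 this] tendsto_mult[OF tendsto_const x0, of 2]]
    have "(\<lambda>n. cinner (op_app T (v n)) (v n) - cinner (\<xi> (v n) + \<i> *\<^sub>C G (\<xi> (v n))) (\<xi> (v n))
        - 2 * cinner (X (e n) - X\<^sub>0 (e n)) (\<xi> (v n))) \<longlonglongrightarrow> 0" by simp
    then show ?thesis unfolding split[OF v(1)] v(2) by simp
  qed
  show ?thesis
    by (intro closable_form.intro closable_form_axioms.intro w.sect_form_axioms csubspace_D0 sub
        N'_triangle N'_scale cl)
qed

end

section \<open>The closed form of a sectorial extension\<close>

lemma sect_form_cong:
  assumes t: "sect_form D t k" and eq: "\<And>u v. u \<in> D \<Longrightarrow> v \<in> D \<Longrightarrow> t' u v = t u v"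
  shows "sect_form D t' k"
proof -
  interpret sect_form D t k by (rule t)
  show ?thesis
  proof
    show "sesquilinear_on D t'" unfolding sesquilinear_on_def using csub by (simp add: eq expand)
  qed (simp_all add: eq Re_nonneg Im_le K_nonneg)
qed

lemma closed_form_cong:
  assumes t: "closed_form H N D t" and D: "csubspace D"
    and eq: "\<And>u v. u \<in> D \<Longrightarrow> v \<in> D \<Longrightarrow> t' u v = t u v"
  shows "closed_form H N D t'"
  unfolding closed_form_def
proof (intro conjI allI impI)
  show "D \<subseteq> H" using t by (simp add: closed_form_def)
  fix x u assume x: "(\<forall>n. x n \<in> D) \<and> u \<in> H \<and> form_conv N t' x u"
  have eq': "t' (y - z) (y - z) = t (y - z) (y - z)" if "y \<in> D" "z \<in> D" for y z
    using csubspace_diff[OF D that] by (rule_tac eq)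
  have "t' (x m - x n) (x m - x n) = t (x m - x n) (x m - x n)" for m n using x by (intro eq') auto
  then have "form_conv N t x u" using x by (simp add: form_conv_def)
  then have *: "u \<in> D" "(\<lambda>n. t (x n - u) (x n - u)) \<longlonglongrightarrow> 0"
    using t x unfolding closed_form_def by blast+
  show "u \<in> D" by (rule *)
  show "(\<lambda>n. t' (x n - u) (x n - u)) \<longlonglongrightarrow> 0" using * x by (simp add: eq')
qed

locale sectorial_extension = extension S R G K \<Gamma> Z X T Y
  for S R :: "('a::chilbert_space \<times> 'a) set" and G K and \<Gamma> :: "'a \<Rightarrow> 'h::chilbert_space"
    and Z X T Y +
  fixes k \<delta> :: real
  assumes sub: "Domain Z \<subseteq> D0 S R \<Gamma>"
    and closable: "closable_form (Domain Z) (omega S R G \<Gamma> Z X) k (D0 S R \<Gamma>) (H'_norm S R G \<Gamma>)"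
    and \<delta>: "0 \<le> \<delta>" "\<delta> < 1"
    and contraction: "\<And>e. e \<in> Domain Z \<Longrightarrow> (norm (X e - X0 S R G \<Gamma> e))\<^sup>2 \<le> \<delta>\<^sup>2 * Re (omega S R G \<Gamma> Z X e e)"
begin

sublocale w: closable_form "Domain Z" \<omega> k Dom0 N' by (rule closable)

abbreviation Db where "Db \<equiv> omega_bar_dom S R G \<Gamma> Z X"
abbreviation \<omega>b where "\<omega>b \<equiv> omega_bar S R G \<Gamma> Z X"

lemma Db_eq: "w.Dbar = Db" and \<omega>b_eq: "w.tbar = \<omega>b"
  by (simp_all add: omega_bar_dom_def omega_bar_def fun_eq_iff)

sublocale b: sect_form Db \<omega>b k
  using w.sect_form_closure unfolding Db_eq \<omega>b_eq .

lemma Db_D0: "e \<in> Db \<Longrightarrow> e \<in> Dom0"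
  using w.Dbar_subset Db_eq by auto

lemma Z_Db: "e \<in> Domain Z \<Longrightarrow> e \<in> Db"
  using w.in_Dbar_if Db_eq by simp

lemma convD:
  assumes "w.conv x e"
  shows "x n \<in> Domain Z" "x n \<in> Dom0" "e \<in> Dom0" "e \<in> Db" "x \<longlonglongrightarrow> e" "(\<lambda>n. X\<^sub>0 (x n)) \<longlonglongrightarrow> X\<^sub>0 e"
    "form_cauchy \<omega> x"
proof -
  have Z: "\<And>n. x n \<in> Domain Z" and e: "e \<in> Dom0" and c: "form_conv N' \<omega> x e" using assms by auto
  then have D0: "\<And>n. x n \<in> Dom0" using sub by blast
  show "x n \<in> Domain Z" "x n \<in> Dom0" "e \<in> Dom0" by (rule Z, rule D0, rule e)
  show "e \<in> Db" using w.in_Dbar[OF assms] Db_eq by simp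
  show "x \<longlonglongrightarrow> e" "(\<lambda>n. X\<^sub>0 (x n)) \<longlonglongrightarrow> X\<^sub>0 e" "form_cauchy \<omega> x"
    using c N'_tendsto[OF D0 e] by (auto simp: form_conv_iff)
qed

lemma Db_conv: "e \<in> Db \<Longrightarrow> \<exists>x. w.conv x e"
  using w.Dbar_conv Db_eq by simp

lemma norm_diff_le: "e \<in> Domain Z \<Longrightarrow> norm (X e - X\<^sub>0 e) \<le> sqrt (quad \<omega> e)"
proof -
  assume e: "e \<in> Domain Z"
  have "\<delta>\<^sup>2 * quad \<omega> e \<le> 1 * quad \<omega> e"
    using \<delta> w.Re_nonneg[OF e] by (intro mult_right_mono) (auto simp: power_le_one)
  then show ?thesis using contraction[OF e] by (intro real_le_rsqrt) simp
qed

text \<open>The contraction bounds \<open>X - X\<^sub>0\<close> by the form \<open>\<omega>\<close>, and \<open>X\<^sub>0\<close> is continuous on \<open>\<H>'\<close>.\<close>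

lemma X_null:
  assumes x: "\<And>n. x n \<in> Domain Z" and 0: "(\<lambda>n. X\<^sub>0 (x n)) \<longlonglongrightarrow> 0" "(\<lambda>n. quad \<omega> (x n)) \<longlonglongrightarrow> 0"
  shows "(\<lambda>n. X (x n)) \<longlonglongrightarrow> 0"
proof -
  have "(\<lambda>n. sqrt (quad \<omega> (x n))) \<longlonglongrightarrow> sqrt 0" by (intro tendsto_intros 0)
  then have "(\<lambda>n. X (x n) - X\<^sub>0 (x n)) \<longlonglongrightarrow> 0"
    using norm_diff_le[OF x]
    by (rule_tac Lim_null_comparison[of _ "\<lambda>n. sqrt (quad \<omega> (x n))"]) (auto intro!: always_eventually)
  from tendsto_add[OF this 0(1)] show ?thesis by simp
qed

lemma X_convergent:
  assumes c: "w.conv x e"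
  obtains y where "(\<lambda>n. X (x n)) \<longlonglongrightarrow> y"
proof -
  note x = convD[OF c]
  have "null2 (\<lambda>m n. (norm (X (x m) - X\<^sub>0 (x m) - (X (x n) - X\<^sub>0 (x n))))\<^sup>2)"
  proof (rule null2_le[OF x(7)[unfolded w.form_cauchy_iff[OF x(1)]]])
    fix m n
    have d: "x m - x n \<in> Domain Z" using x(1) by simp
    have "X (x m) - X\<^sub>0 (x m) - (X (x n) - X\<^sub>0 (x n)) = X (x m - x n) - X\<^sub>0 (x m - x n)"
      using clinear_on_diff[OF X_linear x(1) x(1)] X0_lin(3)[OF x(2) x(2)] by simp
    then show "(norm (X (x m) - X\<^sub>0 (x m) - (X (x n) - X\<^sub>0 (x n))))\<^sup>2 \<le> quad \<omega> (x m - x n)"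
      using power_mono[OF norm_diff_le[OF d], of 2] w.Re_nonneg[OF d] by simp
  qed
  from convergent_if_null2[OF this] obtain y where "(\<lambda>n. X (x n) - X\<^sub>0 (x n)) \<longlonglongrightarrow> y" by blast
  from tendsto_add[OF this x(6)] show thesis using that by simp
qed

text \<open>The continuous extension of \<open>X\<close>. The choice of the approximating sequence is immaterial.\<close>

definition Xc where "Xc e = lim (\<lambda>n. X ((SOME x. w.conv x e) n))"

lemma Xc_lim:
  assumes c: "w.conv x e"
  shows "(\<lambda>n. X (x n)) \<longlonglongrightarrow> Xc e"
proof -
  define y where "y = (SOME y. w.conv y e)"
  have cy: "w.conv y e" unfolding y_def by (rule someI[of "\<lambda>y. w.conv y e", OF c])
  have "(\<lambda>n. X (y n)) \<longlonglongrightarrow> Xc e"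
    unfolding Xc_def y_def[symmetric] using X_convergent[OF cy] limI by metis
  moreover have "(\<lambda>n. X (x n - y n)) \<longlonglongrightarrow> 0"
  proof (rule X_null)
    show "x n - y n \<in> Domain Z" for n using convD(1)[OF c] convD(1)[OF cy] by simp
    show "(\<lambda>n. X\<^sub>0 (x n - y n)) \<longlonglongrightarrow> 0"
      using tendsto_diff[OF convD(6)[OF c] convD(6)[OF cy]] convD(2)[OF c] convD(2)[OF cy]
      by (simp add: X0_lin)
    show "(\<lambda>n. quad \<omega> (x n - y n)) \<longlonglongrightarrow> 0" by (rule w.conv_unique[OF c cy])
  qed
  then have "(\<lambda>n. X (x n) - X (y n)) \<longlonglongrightarrow> 0"
    using clinear_on_diff[OF X_linear convD(1)[OF c] convD(1)[OF cy]] by simp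
  ultimately have "(\<lambda>n. (X (x n) - X (y n)) + X (y n)) \<longlonglongrightarrow> 0 + Xc e" by (rule tendsto_add[rotated])
  then show ?thesis by simp
qed

lemma is_X_bar_Xc: "is_X_bar S R G \<Gamma> Z X Xc"
  unfolding is_X_bar_def
proof (intro conjI ballI)
  show "clinear_on Db Xc"
    unfolding clinear_on_def
  proof (intro conjI ballI allI b.csub)
    fix e assume e: "e \<in> Db"
    then obtain x where x: "w.conv x e" using Db_conv by blast
    show "Xc (c *\<^sub>C e) = c *\<^sub>C Xc e" for c
    proof (rule LIMSEQ_unique[OF Xc_lim[OF w.conv_scale[OF x]]])
      show "(\<lambda>n. X (c *\<^sub>C x n)) \<longlonglongrightarrow> c *\<^sub>C Xc e"
        using tendsto_scaleC[OF tendsto_const Xc_lim[OF x], of c]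
        by (simp add: clinear_on_scaleC[OF X_linear convD(1)[OF x]])
    qed
    fix e' assume "e' \<in> Db"
    then obtain y where y: "w.conv y e'" using Db_conv by blast
    show "Xc (e + e') = Xc e + Xc e'"
    proof (rule LIMSEQ_unique[OF Xc_lim[OF w.conv_add[OF x y]]])
      show "(\<lambda>n. X (x n + y n)) \<longlonglongrightarrow> Xc e + Xc e'"
        using tendsto_add[OF Xc_lim[OF x] Xc_lim[OF y]]
        by (simp add: clinear_on_add[OF X_linear convD(1)[OF x] convD(1)[OF y]])
    qed
  qed
  show "Xc e = X e" if e: "e \<in> Domain Z" for e
    using Xc_lim[OF w.conv_const[OF e]] by (simp add: LIMSEQ_const_iff)
  have "norm (Xc e) \<le> 2 * sqrt ((N' e)\<^sup>2 + quad \<omega>b e)" if e: "e \<in> Db" for e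
  proof -
    obtain x where x: "w.conv x e" using e Db_conv by blast
    have nn: "0 \<le> quad \<omega>b e" by (rule b.Re_nonneg[OF e])
    have lim: "(\<lambda>n. \<omega> (x n) (x n)) \<longlonglongrightarrow> \<omega>b e e" using w.closure_form_lim[OF x x] \<omega>b_eq by simp
    have "norm (X (x n)) \<le> norm (X\<^sub>0 (x n)) + sqrt (quad \<omega> (x n))" for n
      using norm_diff_le[OF convD(1)[OF x]] norm_triangle_ineq2[of "X (x n)" "X\<^sub>0 (x n)"]
      by (smt (verit, best))
    moreover have L: "(\<lambda>n. norm (X\<^sub>0 (x n)) + sqrt (quad \<omega> (x n)) - norm (X (x n)))
        \<longlonglongrightarrow> norm (X\<^sub>0 e) + sqrt (quad \<omega>b e) - norm (Xc e)"
      by (intro tendsto_intros convD(6)[OF x] lim Xc_lim[OF x])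
    ultimately have "norm (Xc e) \<le> norm (X\<^sub>0 e) + sqrt (quad \<omega>b e)"
      using tendsto_lowerbound[OF L, of 0] by simp
    moreover have "norm (X\<^sub>0 e) \<le> sqrt ((N' e)\<^sup>2 + quad \<omega>b e)"
      using nn by (intro real_le_rsqrt) (simp add: N'_eq norm_prod_def)
    moreover have "sqrt (quad \<omega>b e) \<le> sqrt ((N' e)\<^sup>2 + quad \<omega>b e)" by simp
    ultimately show ?thesis by linarith
  qed
  then show "\<exists>C. \<forall>e\<in>Db. norm (Xc e) \<le> C * sqrt ((N' e)\<^sup>2 + quad \<omega>b e)" by blast
qed

context
  fixes Xb assumes Xb: "is_X_bar S R G \<Gamma> Z X Xb"
begin

lemma Xb_linear: "clinear_on Db Xb" and Xb_X: "e \<in> Domain Z \<Longrightarrow> Xb e = X e"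
  using Xb unfolding is_X_bar_def by blast+

lemma Xb_lim:
  assumes x: "w.conv x e"
  shows "(\<lambda>n. X (x n)) \<longlonglongrightarrow> Xb e"
proof -
  obtain C where C: "\<And>e. e \<in> Db \<Longrightarrow> norm (Xb e) \<le> C * sqrt ((N' e)\<^sup>2 + quad \<omega>b e)"
    using Xb unfolding is_X_bar_def by blast
  have N0: "(\<lambda>n. N' (x n - e)) \<longlonglongrightarrow> 0" using x by (simp add: form_conv_iff)
  have "(\<lambda>n. quad \<omega>b (x n - e)) \<longlonglongrightarrow> 0"
    using tendsto_Re[OF w.conv_tbar[OF x]] \<omega>b_eq by simp
  then have "(\<lambda>n. C * sqrt ((N' (x n - e))\<^sup>2 + quad \<omega>b (x n - e))) \<longlonglongrightarrow> C * sqrt (0\<^sup>2 + 0)"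
    by (intro tendsto_intros N0)
  moreover have "norm (Xb (x n - e)) \<le> C * sqrt ((N' (x n - e))\<^sup>2 + quad \<omega>b (x n - e))" for n
    using convD(4)[OF x] Z_Db[OF convD(1)[OF x]] by (intro C) simp
  ultimately have "(\<lambda>n. Xb (x n - e)) \<longlonglongrightarrow> 0"
    by (rule_tac Lim_null_comparison[of _ "\<lambda>n. C * sqrt ((N' (x n - e))\<^sup>2 + quad \<omega>b (x n - e))"])
      (auto intro!: always_eventually)
  moreover have "Xb (x n - e) = X (x n) - Xb e" for n
    using clinear_on_diff[OF Xb_linear Z_Db[OF convD(1)[OF x]] convD(4)[OF x]] Xb_X[OF convD(1)[OF x]] by simp
  ultimately show ?thesis by (simp add: LIM_zero_iff)
qed

lemma Xb_contraction:
  assumes e: "e \<in> Db"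
  shows "(norm (Xb e - X\<^sub>0 e))\<^sup>2 \<le> \<delta>\<^sup>2 * quad \<omega>b e"
proof -
  obtain x where x: "w.conv x e" using e Db_conv by blast
  have lim: "(\<lambda>n. \<omega> (x n) (x n)) \<longlonglongrightarrow> \<omega>b e e" using w.closure_form_lim[OF x x] \<omega>b_eq by simp
  have "(\<lambda>n. \<delta>\<^sup>2 * quad \<omega> (x n) - (norm (X (x n) - X\<^sub>0 (x n)))\<^sup>2)
      \<longlonglongrightarrow> \<delta>\<^sup>2 * quad \<omega>b e - (norm (Xb e - X\<^sub>0 e))\<^sup>2"
    by (intro tendsto_intros convD(6)[OF x] lim Xb_lim[OF x])
  from tendsto_lowerbound[OF this, of 0] contraction[OF convD(1)[OF x]] show ?thesis by simp
qed

text \<open>On its domain \<open>\<sigma>\<close> is the form claimed for the extension, rewritten in terms of \<open>\<xi>\<close>; in this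
  shape the bounds for coupled forms apply.\<close>

definition DT where "DT = {u \<in> L. \<Gamma> u \<in> Db}"
definition \<sigma> where "\<sigma> u v = cinner (\<xi> u + \<i> *\<^sub>C G (\<xi> u)) (\<xi> v)
  + 2 * cinner (Xb (\<Gamma> u) - X\<^sub>0 (\<Gamma> u)) (\<xi> v) + \<omega>b (\<Gamma> u) (\<Gamma> v)"

lemma DT_D: "u \<in> DT \<Longrightarrow> u \<in> L" "u \<in> DT \<Longrightarrow> \<Gamma> u \<in> Db" "u \<in> DT \<Longrightarrow> u \<in> L0" "u \<in> DT \<Longrightarrow> \<Gamma> u \<in> Dom0"
  using Db_D0 by (auto simp: DT_def L0_def)

lemma D_DT: "u \<in> D \<Longrightarrow> u \<in> DT"
  by (simp add: DT_def D_L \<Gamma>_D)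

lemma csubspace_DT: "csubspace DT"
  unfolding csubspace_def DT_def by (auto simp: \<Gamma>_lin \<Gamma>_D)

lemma \<sigma>_eq:
  assumes u: "u \<in> DT" and v: "v \<in> DT"
  shows "l_form S u v + Z_form S R G \<Gamma> Z X Xb (\<Gamma> u) (\<Gamma> v) + 2 * cinner (Xb (\<Gamma> u)) (Rf (PF v)) = \<sigma> u v"
proof -
  have 1: "form_adj \<Omega> (\<Gamma> u) (\<Gamma> v) = 2 * cinner (X\<^sub>0 (\<Gamma> u)) (X\<^sub>0 (\<Gamma> v)) - \<Omega> (\<Gamma> u) (\<Gamma> v)"
    using Omega_adj[OF DT_D(4)[OF u] DT_D(4)[OF v]] by (simp add: algebra_simps)
  have 2: "cinner y (\<xi> v) = cinner y (Rf (PF v)) + cinner y (X\<^sub>0 (\<Gamma> v))" for y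
    by (simp add: \<xi>_def cinner_simps)
  show ?thesis
    unfolding l_form_eq[OF DT_D(3)[OF u] DT_D(3)[OF v]] Z_form_def \<sigma>_def 1
    by (simp add: cinner_diff_left 2[of "Xb (\<Gamma> u)"] 2[of "X\<^sub>0 (\<Gamma> u)"] algebra_simps)
qed

lemma \<sigma>_bounds:
  obtains A where "A \<ge> 0" "\<And>u. u \<in> DT \<Longrightarrow> (1 - \<delta>) * ((norm (\<xi> u))\<^sup>2 + quad \<omega>b (\<Gamma> u)) \<le> quad \<sigma> u"
    "\<And>u. u \<in> DT \<Longrightarrow> quad \<sigma> u \<le> 2 * ((norm (\<xi> u))\<^sup>2 + quad \<omega>b (\<Gamma> u))"
    "\<And>u. u \<in> DT \<Longrightarrow> \<bar>Im (\<sigma> u u)\<bar> \<le> A * ((norm (\<xi> u))\<^sup>2 + quad \<omega>b (\<Gamma> u))"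
proof -
  obtain C where C: "C \<ge> 0" "\<And>x. x \<in> V \<Longrightarrow> norm (G x) \<le> C * norm x" using G_bounded by blast
  note bd = coupled_form_bounds[OF \<xi>_V[OF DT_D(3)] b.Re_nonneg[OF DT_D(2)] b.Im_le[OF DT_D(2)]
      b.K_nonneg \<delta> Xb_contraction[OF DT_D(2)] C(2,1) \<sigma>_def]
  show thesis using bd C(1) b.K_nonneg by (intro that[of "C + 1 + k"]) auto
qed

lemma \<sigma>_sect: "\<exists>A. sect_form DT \<sigma> A"
proof -
  obtain A where A: "A \<ge> 0" and bd: "\<And>u. u \<in> DT \<Longrightarrow> (1 - \<delta>) * ((norm (\<xi> u))\<^sup>2 + quad \<omega>b (\<Gamma> u)) \<le> quad \<sigma> u"
    "\<And>u. u \<in> DT \<Longrightarrow> \<bar>Im (\<sigma> u u)\<bar> \<le> A * ((norm (\<xi> u))\<^sup>2 + quad \<omega>b (\<Gamma> u))"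
    using \<sigma>_bounds by metis
  have "sect_form DT \<sigma> (A / (1 - \<delta>))"
  proof
    show "sesquilinear_on DT \<sigma>"
      unfolding sesquilinear_on_def
      using csubspace_DT
      by (simp add: \<sigma>_def DT_D \<Gamma>_lin \<xi>_lin X0_lin clinear_on_add[OF Xb_linear]
          clinear_on_scaleC[OF Xb_linear] G_add G_scale \<xi>_V b.expand cinner_simps algebra_simps)
    fix u assume u: "u \<in> DT"
    let ?q = "(norm (\<xi> u))\<^sup>2 + quad \<omega>b (\<Gamma> u)"
    have q: "?q \<ge> 0" using b.Re_nonneg[OF DT_D(2)[OF u]] by simp
    have q': "(1 - \<delta>) * ?q \<ge> 0" using q \<delta> by (intro mult_nonneg_nonneg) auto
    then show "0 \<le> quad \<sigma> u" using bd(1)[OF u] by linarith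
    have "\<bar>Im (\<sigma> u u)\<bar> \<le> A / (1 - \<delta>) * ((1 - \<delta>) * ?q)" using bd(2)[OF u] \<delta> by simp
    also have "\<dots> \<le> A / (1 - \<delta>) * quad \<sigma> u"
      using bd(1)[OF u] A \<delta> by (intro mult_left_mono) auto
    finally show "\<bar>Im (\<sigma> u u)\<bar> \<le> A / (1 - \<delta>) * quad \<sigma> u" .
  qed (use A \<delta> in auto)
  then show ?thesis by blast
qed

text \<open>A Cauchy sequence for \<open>\<sigma>\<close> is one for \<open>\<xi>\<close> and for the closure of \<open>\<omega>\<close> separately. Closedness of
  \<open>\<xi>\<close> yields convergence of the boundary values in \<open>\<H>'\<close>, after which the closure of \<open>\<omega>\<close> takes over.\<close>

lemma \<sigma>_closed: "closed_form UNIV norm DT \<sigma>"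
  unfolding closed_form_def
proof (intro conjI allI impI subset_UNIV)
  obtain A where "sect_form DT \<sigma> A" using \<sigma>_sect by blast
  then interpret \<sigma>: sect_form DT \<sigma> A .
  obtain A' where lo: "\<And>u. u \<in> DT \<Longrightarrow> (1 - \<delta>) * ((norm (\<xi> u))\<^sup>2 + quad \<omega>b (\<Gamma> u)) \<le> quad \<sigma> u"
    and up: "\<And>u. u \<in> DT \<Longrightarrow> quad \<sigma> u \<le> 2 * ((norm (\<xi> u))\<^sup>2 + quad \<omega>b (\<Gamma> u))"
    using \<sigma>_bounds by blast
  fix x u assume *: "(\<forall>n. x n \<in> DT) \<and> u \<in> UNIV \<and> form_conv norm \<sigma> x u"
  then have x: "\<And>n. x n \<in> DT" and c: "form_cauchy \<sigma> x" and xu: "x \<longlonglongrightarrow> u"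
    by (auto simp: form_conv_iff tendsto_norm_zero_iff LIM_zero_iff)
  have d: "\<xi> (x m - x n) = \<xi> (x m) - \<xi> (x n)" "\<Gamma> (x m - x n) = \<Gamma> (x m) - \<Gamma> (x n)" for m n
    using x DT_D by (simp_all add: \<xi>_lin \<Gamma>_lin)
  have both: "null2 (\<lambda>m n. (norm (\<xi> (x m) - \<xi> (x n)))\<^sup>2 + quad \<omega>b (\<Gamma> (x m) - \<Gamma> (x n)))"
  proof (rule null2_le)
    show "null2 (\<lambda>m n. 1 / (1 - \<delta>) * quad \<sigma> (x m - x n))"
      using c \<delta> unfolding \<sigma>.form_cauchy_iff[OF x] by (intro null2_cmult) auto
    show "(norm (\<xi> (x m) - \<xi> (x n)))\<^sup>2 + quad \<omega>b (\<Gamma> (x m) - \<Gamma> (x n)) \<le> 1 / (1 - \<delta>) * quad \<sigma> (x m - x n)" for m n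
      using lo[of "x m - x n"] x \<delta> unfolding d by (simp add: field_simps)
  qed
  have nn: "0 \<le> quad \<omega>b (\<Gamma> (x m) - \<Gamma> (x n))" for m n
    using DT_D(2)[OF x] by (intro b.Re_nonneg) simp
  have "null2 (\<lambda>m n. (norm (\<xi> (x m) - \<xi> (x n)))\<^sup>2)" using nn by (intro null2_le[OF both]) simp
  from convergent_if_null2[OF this] obtain y where y: "(\<lambda>n. \<xi> (x n)) \<longlonglongrightarrow> y" by blast
  note cl = \<xi>_closed[OF DT_D(3)[OF x] xu y]
  have cb: "form_cauchy \<omega>b (\<lambda>n. \<Gamma> (x n))"
    unfolding b.form_cauchy_iff[OF DT_D(2)[OF x]] by (intro null2_le[OF both]) simp
  have e: "\<Gamma> u \<in> Dom0" by (rule L0D(2)[OF cl(1)])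
  have "(\<lambda>n. N' (\<Gamma> (x n) - \<Gamma> u)) \<longlonglongrightarrow> 0"
    using N'_tendsto[OF DT_D(4)[OF x] e] cl(3,4) by simp
  then have fc: "form_conv N' \<omega>b (\<lambda>n. \<Gamma> (x n)) (\<Gamma> u)" using cb by (simp add: form_conv_iff)
  have cf: "closed_form Dom0 N' Db \<omega>b" using w.closed_closure unfolding Db_eq \<omega>b_eq .
  have "\<Gamma> u \<in> Db \<and> (\<lambda>n. \<omega>b (\<Gamma> (x n) - \<Gamma> u) (\<Gamma> (x n) - \<Gamma> u)) \<longlonglongrightarrow> 0"
    using cf[unfolded closed_form_def, THEN conjunct2, rule_format, of "\<lambda>n. \<Gamma> (x n)" "\<Gamma> u"]
      fc e DT_D(2)[OF x] by simp
  then have bl: "\<Gamma> u \<in> Db" "(\<lambda>n. \<omega>b (\<Gamma> (x n) - \<Gamma> u) (\<Gamma> (x n) - \<Gamma> u)) \<longlonglongrightarrow> 0" by auto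
  show u: "u \<in> DT" using cl(1) bl(1) by (simp add: DT_def L0_def)
  have du: "\<xi> (x n - u) = \<xi> (x n) - y" "\<Gamma> (x n - u) = \<Gamma> (x n) - \<Gamma> u" for n
    using x u DT_D cl(2) by (simp_all add: \<xi>_lin \<Gamma>_lin)
  have "(\<lambda>n. (norm (\<xi> (x n) - y))\<^sup>2) \<longlonglongrightarrow> 0" using y by (simp add: norm_sq_null_iff LIM_zero_iff)
  then have "(\<lambda>n. 2 * ((norm (\<xi> (x n - u)))\<^sup>2 + quad \<omega>b (\<Gamma> (x n - u)))) \<longlonglongrightarrow> 2 * (0 + 0)"
    unfolding du using tendsto_Re[OF bl(2)] by (intro tendsto_intros) auto
  moreover have xuD: "x n - u \<in> DT" for n using x u by simp
  ultimately have "(\<lambda>n. quad \<sigma> (x n - u)) \<longlonglongrightarrow> 0"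
    using up[OF xuD] \<sigma>.Re_nonneg[OF xuD]
    by (rule_tac Lim_null_comparison[of _ "\<lambda>n. 2 * ((norm (\<xi> (x n - u)))\<^sup>2 + quad \<omega>b (\<Gamma> (x n - u)))"])
      (auto intro!: always_eventually)
  then show "(\<lambda>n. \<sigma> (x n - u) (x n - u)) \<longlonglongrightarrow> 0"
    using \<sigma>.form_null_iff[OF xuD] by simp
qed

text \<open>The boundary value of \<open>v\<close> is approximated within the domain of the relation, where the
  identity is the splitting of the form; the limit uses continuity of the gamma field and of \<open>X\<^sub>0\<close>.\<close>

lemma T_\<sigma>:
  assumes u: "u \<in> Domain T" and v: "v \<in> DT"
  shows "cinner (op_app T u) v = \<sigma> u v"
proof -
  have e: "\<Gamma> u \<in> Domain Z" using u dom_Z by blast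
  have eD: "\<Gamma> u \<in> Dom0" using e sub by blast
  obtain y where y: "w.conv y (\<Gamma> v)" using DT_D(2)[OF v] Db_conv by blast
  let ?b = "\<lambda>h. cinner (Y u) h - (\<i> * cinner (g (\<Gamma> u)) (g h) + cinner (X\<^sub>0 (\<Gamma> u) + \<i> *\<^sub>C G (X\<^sub>0 (\<Gamma> u))) (X\<^sub>0 h))
      - 2 * cinner (X (\<Gamma> u) - X\<^sub>0 (\<Gamma> u)) (X\<^sub>0 h)"
  have "(\<lambda>n. \<omega> (\<Gamma> u) (y n)) \<longlonglongrightarrow> \<omega>b (\<Gamma> u) (\<Gamma> v)"
    using w.closure_form_lim[OF w.conv_const[OF e] y] \<omega>b_eq by simp
  moreover have "\<omega> (\<Gamma> u) (y n) = ?b (y n)" for n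
    unfolding \<omega>_eq[OF u convD(1)[OF y]] Omega_eq[OF eD convD(2)[OF y]] ..
  moreover have "(\<lambda>n. ?b (y n)) \<longlonglongrightarrow> ?b (\<Gamma> v)"
    by (intro tendsto_intros convD(5,6)[OF y] g_tendsto)
  ultimately have "\<omega>b (\<Gamma> u) (\<Gamma> v) = ?b (\<Gamma> v)" using LIMSEQ_unique by simp
  then show ?thesis
    unfolding \<sigma>_def T_split[OF u eD DT_D(3)[OF v]] Omega_eq[OF eD DT_D(4)[OF v]] Xb_X[OF e] by simp
qed

lemma associated_form_\<sigma>:
  "associated_form T {u \<in> LL S. \<Gamma> u \<in> omega_bar_dom S R G \<Gamma> Z X}
     (\<lambda>u v. l_form S u v + Z_form S R G \<Gamma> Z X Xb (\<Gamma> u) (\<Gamma> v)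
        + 2 * cinner (Xb (\<Gamma> u)) (op_app R (projF S \<i> v)))"
  unfolding associated_form_def DT_def[symmetric] sectorial_form_iff
proof (intro conjI ballI)
  obtain A where A: "sect_form DT \<sigma> A" using \<sigma>_sect by blast
  show "\<exists>A. sect_form DT (\<lambda>u v. l_form S u v + Z_form S R G \<Gamma> Z X Xb (\<Gamma> u) (\<Gamma> v)
        + 2 * cinner (Xb (\<Gamma> u)) (Rf (PF v))) A"
    using sect_form_cong[OF A \<sigma>_eq] by blast
  show "closed_form UNIV norm DT (\<lambda>u v. l_form S u v + Z_form S R G \<Gamma> Z X Xb (\<Gamma> u) (\<Gamma> v)
        + 2 * cinner (Xb (\<Gamma> u)) (Rf (PF v)))"
    by (rule closed_form_cong[OF \<sigma>_closed csubspace_DT \<sigma>_eq])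
  show "closure DT = UNIV" using closure_D closure_mono[of D DT] D_DT by auto
  have "\<Gamma> u \<in> Db" if "u \<in> Domain T" for u using Z_Db that unfolding dom_Z by blast
  then show sub: "Domain T \<subseteq> DT" using T_L unfolding DT_def by blast
  show "cinner (op_app T u) v = l_form S u v + Z_form S R G \<Gamma> Z X Xb (\<Gamma> u) (\<Gamma> v)
        + 2 * cinner (Xb (\<Gamma> u)) (Rf (PF v))" if "u \<in> Domain T" "v \<in> DT" for u v
    unfolding \<sigma>_eq[OF subsetD[OF sub that(1)] that(2)] by (rule T_\<sigma>[OF that])
qed

end

end

theorem theorem3p8:
  fixes S R T :: "('a::chilbert_space \<times> 'a) set"
    and G :: "'a \<Rightarrow> 'a"
    and \<Gamma> :: "'a \<Rightarrow> 'h::chilbert_space"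
    and Z :: "('h \<times> 'h) set"
    and X :: "'h \<Rightarrow> 'a"
    and \<alpha> :: real
  assumes "0 \<le> \<alpha>" "\<alpha> < pi / 2"
    and "linear_operator S" "densely_defined S" "closed S" "sectorial_angle_op \<alpha> S"
    and "is_sqrt_op (S_FR S) R"
    and "is_GF S R G"
    and "boundary_pair S R \<Gamma>"
    and "admissible_pair S Z X"
    and "m_accretive_op T" "S \<subseteq> T" "corresponds S R \<Gamma> Z X T"
  shows
    "(m_sectorial_op T \<longleftrightarrow>
        Domain Z \<subseteq> D0 S R \<Gamma>
      \<and> sectorial_form (Domain Z) (omega S R G \<Gamma> Z X)
      \<and> admits_closure (D0 S R \<Gamma>) (H'_norm S R G \<Gamma>) (Domain Z) (omega S R G \<Gamma> Z X)
      \<and> (\<exists>\<delta>. 0 \<le> \<delta> \<and> \<delta> < 1 \<and> (\<forall>e\<in>Domain Z.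
            (norm (X e - X0 S R G \<Gamma> e))\<^sup>2 \<le> \<delta>\<^sup>2 * Re (omega S R G \<Gamma> Z X e e))))
   \<and> Domain Z = \<Gamma> ` Domain T
   \<and> (Domain Z \<subseteq> D0 S R \<Gamma> \<longrightarrow> (\<forall>e\<in>Domain Z. \<forall>g\<in>Domain Z.
        omega S R G \<Gamma> Z X e g = rel_form Z e g + form_adj (Omega0 S R G \<Gamma>) e g
          - 2 * cinner (X e) (X0 S R G \<Gamma> g)))
   \<and> (m_sectorial_op T \<longrightarrow>
        (\<exists>Xb. is_X_bar S R G \<Gamma> Z X Xb)
      \<and> (\<forall>Xb. is_X_bar S R G \<Gamma> Z X Xb \<longrightarrow>
           associated_form T {u \<in> LL S. \<Gamma> u \<in> omega_bar_dom S R G \<Gamma> Z X}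
             (\<lambda>u v. l_form S u v + Z_form S R G \<Gamma> Z X Xb (\<Gamma> u) (\<Gamma> v)
                + 2 * cinner (Xb (\<Gamma> u)) (op_app R (projF S \<i> v)))))"
proof -
  obtain K where "sectorial_operator_with K S"
    using ex_sectorial_angle_op_iff[OF assms(3)] assms(1,2,6) by blast
  moreover obtain Y where "clinear_on (Domain T) Y" "Z = {(\<Gamma> u, Y u) | u. u \<in> Domain T}"
    "\<forall>u\<in>Domain T. \<forall>v\<in>LL S. cinner (op_app T u) v = l_form S u v + cinner (Y u) (\<Gamma> v)
        + 2 * cinner (X (\<Gamma> u)) (op_app R (projF S \<i> v))" "Domain T \<subseteq> LL S"
    using assms(13) unfolding corresponds_def by blast
  moreover have T_linear: "linear_operator T" using assms(11) by (simp add: m_accretive_op_def)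
  ultimately interpret extension S R G K \<Gamma> Z X T Y
    using assms by unfold_locales auto
  have m_sect: "m_sectorial_op T \<longleftrightarrow> (\<exists>k. sectorial_operator_with k T)"
    unfolding m_sectorial_op_def ex_sectorial_angle_op_iff[OF T_linear] using assms(11) by blast
  have "Domain Z \<subseteq> Dom0 \<and> sectorial_form (Domain Z) \<omega> \<and> admits_closure Dom0 N' (Domain Z) \<omega>
      \<and> (\<exists>\<delta>. 0 \<le> \<delta> \<and> \<delta> < 1 \<and> (\<forall>e\<in>Domain Z. (norm (X e - X\<^sub>0 e))\<^sup>2 \<le> \<delta>\<^sup>2 * Re (\<omega> e e)))"
    if "sectorial_operator_with k T" for k
    using dom_Z_D0_if_sectorial[OF that] sect_form_\<omega>[OF that] X_contraction[OF that]
      closable_form.admits_closure[OF closable_\<omega>[OF that]] sectorial_form_iff by blast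
  moreover have "\<exists>k. sectorial_operator_with k T"
    if "Domain Z \<subseteq> Dom0" "sectorial_form (Domain Z) \<omega>" "0 \<le> \<delta>" "\<delta> < 1"
      "\<forall>e\<in>Domain Z. (norm (X e - X\<^sub>0 e))\<^sup>2 \<le> \<delta>\<^sup>2 * Re (\<omega> e e)" for \<delta>
    using that sectorial_if[of _ \<delta>] sectorial_form_iff by blast
  moreover have "(\<exists>Xb. is_X_bar S R G \<Gamma> Z X Xb)
      \<and> (\<forall>Xb. is_X_bar S R G \<Gamma> Z X Xb \<longrightarrow>
           associated_form T {u \<in> LL S. \<Gamma> u \<in> omega_bar_dom S R G \<Gamma> Z X}
             (\<lambda>u v. l_form S u v + Z_form S R G \<Gamma> Z X Xb (\<Gamma> u) (\<Gamma> v)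
                + 2 * cinner (Xb (\<Gamma> u)) (op_app R (projF S \<i> v))))"
    if T_sect: "sectorial_operator_with k T" for k
  proof -
    obtain \<delta> where "0 \<le> \<delta>" "\<delta> < 1" "\<forall>e\<in>Domain Z. (norm (X e - X\<^sub>0 e))\<^sup>2 \<le> \<delta>\<^sup>2 * Re (\<omega> e e)"
      using X_contraction[OF T_sect] by blast
    then interpret sectorial_extension S R G K \<Gamma> Z X T Y k \<delta>
      using dom_Z_D0_if_sectorial[OF T_sect] closable_\<omega>[OF T_sect]
      by (intro sectorial_extension.intro extension_axioms sectorial_extension_axioms.intro) auto
    show ?thesis using is_X_bar_Xc associated_form_\<sigma> by blast
  qed
  ultimately show ?thesis
    unfolding m_sect using dom_Z \<omega>_alt by blast
qed

end
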